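(* Let $\mathcal{X}$ and $\Theta$ be complete separable metric spaces with their Borel $\sigma$-fields, and let $\{P_\theta:\theta\in\Theta\}$ be a family of probability measures on $\mathcal{X}$ such that the map $\theta\mapsto P_\theta$ is one-to-one and Borel. Given $\theta$, let $X_1,X_2,\ldots$ be i.i.d. with distribution $P_\theta$. Given a family of priors $\{\Pi(\cdot|\lambda):\lambda\in\Lambda\}$ on $\Theta$ and an estimator $\hat\lambda_n=\hat\lambda_n(X_1,\ldots,X_n)$, let $\Pi_{n,\hat\lambda_n}$ be the empirical Bayes posterior. (a) The empirical Bayes posterior is weakly consistent at every $\theta\in\Theta$ if and only if, for every prior probability measure $q$ on $\Theta$, the empirical Bayes posterior $\Pi_{n,\hat\lambda_n}$ and the Bayes posterior $q_n$ weakly merge as $n\to\infty$, with $P_q$-probability $1$. (b) Suppose moreover that the map $\theta\mapsto P_\theta$ is continuous and has continuous inverse. Then the empirical Bayes posterior is weakly consistent at every $\theta\in\Theta$ if and only if, for every prior probability measure $q$ on $\Theta$, the predictive distributions $P_{\Pi_{n,\hat\lambda_n}}$ and $P_{q_n}$ weakly merge with $P_q$-probability $1$, that is, $$\forall f\in C_B(\mathcal{X}^\infty),\qquad \left|\int_{\mathcal{X}^\infty} f\,\mathrm{d}\bigl(P_{\Pi_{n,\hat\lambda_n}}-P_{q_n}\bigr)\right|\to 0\quad\text{a.s. }[P_q].$$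
   Context: $P_\theta^\infty$ is the infinite product measure of $P_\theta$ on $\mathcal{X}^\infty$. Probability measures on $\mathcal X$ are given the topology of weak convergence (and its Borel $\sigma$-field); continuity of $\theta\mapsto P_\theta$ and of its inverse (defined on its image) refers to this topology. $C_B(\mathcal{X}^\infty)$ is the set of bounded continuous real functions on $\mathcal{X}^\infty$ (product topology). For a prior $q$ on $\Theta$, $P_q$ is the joint law on $\Theta\times\mathcal{X}^\infty$ of the parameter and the data: $P_q(A\times B)=\int_A P_\theta^\infty(B)\,\mathrm{d}q(\theta)$ for Borel $A\subseteq\Theta$, $B\subseteq\mathcal{X}^\infty$. $q_n$ is the posterior distribution of $\theta$ given $X_1,\ldots,X_n$ under $P_q$ (a version of the conditional distribution). The empirical Bayes posterior $\Pi_{n,\hat\lambda_n}=\Pi(\cdot|\hat\lambda_n,X_1,\ldots,X_n)$ is obtained from the posterior $\Pi(\cdot|\lambda,X_1,\ldots,X_n)$ corresponding to the prior $\Pi(\cdot|\lambda)$ by plugging in $\lambda=\hat\lambda_n(X_1,\ldots,X_n)$; when $P_\theta^{(n)}$ (the law of $(X_1,\dots,X_n)$ given $\theta$) has density $p_\theta^{(n)}$ with respect to a common $\sigma$-finite measure it is $\Pi(B|\hat\lambda_n,X_{1:n})=\int_B p_\theta^{(n)}(X_{1:n})\,\mathrm{d}\Pi(\theta|\hat\lambda_n)\big/\int_\Theta p_\theta^{(n)}(X_{1:n})\,\mathrm{d}\Pi(\theta|\hat\lambda_n)$. The estimator takes values in the closure of $\Lambda$; for $\lambda_0$ in the boundary,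 $\Pi(\cdot|\lambda_0)$ is the weak limit of $\Pi(\cdot|\lambda)$ as $\lambda\to\lambda_0$, when it exists. The empirical Bayes posterior is assumed well defined: it is a probability measure on $\Theta$ for all large $n$, $P_\theta^\infty$-almost surely, for all $\theta$. The usual measurability is assumed. For any (Bayes or empirical Bayes) posterior $\Pi_n$, the predictive distribution of all future observations $X_{n+1},X_{n+2},\ldots$ given $X_1,\ldots,X_n$ is $P_{\Pi_n}(\cdot)=\int_\Theta P_\theta^\infty(\cdot)\,\mathrm{d}\Pi_n(\theta)$. A sequence of (data-dependent) posteriors $\Pi_n$ is weakly consistent at $\theta$ if, for every neighborhood $W$ of $\theta$ in $\Theta$, $\Pi_n(W^c)\to0$ a.s. $[P_\theta^\infty]$. Two sequences of probability measures $p_n,q_n$ on the same space merge weakly if $|\int g\,\mathrm{d}p_n-\int g\,\mathrm{d}q_n|\to0$ for all bounded continuous $g$. *)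

theory Defs
  imports "HOL-Probability.Probability"
begin

text \<open>The space of probability measures carries the coarsest topology making every map
  \<open>M \<mapsto> (\<integral>x. f x \<partial>M)\<close>, with \<open>f\<close> bounded and continuous, continuous.\<close>

definition weak_topology :: "'a::topological_space measure topology" where
  "weak_topology = topology_generated_by
     {{M \<in> space (prob_algebra borel). (\<integral>x. f x \<partial>M) \<in> U} | (f :: 'a \<Rightarrow> real) U.
        continuous_on UNIV f \<and> bounded (range f) \<and> open U}"

lemma topspace_weak_topology [simp]: "topspace weak_topology = space (prob_algebra borel)"
  unfolding weak_topology_def topology_generated_by_topspace
proof (intro equalityI subsetI)
  fix M :: "'a measure" assume M: "M \<in> space (prob_algebra borel)"
  show "M \<in> \<Union> {{M \<in> space (prob_algebra borel). (\<integral>x. f x \<partial>M) \<in> U} | (f :: 'a \<Rightarrow> real) U.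
        continuous_on UNIV f \<and> bounded (range f) \<and> open U}"
    by (rule UnionI[of "{M \<in> space (prob_algebra borel). (\<integral>x. (0::real) \<partial>M) \<in> UNIV}"])
       (use M in \<open>auto intro!: exI[of _ "\<lambda>_. 0"] exI[of _ UNIV]\<close>)
qed auto

definition weak_borel :: "'a::topological_space measure measure" where
  "weak_borel = sigma (topspace weak_topology) {U. openin weak_topology U}"

definition merge_weakly :: "(nat \<Rightarrow> 'a::topological_space measure) \<Rightarrow> (nat \<Rightarrow> 'a measure) \<Rightarrow> bool" where
  "merge_weakly p q \<longleftrightarrow>
     (\<forall>g :: 'a \<Rightarrow> real. continuous_on UNIV g \<and> bounded (range g) \<longrightarrow>
        (\<lambda>n. \<bar>(\<integral>x. g x \<partial>p n) - (\<integral>x. g x \<partial>q n)\<bar>) \<longlonglongrightarrow> 0)"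

text \<open>A data sequence is \<open>\<omega> :: nat \<Rightarrow> 'x\<close>, with \<open>\<omega> i\<close> the observation $X_{i+1}$.  Functions of
  $(X_1,\dots,X_n)$ are functions on the sample space \<open>sample_space n\<close>, evaluated at
  \<open>first_obs n \<omega>\<close>.\<close>

abbreviation sample_space :: "nat \<Rightarrow> (nat \<Rightarrow> 'x::topological_space) measure" where
  "sample_space n \<equiv> Pi\<^sub>M {..<n} (\<lambda>_. borel)"

abbreviation first_obs :: "nat \<Rightarrow> (nat \<Rightarrow> 'x) \<Rightarrow> (nat \<Rightarrow> 'x)" where
  "first_obs n \<omega> \<equiv> restrict \<omega> {..<n}"

definition iid_law :: "('t \<Rightarrow> 'x measure) \<Rightarrow> 't \<Rightarrow> (nat \<Rightarrow> 'x) measure" where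
  "iid_law P \<theta> = Pi\<^sub>M UNIV (\<lambda>_. P \<theta>)"

definition joint_law ::
  "('t::topological_space \<Rightarrow> 'x::topological_space measure) \<Rightarrow> 't measure \<Rightarrow> ('t \<times> (nat \<Rightarrow> 'x)) measure" where
  "joint_law P q =
     q \<bind> (\<lambda>\<theta>. iid_law P \<theta> \<bind> (\<lambda>\<omega>. return (borel \<Otimes>\<^sub>M Pi\<^sub>M UNIV (\<lambda>_. borel)) (\<theta>, \<omega>)))"

definition obs_algebra :: "nat \<Rightarrow> ('t \<times> (nat \<Rightarrow> 'x::topological_space)) measure" where
  "obs_algebra n = vimage_algebra UNIV (\<lambda>(\<theta>, \<omega>). first_obs n \<omega>) (sample_space n)"

text \<open>\<open>K\<close> is a version of the conditional distribution of the parameter given the first \<open>n\<close>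
  observations.  Kernels are only required to be sub-probability kernels, so that \<open>K\<close> may fail to be
  a probability measure on an exceptional set (for instance where the Bayes formula reads $0/0$);
  taking \<open>A = UNIV\<close> shows that this set is null under the joint law.\<close>

definition posterior_version ::
  "('t::topological_space \<Rightarrow> 'x::topological_space measure) \<Rightarrow> 't measure \<Rightarrow> nat \<Rightarrow>
     ((nat \<Rightarrow> 'x) \<Rightarrow> 't measure) \<Rightarrow> bool" where
  "posterior_version P q n K \<longleftrightarrow>
     K \<in> sample_space n \<rightarrow>\<^sub>M subprob_algebra borel \<and>
     (\<forall>A \<in> sets borel. AE z in joint_law P q.
        measure (K (first_obs n (snd z))) A =
        real_cond_exp (joint_law P q) (obs_algebra n) (indicator (A \<times> UNIV)) z)"

text \<open>The prior attached to a hyperparameter in the closure of \<open>\<Lambda>\<close>: the given one inside \<open>\<Lambda>\<close>, and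
  the weak limit from inside \<open>\<Lambda>\<close> otherwise.  It is a relation because the limit need not exist.\<close>

definition prior_at ::
  "'l::topological_space set \<Rightarrow> ('l \<Rightarrow> 't::topological_space measure) \<Rightarrow> 'l \<Rightarrow> 't measure \<Rightarrow> bool" where
  "prior_at \<Lambda> Prior l L \<longleftrightarrow>
     (if l \<in> \<Lambda> then L = Prior l
      else l \<in> closure \<Lambda> \<and> limitin weak_topology Prior L (at l within \<Lambda>))"

definition eb_posterior ::
  "(nat \<Rightarrow> 'l \<Rightarrow> (nat \<Rightarrow> 'x) \<Rightarrow> 't measure) \<Rightarrow> (nat \<Rightarrow> (nat \<Rightarrow> 'x) \<Rightarrow> 'l) \<Rightarrow>
     nat \<Rightarrow> (nat \<Rightarrow> 'x) \<Rightarrow> 't measure" where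
  "eb_posterior Post lhat n x = Post n (lhat n x) x"

definition predictive :: "('t \<Rightarrow> 'x measure) \<Rightarrow> 't measure \<Rightarrow> (nat \<Rightarrow> 'x) measure" where
  "predictive P Pst = Pst \<bind> iid_law P"

definition weakly_consistent_at ::
  "('t::topological_space \<Rightarrow> 'x measure) \<Rightarrow> (nat \<Rightarrow> (nat \<Rightarrow> 'x) \<Rightarrow> 't measure) \<Rightarrow> 't \<Rightarrow> bool" where
  "weakly_consistent_at P Post \<theta> \<longleftrightarrow>
     (\<forall>W \<in> sets borel. \<theta> \<in> interior W \<longrightarrow>
        (AE \<omega> in iid_law P \<theta>. (\<lambda>n. measure (Post n (first_obs n \<omega>)) (- W)) \<longlonglongrightarrow> 0))"

lemma openin_weak_topology_integral:
  fixes f :: "'a::topological_space \<Rightarrow> real"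
  assumes "continuous_on UNIV f" "bounded (range f)" "open U"
  shows "openin weak_topology {M \<in> space (prob_algebra borel). (\<integral>x. f x \<partial>M) \<in> U}"
  unfolding weak_topology_def by (rule topology_generated_by_Basis) (use assms in blast)

lemma space_weak_borel [simp]: "space weak_borel = space (prob_algebra borel)"
  unfolding weak_borel_def topspace_weak_topology[symmetric]
  by (rule space_measure_of) (blast dest: openin_subset)

lemma measurable_integral_weak_borel:
  fixes f :: "'a::topological_space \<Rightarrow> real"
  assumes "continuous_on UNIV f" "bounded (range f)"
  shows "(\<lambda>M. \<integral>x. f x \<partial>M) \<in> borel_measurable weak_borel"
proof (rule borel_measurableI)
  fix U :: "real set" assume "open U"
  have "(\<lambda>M. \<integral>x. f x \<partial>M) -` U \<inter> space weak_borel =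
     {M \<in> space (prob_algebra borel). (\<integral>x. f x \<partial>M) \<in> U}" by auto
  moreover have "\<dots> \<in> sets weak_borel"
    unfolding weak_borel_def
    using openin_weak_topology_integral[OF assms \<open>open U\<close>]
    by (intro in_measure_of) (blast dest: openin_subset)+
  ultimately show "(\<lambda>M. \<integral>x. f x \<partial>M) -` U \<inter> space weak_borel \<in> sets weak_borel" by simp
qed

lemma weak_borel_prob_algebra:
  "(\<lambda>M. M) \<in> weak_borel \<rightarrow>\<^sub>M prob_algebra (borel :: 'a::metric_space measure)"
proof (rule measurable_prob_algebra_generated[where G = "{C. closed C}" and \<Omega> = UNIV])
  show "sets (borel :: 'a measure) = sigma_sets UNIV {C. closed C}"
    by (simp add: borel_eq_closed)
  show "Int_stable {C. closed (C::'a set)}" by (auto simp: Int_stable_def)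
  fix M :: "'a measure" assume "M \<in> space weak_borel"
  then show "prob_space M" "sets M = sets borel" by (auto simp: space_prob_algebra)
next
  fix C :: "'a set" assume "C \<in> {C. closed C}"
  then have C: "closed C" by simp
  define f where "f k x = max 0 (1 - real k * infdist x C)" for k x
  have fc: "continuous_on UNIV (f k)" for k unfolding f_def by (intro continuous_intros)
  have f01: "f k x \<in> {0..1}" for k x by (auto simp: f_def infdist_nonneg)
  have fb: "bounded (range (f k))" for k
    by (rule bounded_subset[of "{0..1}"]) (use f01 in auto)
  show "(\<lambda>M. emeasure M C) \<in> borel_measurable weak_borel"
  proof (cases "C = {}")
    case False
    have lim: "(\<lambda>k. f k x) \<longlonglongrightarrow> indicator C x" for x
    proof (cases "x \<in> C")
      case True then show ?thesis by (simp add: f_def)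
    next
      case x: False
      have pos: "infdist x C > 0"
        using C False x in_closed_iff_infdist_zero[of C x] infdist_nonneg[of x C] by (simp add: less_le)
      obtain k0 :: nat where k0: "real k0 * infdist x C > 1" using pos ex_less_of_nat_mult by blast
      have "eventually (\<lambda>k. f k x = 0) sequentially"
        using eventually_ge_at_top[of k0]
      proof eventually_elim
        case (elim k)
        have "real k0 * infdist x C \<le> real k * infdist x C" using elim pos by simp
        then show ?case using k0 by (simp add: f_def)
      qed
      then show ?thesis using x by (simp add: tendsto_eventually)
    qed
    have "(\<lambda>M. measure M C) \<in> borel_measurable weak_borel"
    proof (rule borel_measurable_LIMSEQ_real)
      show "(\<lambda>M. \<integral>x. f k x \<partial>M) \<in> borel_measurable weak_borel" for k
        by (rule measurable_integral_weak_borel[OF fc fb])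
      fix M :: "'a measure" assume "M \<in> space weak_borel"
      then have M: "prob_space M" and [measurable_cong]: "sets M = sets borel" by (auto simp: space_prob_algebra)
      interpret prob_space M by fact
      have sp: "space M = UNIV" using sets_eq_imp_space_eq[OF \<open>sets M = sets borel\<close>] by simp
      have "(\<lambda>k. \<integral>x. f k x \<partial>M) \<longlonglongrightarrow> (\<integral>x. indicator C x \<partial>M)"
      proof (rule integral_dominated_convergence[where w = "\<lambda>_. 1"])
        show "f k \<in> borel_measurable M" for k
          using borel_measurable_continuous_onI[OF fc] by (simp cong: measurable_cong_sets)
        show "(indicator C :: 'a \<Rightarrow> real) \<in> borel_measurable M"
          using C by (intro borel_measurable_indicator) (simp add: \<open>sets M = sets borel\<close>)
      qed (use lim f01 in \<open>auto intro!: AE_I2 simp: abs_le_iff\<close>)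
      then show "(\<lambda>k. \<integral>x. f k x \<partial>M) \<longlonglongrightarrow> measure M C"
        by (simp add: sp)
    qed
    then have "(\<lambda>M. ennreal (measure M C)) \<in> borel_measurable weak_borel" by measurable
    then show ?thesis
      by (subst measurable_cong[where g = "\<lambda>M. ennreal (measure M C)"])
         (auto simp: space_prob_algebra prob_space_def finite_measure.emeasure_eq_measure)
  qed auto
qed auto

context
  fixes P :: "'t::polish_space \<Rightarrow> 'x::polish_space measure"
  assumes P: "P \<in> borel \<rightarrow>\<^sub>M weak_borel"
begin

lemma P_prob_algebra: "P \<in> borel \<rightarrow>\<^sub>M prob_algebra borel"
  using measurable_comp[OF P weak_borel_prob_algebra] by (simp add: comp_def)

lemma P_prob: "prob_space (P \<theta>)" and P_sets: "sets (P \<theta>) = sets borel"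
  using measurable_space[OF P, of \<theta>] by (auto simp: space_prob_algebra)

lemma iid_law_measurable: "iid_law P \<in> borel \<rightarrow>\<^sub>M prob_algebra (Pi\<^sub>M UNIV (\<lambda>_. borel))"
proof (rule measurable_prob_algebra_generated[OF sets_PiM Int_stable_prod_algebra prod_algebra_sets_into_space])
  fix \<theta>
  show "prob_space (iid_law P \<theta>)" unfolding iid_law_def by (intro prob_space_PiM P_prob)
  show "sets (iid_law P \<theta>) = sets (Pi\<^sub>M UNIV (\<lambda>_. borel))"
    unfolding iid_law_def by (intro sets_PiM_cong refl P_sets)
next
  fix A :: "(nat \<Rightarrow> 'x) set" assume "A \<in> prod_algebra UNIV (\<lambda>_. borel)"
  then obtain J E where A: "A = prod_emb UNIV (\<lambda>_. borel) J (Pi\<^sub>E J E)" and J: "finite J"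
    and E: "\<And>i. i \<in> J \<Longrightarrow> E i \<in> sets borel"
    by (auto elim!: prod_algebraE)
  have "emeasure (iid_law P \<theta>) A = (\<Prod>i\<in>J. emeasure (P \<theta>) (E i))" for \<theta>
  proof -
    have "A = prod_emb UNIV (\<lambda>_. P \<theta>) J (Pi\<^sub>E J E)"
      unfolding A prod_emb_def using sets_eq_imp_space_eq[OF P_sets] by (simp cong: PiE_cong)
    then show ?thesis unfolding iid_law_def
      using J E by (simp add: emeasure_PiM_emb P_prob P_sets)
  qed
  moreover have "(\<lambda>\<theta>. \<Prod>i\<in>J. emeasure (P \<theta>) (E i)) \<in> borel_measurable borel"
    by (intro borel_measurable_prod_ennreal measurable_emeasure_kernel[OF measurable_prob_algebraD[OF P_prob_algebra]] E)
  ultimately show "(\<lambda>\<theta>. emeasure (iid_law P \<theta>) A) \<in> borel_measurable borel" by simp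
qed

text \<open>\<open>joint_law P q\<close> is the law determined by
  $P_q(A\times B)=\int_A P_\theta^\infty(B)\,\mathrm{d}q(\theta)$.\<close>

lemma emeasure_joint_law:
  assumes q: "q \<in> space (prob_algebra borel)" and A: "A \<in> sets borel" and B: "B \<in> sets (Pi\<^sub>M UNIV (\<lambda>_. borel))"
  shows "emeasure (joint_law P q) (A \<times> B) = (\<integral>\<^sup>+\<theta>\<in>A. emeasure (iid_law P \<theta>) B \<partial>q)"
proof -
  note [measurable] = iid_law_measurable
  have qs[measurable_cong]: "sets q = sets borel" using q by (auto simp: space_prob_algebra)
  have k: "(\<lambda>\<theta>. iid_law P \<theta> \<bind> (\<lambda>\<omega>. return (borel \<Otimes>\<^sub>M Pi\<^sub>M UNIV (\<lambda>_. borel)) (\<theta>, \<omega>)))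
      \<in> borel \<rightarrow>\<^sub>M prob_algebra (borel \<Otimes>\<^sub>M Pi\<^sub>M UNIV (\<lambda>_. borel))"
    by measurable
  have "emeasure (joint_law P q) (A \<times> B) =
     (\<integral>\<^sup>+\<theta>. emeasure (iid_law P \<theta> \<bind> (\<lambda>\<omega>. return (borel \<Otimes>\<^sub>M Pi\<^sub>M UNIV (\<lambda>_. borel)) (\<theta>, \<omega>))) (A \<times> B) \<partial>q)"
    unfolding joint_law_def using A B by (intro emeasure_bind_prob_algebra[OF q k]) auto
  also have "\<dots> = (\<integral>\<^sup>+\<theta>\<in>A. emeasure (iid_law P \<theta>) B \<partial>q)"
  proof (rule nn_integral_cong)
    fix \<theta>
    have i: "iid_law P \<theta> \<in> space (prob_algebra (Pi\<^sub>M UNIV (\<lambda>_. borel)))"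
      using measurable_space[OF iid_law_measurable] by simp
    have s: "sets (iid_law P \<theta>) = sets (Pi\<^sub>M UNIV (\<lambda>_. borel))" using i by (auto simp: space_prob_algebra)
    have "emeasure (iid_law P \<theta> \<bind> (\<lambda>\<omega>. return (borel \<Otimes>\<^sub>M Pi\<^sub>M UNIV (\<lambda>_. borel)) (\<theta>, \<omega>))) (A \<times> B)
       = (\<integral>\<^sup>+\<omega>. emeasure (return (borel \<Otimes>\<^sub>M Pi\<^sub>M UNIV (\<lambda>_. borel)) (\<theta>, \<omega>)) (A \<times> B) \<partial>iid_law P \<theta>)"
      using A B by (intro emeasure_bind_prob_algebra[OF i, where L = "borel \<Otimes>\<^sub>M Pi\<^sub>M UNIV (\<lambda>_. borel)"]) auto
    also have "\<dots> = (\<integral>\<^sup>+\<omega>. indicator A \<theta> * indicator B \<omega> \<partial>iid_law P \<theta>)"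
      using A B by (intro nn_integral_cong) (simp add: indicator_times)
    also have "\<dots> = emeasure (iid_law P \<theta>) B * indicator A \<theta>"
      using B s by (simp add: nn_integral_cmult mult.commute)
    finally show "emeasure (iid_law P \<theta> \<bind> (\<lambda>\<omega>. return (borel \<Otimes>\<^sub>M Pi\<^sub>M UNIV (\<lambda>_. borel)) (\<theta>, \<omega>))) (A \<times> B)
       = emeasure (iid_law P \<theta>) B * indicator A \<theta>" .
  qed
  finally show ?thesis .
qed


lemma joint_law_prob_algebra:
  assumes q: "q \<in> space (prob_algebra borel)"
  shows "joint_law P q \<in> space (prob_algebra (borel \<Otimes>\<^sub>M Pi\<^sub>M UNIV (\<lambda>_. borel)))"
proof -
  note [measurable] = iid_law_measurable
  have "(\<lambda>\<theta>. iid_law P \<theta> \<bind> (\<lambda>\<omega>. return (borel \<Otimes>\<^sub>M Pi\<^sub>M UNIV (\<lambda>_. borel)) (\<theta>, \<omega>)))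
      \<in> borel \<rightarrow>\<^sub>M prob_algebra (borel \<Otimes>\<^sub>M Pi\<^sub>M UNIV (\<lambda>_. borel))"
    by measurable
  then have "(\<lambda>q. q \<bind> (\<lambda>\<theta>. iid_law P \<theta> \<bind> (\<lambda>\<omega>. return (borel \<Otimes>\<^sub>M Pi\<^sub>M UNIV (\<lambda>_. borel)) (\<theta>, \<omega>))))
      \<in> prob_algebra borel \<rightarrow>\<^sub>M prob_algebra (borel \<Otimes>\<^sub>M Pi\<^sub>M UNIV (\<lambda>_. borel))"
    by (intro measurable_bind_prob_space[where N = borel]) simp_all
  from measurable_space[OF this q] show ?thesis unfolding joint_law_def .
qed

lemma nn_integral_joint_law:
  assumes q: "q \<in> space (prob_algebra borel)"
    and f: "f \<in> borel_measurable (borel \<Otimes>\<^sub>M Pi\<^sub>M UNIV (\<lambda>_. borel))"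
  shows "(\<integral>\<^sup>+z. f z \<partial>joint_law P q) = (\<integral>\<^sup>+\<theta>. (\<integral>\<^sup>+\<omega>. f (\<theta>, \<omega>) \<partial>iid_law P \<theta>) \<partial>q)"
proof -
  note [measurable] = iid_law_measurable
  let ?R = "\<lambda>\<theta>. (\<lambda>\<omega>. return (borel \<Otimes>\<^sub>M Pi\<^sub>M UNIV (\<lambda>_. borel)) (\<theta>, \<omega> :: nat \<Rightarrow> 'x))"
  have qs[measurable_cong]: "sets q = sets borel" using q by (auto simp: space_prob_algebra)
  have k: "(\<lambda>\<theta>. iid_law P \<theta> \<bind> ?R \<theta>)
      \<in> borel \<rightarrow>\<^sub>M prob_algebra (borel \<Otimes>\<^sub>M Pi\<^sub>M UNIV (\<lambda>_. borel))"
    by measurable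
  have k': "(\<lambda>\<theta>. iid_law P \<theta> \<bind> ?R \<theta>)
      \<in> q \<rightarrow>\<^sub>M subprob_algebra (borel \<Otimes>\<^sub>M Pi\<^sub>M UNIV (\<lambda>_. borel))"
    using measurable_prob_algebraD[OF k] by (simp add: qs cong: measurable_cong_sets)
  have s: "sets (iid_law P \<theta>) = sets (Pi\<^sub>M UNIV (\<lambda>_. borel))" for \<theta>
    using measurable_space[OF iid_law_measurable, of \<theta>] by (auto simp: space_prob_algebra)
  have R: "?R \<theta> \<in> iid_law P \<theta> \<rightarrow>\<^sub>M subprob_algebra (borel \<Otimes>\<^sub>M Pi\<^sub>M UNIV (\<lambda>_. borel))" for \<theta>
    unfolding measurable_cong_sets[OF s refl] by measurable
  have "(\<integral>\<^sup>+z. f z \<partial>joint_law P q) = (\<integral>\<^sup>+\<theta>. (\<integral>\<^sup>+z. f z \<partial>(iid_law P \<theta> \<bind> ?R \<theta>)) \<partial>q)"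
    unfolding joint_law_def by (rule nn_integral_bind[OF f k'])
  also have "\<dots> = (\<integral>\<^sup>+\<theta>. (\<integral>\<^sup>+\<omega>. (\<integral>\<^sup>+z. f z \<partial>?R \<theta> \<omega>) \<partial>iid_law P \<theta>) \<partial>q)"
    by (intro nn_integral_cong nn_integral_bind[OF f R])
  also have "\<dots> = (\<integral>\<^sup>+\<theta>. (\<integral>\<^sup>+\<omega>. f (\<theta>, \<omega>) \<partial>iid_law P \<theta>) \<partial>q)"
    by (intro nn_integral_cong nn_integral_return f) (simp add: space_pair_measure space_PiM)
  finally show ?thesis .
qed

text \<open>In a dominated model the Bayes formula gives a version of the posterior.  Extended nonnegative
  division makes the formula the null measure wherever the denominator is $0$ or $\infty$.\<close>

lemma posterior_version_dominated:
  fixes p :: "'t \<Rightarrow> (nat \<Rightarrow> 'x) \<Rightarrow> ennreal" and K :: "(nat \<Rightarrow> 'x) \<Rightarrow> 't measure"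
  assumes q: "q \<in> space (prob_algebra borel)"
    and \<mu>: "sigma_finite_measure \<mu>" and \<mu>_sets: "sets \<mu> = sets (sample_space n)"
    and p: "(\<lambda>(\<theta>, x). p \<theta> x) \<in> borel_measurable (borel \<Otimes>\<^sub>M sample_space n)"
    and dens: "\<And>\<theta>. distr (iid_law P \<theta>) (sample_space n) (first_obs n) = density \<mu> (p \<theta>)"
    and K_sets: "\<And>x. sets (K x) = sets borel"
    and K: "\<And>x B. x \<in> space (sample_space n) \<Longrightarrow> B \<in> sets borel \<Longrightarrow>
              emeasure (K x) B = (\<integral>\<^sup>+\<theta>\<in>B. p \<theta> x \<partial>q) / (\<integral>\<^sup>+\<theta>. p \<theta> x \<partial>q)"
  shows "posterior_version P q n K"
proof -
  let ?J = "joint_law P q" and ?F = "obs_algebra n :: ('t \<times> (nat \<Rightarrow> 'x)) measure"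
  have qp: "prob_space q" and qs[measurable_cong]: "sets q = sets borel"
    using q by (auto simp: space_prob_algebra)
  interpret q: prob_space q by fact
  interpret \<mu>: sigma_finite_measure \<mu> by fact
  interpret q\<mu>: pair_sigma_finite q \<mu> by unfold_locales
  note [measurable_cong] = \<mu>_sets
  note [measurable] = p
  have spq: "space q = UNIV" using sets_eq_imp_space_eq[OF qs] by simp
  have sp\<mu>: "space \<mu> = space (sample_space n)" by (rule sets_eq_imp_space_eq[OF \<mu>_sets])
  have pm: "(\<lambda>x. p \<theta> x) \<in> borel_measurable (sample_space n)" for \<theta>
    using measurable_Pair2[OF p, of \<theta>] by simp
  define D where "D x = (\<integral>\<^sup>+\<theta>. p \<theta> x \<partial>q)" for x
  define N where "N A x = (\<integral>\<^sup>+\<theta>\<in>A. p \<theta> x \<partial>q)" for A x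
  have pswap: "(\<lambda>(x, \<theta>). p \<theta> x) \<in> borel_measurable (sample_space n \<Otimes>\<^sub>M q)"
    by measurable
  have D_m[measurable]: "D \<in> borel_measurable (sample_space n)"
    unfolding D_def by (rule q.borel_measurable_nn_integral[OF pswap])
  have N_m[measurable]: "N A \<in> borel_measurable (sample_space n)" if [measurable]: "A \<in> sets borel" for A
    unfolding N_def by measurable
  have ND: "N A x \<le> D x" for A x
    unfolding N_def D_def by (intro nn_integral_mono) (auto simp: indicator_def)
  have KA: "emeasure (K x) A = N A x / D x" if "x \<in> space (sample_space n)" "A \<in> sets borel" for x A
    using K[OF that] by (simp add: N_def D_def)
  have KU: "emeasure (K x) UNIV \<le> 1" if x: "x \<in> space (sample_space n)" for x
  proof -
    have "N UNIV x = D x" by (simp add: N_def D_def)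
    then have "emeasure (K x) UNIV = D x / D x" using KA[OF x, of UNIV] by simp
    also have "\<dots> \<le> 1"
      by (cases "D x = 0 \<or> D x = \<top>") (auto simp: ennreal_divide_self less_top)
    finally show ?thesis .
  qed
  have K_sub: "subprob_space (K x)" if x: "x \<in> space (sample_space n)" for x
    using KU[OF x] sets_eq_imp_space_eq[OF K_sets] by (intro subprob_spaceI) auto
  have K_meas: "K \<in> sample_space n \<rightarrow>\<^sub>M subprob_algebra borel"
  proof (rule measurable_subprob_algebra)
    fix A :: "'t set" assume [measurable]: "A \<in> sets borel"
    show "(\<lambda>x. emeasure (K x) A) \<in> borel_measurable (sample_space n)"
      by (subst measurable_cong[OF KA]) auto
  qed (use K_sub K_sets in auto)
  have J: "prob_space ?J" and Js[measurable_cong]: "sets ?J = sets (borel \<Otimes>\<^sub>M Pi\<^sub>M UNIV (\<lambda>_. borel))"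
    using joint_law_prob_algebra[OF q] by (auto simp: space_prob_algebra)
  have spJ: "space ?J = UNIV" using sets_eq_imp_space_eq[OF Js] by (simp add: space_pair_measure space_PiM)
  interpret J: prob_space ?J by fact
  have X: "first_obs n \<in> Pi\<^sub>M UNIV (\<lambda>_. borel) \<rightarrow>\<^sub>M sample_space n"
    by (rule measurable_restrict_subset) simp
  have X2[measurable]: "(\<lambda>z. first_obs n (snd z)) \<in> borel \<Otimes>\<^sub>M Pi\<^sub>M UNIV (\<lambda>_. borel) \<rightarrow>\<^sub>M sample_space n"
    by (rule measurable_compose[OF measurable_snd X])
  have XF: "(\<lambda>z. first_obs n (snd z)) \<in> ?F \<rightarrow>\<^sub>M sample_space n"
    unfolding obs_algebra_def split_beta'
    by (rule measurable_vimage_algebra1) (auto simp: space_PiM)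
  have sub: "subalgebra ?J ?F"
    unfolding subalgebra_def
  proof
    show "space ?F = space ?J" by (simp add: obs_algebra_def spJ)
    show "sets ?F \<subseteq> sets ?J"
      using measurable_sets[OF X2] unfolding obs_algebra_def split_beta'
      by (auto simp: sets_vimage_algebra2 space_PiM Js space_pair_measure)
  qed
  interpret S: finite_measure_subalgebra ?J ?F
    by unfold_locales (rule sub)
  have sF: "\<exists>B \<in> sets (sample_space n). S = (\<lambda>z. first_obs n (snd z)) -` B" if "S \<in> sets ?F" for S
    using that unfolding obs_algebra_def split_beta' by (auto simp: sets_vimage_algebra2 space_PiM)
  have iid: "(\<integral>\<^sup>+\<omega>. g (first_obs n \<omega>) \<partial>iid_law P \<theta>) = (\<integral>\<^sup>+x. p \<theta> x * g x \<partial>\<mu>)"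
    if g: "g \<in> borel_measurable (sample_space n)" for g \<theta>
  proof -
    have s: "sets (iid_law P \<theta>) = sets (Pi\<^sub>M UNIV (\<lambda>_. borel))"
      using measurable_space[OF iid_law_measurable, of \<theta>] by (auto simp: space_prob_algebra)
    have "(\<integral>\<^sup>+\<omega>. g (first_obs n \<omega>) \<partial>iid_law P \<theta>) = (\<integral>\<^sup>+x. g x \<partial>distr (iid_law P \<theta>) (sample_space n) (first_obs n))"
      using X g by (intro nn_integral_distr[symmetric]) (simp_all only: measurable_cong_sets[OF s refl] measurable_distr_eq1)
    also have "\<dots> = (\<integral>\<^sup>+x. p \<theta> x * g x \<partial>\<mu>)"
      unfolding dens using pm g by (intro nn_integral_density) (simp_all cong: measurable_cong_sets add: measurable_cong_sets[OF \<mu>_sets refl])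
    finally show ?thesis .
  qed
  have "(\<integral>\<^sup>+x. D x \<partial>\<mu>) = (\<integral>\<^sup>+\<theta>. \<integral>\<^sup>+x. p \<theta> x \<partial>\<mu> \<partial>q)"
    unfolding D_def by (rule q\<mu>.Fubini') measurable
  also have "\<dots> = (\<integral>\<^sup>+\<theta>. 1 \<partial>q)"
    using iid[of "\<lambda>_. 1"] P_prob unfolding iid_law_def
    by (intro nn_integral_cong) (simp add: prob_space.emeasure_space_1[OF prob_space_PiM])
  finally have "(\<integral>\<^sup>+x. D x \<partial>\<mu>) \<noteq> \<infinity>" by (simp add: q.emeasure_space_1)
  then have D_fin: "AE x in \<mu>. D x \<noteq> \<infinity>"
    by (intro nn_integral_PInf_AE) (simp_all add: measurable_cong_sets[OF \<mu>_sets refl])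
  have key: "AE z in ?J. real_cond_exp ?J ?F (indicator (A \<times> UNIV)) z = measure (K (first_obs n (snd z))) A"
    if A[measurable]: "A \<in> sets borel" for A
  proof (rule S.real_cond_exp_charact)
    have kA: "(\<lambda>x. measure (K x) A) \<in> borel_measurable (sample_space n)"
      using measurable_compose[OF measurable_emeasure_kernel[OF K_meas A] borel_measurable_enn2real]
      by (simp add: measure_def)
    have eA: "(\<lambda>x. emeasure (K x) A) \<in> borel_measurable (sample_space n)"
      using measurable_emeasure_kernel[OF K_meas A] .
    have xs: "first_obs n \<omega> \<in> space (sample_space n)" for \<omega> :: "nat \<Rightarrow> 'x" by (simp add: space_PiM)
    have le1: "measure (K x) A \<le> 1" if "x \<in> space (sample_space n)" for x
      using subprob_space.subprob_measure_le_1[OF K_sub[OF that]] by simp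
    have emK: "emeasure (K x) A = ennreal (measure (K x) A)" if "x \<in> space (sample_space n)" for x
      using K_sub[OF that] by (simp add: finite_measure.emeasure_eq_measure subprob_space_def)
    show F: "(\<lambda>z. measure (K (first_obs n (snd z))) A) \<in> borel_measurable ?F"
      by (rule measurable_compose[OF XF kA])
    show int: "integrable ?J (\<lambda>z. measure (K (first_obs n (snd z))) A)"
      using measurable_from_subalg[OF sub F] le1[OF xs]
      by (intro J.integrable_const_bound[where B = 1]) auto
    have AU: "A \<times> UNIV \<in> sets ?J" unfolding Js by (rule pair_measureI) (auto simp: space_PiM intro: sets.top[of "Pi\<^sub>M UNIV (\<lambda>_. borel)", unfolded space_PiM, simplified])
    show int2: "integrable ?J (indicator (A \<times> UNIV) :: _ \<Rightarrow> real)"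
      using AU by (intro J.integrable_const_bound[where B = 1]) (auto simp: indicator_def)
    fix S assume "S \<in> sets ?F"
    then obtain B where B[measurable]: "B \<in> sets (sample_space n)" and S: "S = (\<lambda>z. first_obs n (snd z)) -` B"
      using sF by blast
    have SJ: "S \<in> sets ?J" using \<open>S \<in> sets ?F\<close> sub by (auto simp: subalgebra_def)
    have "(\<integral>\<^sup>+z. indicator (A \<times> UNIV) z * indicator S z \<partial>?J)
       = (\<integral>\<^sup>+\<theta>. \<integral>\<^sup>+\<omega>. indicator (A \<times> UNIV) (\<theta>, \<omega>) * indicator S (\<theta>, \<omega>) \<partial>iid_law P \<theta> \<partial>q)"
      using AU SJ by (intro nn_integral_joint_law[OF q]) (simp add: Js)
    also have "\<dots> = (\<integral>\<^sup>+\<theta>. \<integral>\<^sup>+x. p \<theta> x * (indicator A \<theta> * indicator B x) \<partial>\<mu> \<partial>q)"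
      by (intro nn_integral_cong, subst iid[symmetric]) (auto simp: S indicator_def intro!: nn_integral_cong)
    also have "\<dots> = (\<integral>\<^sup>+x. \<integral>\<^sup>+\<theta>. p \<theta> x * (indicator A \<theta> * indicator B x) \<partial>q \<partial>\<mu>)"
      by (rule q\<mu>.Fubini'[symmetric]) measurable
    also have "\<dots> = (\<integral>\<^sup>+x. N A x * indicator B x \<partial>\<mu>)"
    proof (intro nn_integral_cong)
      fix x assume "x \<in> space \<mu>"
      then have "(\<lambda>\<theta>. p \<theta> x) \<in> borel_measurable q"
        using measurable_Pair1[OF p, of x] by (simp add: sp\<mu> measurable_cong_sets[OF qs refl])
      then show "(\<integral>\<^sup>+\<theta>. p \<theta> x * (indicator A \<theta> * indicator B x) \<partial>q) = N A x * indicator B x"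
        unfolding N_def using A by (subst nn_integral_multc[symmetric]) (auto simp: mult.assoc measurable_cong_sets[OF qs refl])
    qed
    also have "\<dots> = (\<integral>\<^sup>+x. D x * (emeasure (K x) A * indicator B x) \<partial>\<mu>)"
    proof (rule nn_integral_cong_AE)
      show "AE x in \<mu>. N A x * indicator B x = D x * (emeasure (K x) A * indicator B x)"
        using D_fin
      proof (rule AE_mp, intro AE_I2 impI)
        fix x assume x: "x \<in> space \<mu>" and fin: "D x \<noteq> \<infinity>"
        have "N A x = D x * emeasure (K x) A"
        proof (cases "D x = 0")
          case True then show ?thesis using ND[of A x] by simp
        next
          case False
          then have "N A x * D x / D x = N A x" using fin by (simp add: ennreal_mult_divide_eq)
          then show ?thesis using x KA[OF _ A] sp\<mu>
            by (simp add: ennreal_times_divide mult.commute)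
        qed
        then show "N A x * indicator B x = D x * (emeasure (K x) A * indicator B x)" by (simp add: mult.assoc)
      qed
    qed
    also have "\<dots> = (\<integral>\<^sup>+x. \<integral>\<^sup>+\<theta>. p \<theta> x * (emeasure (K x) A * indicator B x) \<partial>q \<partial>\<mu>)"
    proof (intro nn_integral_cong)
      fix x assume "x \<in> space \<mu>"
      then have "(\<lambda>\<theta>. p \<theta> x) \<in> borel_measurable q"
        using measurable_Pair1[OF p, of x] by (simp add: sp\<mu> measurable_cong_sets[OF qs refl])
      then show "D x * (emeasure (K x) A * indicator B x) = (\<integral>\<^sup>+\<theta>. p \<theta> x * (emeasure (K x) A * indicator B x) \<partial>q)"
        unfolding D_def by (simp add: nn_integral_multc)
    qed
    also have "\<dots> = (\<integral>\<^sup>+\<theta>. \<integral>\<^sup>+x. p \<theta> x * (emeasure (K x) A * indicator B x) \<partial>\<mu> \<partial>q)"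
    proof -
      have h[measurable]: "(\<lambda>x. emeasure (K x) A * indicator B x) \<in> borel_measurable (sample_space n)"
        using eA B by (intro borel_measurable_times_ennreal borel_measurable_indicator)
      have "(\<lambda>z. p (fst z) (snd z) * (emeasure (K (snd z)) A * indicator B (snd z)))
          \<in> borel_measurable (borel \<Otimes>\<^sub>M sample_space n)"
        using p unfolding split_beta'
        by (rule borel_measurable_times_ennreal) (rule measurable_compose[OF measurable_snd h])
      then have "(\<lambda>(\<theta>, x). p \<theta> x * (emeasure (K x) A * indicator B x)) \<in> borel_measurable (q \<Otimes>\<^sub>M \<mu>)"
        by (simp add: split_beta' measurable_cong_sets[OF sets_pair_measure_cong[OF qs \<mu>_sets] refl])
      from q\<mu>.Fubini'[OF this] show ?thesis .
    qed
    also have "\<dots> = (\<integral>\<^sup>+\<theta>. \<integral>\<^sup>+\<omega>. emeasure (K (first_obs n (snd (\<theta>, \<omega>)))) A * indicator S (\<theta>, \<omega>) \<partial>iid_law P \<theta> \<partial>q)"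
      using eA by (intro nn_integral_cong, subst iid[symmetric]) (auto simp: S indicator_def intro!: nn_integral_cong)
    also have "\<dots> = (\<integral>\<^sup>+z. emeasure (K (first_obs n (snd z))) A * indicator S z \<partial>?J)"
      using SJ measurable_compose[OF X2 eA] unfolding Js
      by (intro nn_integral_joint_law[OF q, symmetric] borel_measurable_times_ennreal borel_measurable_indicator)
    finally have eq: "(\<integral>\<^sup>+z. indicator (A \<times> UNIV) z * indicator S z \<partial>?J)
       = (\<integral>\<^sup>+z. emeasure (K (first_obs n (snd z))) A * indicator S z \<partial>?J)" .
    show "(\<integral>z\<in>S. indicator (A \<times> UNIV) z \<partial>?J) = (\<integral>z\<in>S. measure (K (first_obs n (snd z))) A \<partial>?J)"
      unfolding set_lebesgue_integral_def
    proof (subst (1 2) integral_eq_nn_integral)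
      show "(\<lambda>x. indicat_real S x *\<^sub>R measure (K (first_obs n (snd x))) A) \<in> borel_measurable ?J"
        using SJ int by (intro borel_measurable_scaleR borel_measurable_indicator borel_measurable_integrable)
      show "(\<lambda>x. indicat_real S x *\<^sub>R indicat_real (A \<times> UNIV) x) \<in> borel_measurable ?J"
        using SJ int2 by (intro borel_measurable_scaleR borel_measurable_indicator borel_measurable_integrable)
      show "enn2real (\<integral>\<^sup>+ x. ennreal (indicat_real S x *\<^sub>R indicat_real (A \<times> UNIV) x) \<partial>?J) =
        enn2real (\<integral>\<^sup>+ x. ennreal (indicat_real S x *\<^sub>R measure (K (first_obs n (snd x))) A) \<partial>?J)"
        using eq by (intro arg_cong[where f = enn2real])
          (simp add: emK[OF xs] ennreal_mult'' ennreal_indicator mult.commute)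
    qed auto
  qed
  show ?thesis
    unfolding posterior_version_def using K_meas key by (auto simp: eq_commute)
qed

end

end

theory Submission
  imports Defs
begin

text \<open>By Doob's theorem the Bayes posterior concentrates at the true parameter, almost surely under
  the joint law: martingale convergence applies because \<open>\<theta>\<close> is almost surely a function of the
  infinite sequence, \<open>P \<theta>\<close> being the limit of the empirical frequencies and \<open>P\<close> injective.  A consistent
  empirical Bayes posterior therefore has the same weak limit, the Dirac mass at \<open>\<theta>\<close>, and merges with
  it.  Conversely, a Dirac prior has the constant Dirac posterior, and merging with it is consistency.
  For the predictive laws, \<open>\<theta> \<mapsto> iid_law P \<theta>\<close> is weakly continuous, so merging is inherited from the
  posteriors; for the converse, weak convergence of the predictive laws to the law of \<open>\<theta>\<close> is tested on
  functions of the first two observations.\<close>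

section \<open>Martingale convergence\<close>

text \<open>Consistency is asserted under each \<open>iid_law P \<theta>\<close> separately, merging
  under \<open>joint_law P q\<close>. Passing from the first to the second needs an event that is
  measurable jointly in parameter and data, so neighbourhoods of the true parameter are replaced by
  the countably many balls around \<open>fst z\<close> of radius \<open>1 / real (Suc k)\<close>.
  Martingale convergence is used without forming the limit sigma-field: it suffices that the
  indicator of a parameter set is within any \<open>e\<close> in mean of a function of finitely many
  observations. Injectivity alone gives no continuity of the inverse of \<open>P\<close>; regularity
  of measures supplies a continuous substitute up to a small error. In the converse for predictive
  laws the null set may depend on the test function, and the test function on \<theta>; this is
  harmless because the prior is a point mass at \<theta> and each weak neighbourhood calls for
  finitely many test functions. Two observations are taken because one gives only the posterior mean
  of \<open>\<integral>x. f x \<partial>P \<theta>'\<close>, which may converge to the right value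
  without concentration.\<close>

lemma (in prob_space) nn_cond_exp_maximal_inequality:
  fixes F :: "nat \<Rightarrow> 'a measure" and D :: "'a \<Rightarrow> ennreal"
  assumes sub: "\<And>n. subalgebra M (F n)" and mono: "\<And>m n. m \<le> n \<Longrightarrow> sets (F m) \<subseteq> sets (F n)"
    and D[measurable]: "D \<in> borel_measurable M"
  shows "c * emeasure M {x \<in> space M. \<exists>n. nn_cond_exp M (F n) D x > c} \<le> (\<integral>\<^sup>+x. D x \<partial>M)"
proof -
  define V where "V n = nn_cond_exp M (F n) D" for n
  have sp: "space (F n) = space M" for n using sub by (auto simp: subalgebra_def)
  define E where "E n = {x \<in> space M. V n x > c}" for n
  have EF: "E i \<in> sets (F n)" if "i \<le> n" for i n
  proof -
    have "V i \<in> borel_measurable (F i)" unfolding V_def by simp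
    then have "{x \<in> space (F i). V i x > c} \<in> sets (F i)" by measurable
    then show ?thesis using mono[OF that] by (auto simp: E_def sp)
  qed
  \<comment> \<open>\<open>disjointed E n\<close> is the event that n is the first index at which
    the conditional expectation exceeds c. Since it lies in \<open>F n\<close>, \<open>V n\<close>
    may be exchanged for \<open>D\<close> under the integral over it; summing over n is Doob's
    stopping argument.\<close>
  have AF: "disjointed E n \<in> sets (F n)" for n
    unfolding disjointed_def using EF by (auto intro!: sets.Diff sets.finite_UN)
  have AM[measurable]: "disjointed E n \<in> sets M" for n
    using AF[of n] sub[of n] by (auto simp: subalgebra_def)
  have step: "c * emeasure M (disjointed E n) \<le> (\<integral>\<^sup>+x. indicator (disjointed E n) x * D x \<partial>M)" for n
  proof -
    interpret S: finite_measure_subalgebra M "F n" by unfold_locales (rule sub)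
    have "c * emeasure M (disjointed E n) = (\<integral>\<^sup>+x. c * indicator (disjointed E n) x \<partial>M)"
      by (simp add: nn_integral_cmult)
    also have "\<dots> \<le> (\<integral>\<^sup>+x. indicator (disjointed E n) x * V n x \<partial>M)"
      by (intro nn_integral_mono) (auto simp: indicator_def disjointed_def E_def intro: less_imp_le)
    also have "\<dots> = (\<integral>\<^sup>+x. indicator (disjointed E n) x * D x \<partial>M)"
      unfolding V_def by (intro S.nn_cond_exp_intg borel_measurable_indicator AF D)
    finally show ?thesis .
  qed
  have "{x \<in> space M. \<exists>n. V n x > c} = (\<Union>n. disjointed E n)"
    by (auto simp: UN_disjointed_eq E_def)
  then have "c * emeasure M {x \<in> space M. \<exists>n. V n x > c} = (\<Sum>n. c * emeasure M (disjointed E n))"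
    by (subst ennreal_suminf_cmult) (simp add: suminf_emeasure disjoint_family_disjointed image_subset_iff)
  also have "\<dots> \<le> (\<Sum>n. \<integral>\<^sup>+x. indicator (disjointed E n) x * D x \<partial>M)"
    by (intro suminf_le step) auto
  also have "\<dots> = (\<integral>\<^sup>+x. (\<Sum>n. indicator (disjointed E n) x * D x) \<partial>M)"
    by (intro nn_integral_suminf[symmetric]) measurable
  also have "\<dots> \<le> (\<integral>\<^sup>+x. D x \<partial>M)"
  proof (intro nn_integral_mono)
    fix x
    have "(\<Sum>n. indicator (disjointed E n) x * D x) = (\<Sum>n. indicator (disjointed E n) x :: ennreal) * D x"
      by simp
    also have "(\<Sum>n. indicator (disjointed E n) x :: ennreal) = indicator (\<Union>n. disjointed E n) x"
      by (rule suminf_indicator[OF disjoint_family_disjointed])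
    also have "indicator (\<Union>n. disjointed E n) x * D x \<le> D x" by (auto simp: indicator_def)
    finally show "(\<Sum>n. indicator (disjointed E n) x * D x) \<le> D x" .
  qed
  finally show ?thesis unfolding V_def .
qed

text \<open>The maximal inequality for \<open>\<bar>f - g\<bar>\<close>, with \<open>g\<close> measurable at a finite stage, reduces upward
  martingale convergence to Borel--Cantelli.\<close>

lemma (in prob_space) real_cond_exp_tendsto:
  fixes F :: "nat \<Rightarrow> 'a measure" and f :: "'a \<Rightarrow> real"
  assumes sub: "\<And>n. subalgebra M (F n)" and mono: "\<And>m n. m \<le> n \<Longrightarrow> sets (F m) \<subseteq> sets (F n)"
    and f: "integrable M f"
    and approx: "\<And>e. e > 0 \<Longrightarrow> \<exists>m g. g \<in> borel_measurable (F m) \<and> integrable M g \<and> (\<integral>x. \<bar>f x - g x\<bar> \<partial>M) < e"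
  shows "AE x in M. (\<lambda>n. real_cond_exp M (F n) f x) \<longlonglongrightarrow> f x"
proof -
  have sp: "space (F n) = space M" for n using sub by (auto simp: subalgebra_def)
  have fsub: "finite_measure_subalgebra M (F n)" for n by unfold_locales (rule sub)
  \<comment> \<open>An error below (1/4)^i against the threshold (1/2)^i leaves the bound (1/2)^i in
    the maximal inequality as well as in Markov's inequality, so both families of bad events have
    summable probabilities.\<close>
  have "\<forall>i::nat. \<exists>m g. g \<in> borel_measurable (F m) \<and> integrable M g \<and> (\<integral>x. \<bar>f x - g x\<bar> \<partial>M) < (1/4)^i"
    by (intro allI approx) simp
  then obtain m g where gF: "\<And>i. g i \<in> borel_measurable (F (m i))" and g: "\<And>i::nat. integrable M (g i)"
    and gl: "\<And>i. (\<integral>x. \<bar>f x - g i x\<bar> \<partial>M) < (1/4)^i" by metis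
  note [measurable] = borel_measurable_integrable[OF f] borel_measurable_integrable[OF g]
  define D where "D i x = ennreal \<bar>f x - g i x\<bar>" for i x
  have [measurable]: "D i \<in> borel_measurable M" for i unfolding D_def by measurable
  have Dint: "(\<integral>\<^sup>+x. D i x \<partial>M) \<le> ennreal ((1/4)^i)" for i
    unfolding D_def using f g gl[of i] by (subst nn_integral_eq_integral) (auto intro!: ennreal_leI)
  define A where "A i = {x \<in> space M. \<exists>n. nn_cond_exp M (F n) (D i) x > ennreal ((1/2)^i)}" for i
  define B where "B i = {x \<in> space M. D i x > ennreal ((1/2)^i)}" for i
  have [measurable]: "nn_cond_exp M (F n) (D i) \<in> borel_measurable M" for n i by simp
  have [measurable]: "A i \<in> sets M" "B i \<in> sets M" for i unfolding A_def B_def by measurable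
  have half: "measure M X \<le> (1/2)^i" if "ennreal ((1/2)^i) * emeasure M X \<le> ennreal ((1/4)^i)" for X and i :: nat
  proof -
    have "ennreal ((1/2)^i * measure M X) \<le> ennreal ((1/4)^i)"
      using that by (simp add: emeasure_eq_measure ennreal_mult')
    then have "(1/2)^i * measure M X \<le> (1/4)^i" by simp
    also have "(1/4::real)^i = (1/2)^i * (1/2)^i" by (simp flip: power_mult_distrib)
    finally show ?thesis by simp
  qed
  have mA: "measure M (A i) \<le> (1/2)^i" for i
    unfolding A_def by (rule half, rule order_trans[OF nn_cond_exp_maximal_inequality[OF sub mono] Dint]) simp_all
  have mB: "measure M (B i) \<le> (1/2)^i" for i
  proof (rule half)
    have "ennreal ((1/2)^i) * emeasure M (B i) = (\<integral>\<^sup>+x. ennreal ((1/2)^i) * indicator (B i) x \<partial>M)"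
      by (simp add: nn_integral_cmult)
    also have "\<dots> \<le> (\<integral>\<^sup>+x. D i x \<partial>M)"
      by (intro nn_integral_mono) (auto simp: B_def indicator_def)
    finally show "ennreal ((1/2)^i) * emeasure M (B i) \<le> ennreal ((1/4)^i)" using Dint[of i] by simp
  qed
  have sA: "summable (\<lambda>i. measure M (A i))" and sB: "summable (\<lambda>i. measure M (B i))"
    by (rule summable_comparison_test'[of "\<lambda>i. (1/2::real)^i" 0]; use mA mB in simp)+
  have evA: "AE x in M. eventually (\<lambda>i. x \<in> space M - A i) sequentially"
    by (intro borel_cantelli_AE1 sA) (auto simp: emeasure_eq_measure)
  have evB: "AE x in M. eventually (\<lambda>i. x \<in> space M - B i) sequentially"
    by (intro borel_cantelli_AE1 sB) (auto simp: emeasure_eq_measure)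
  \<comment> \<open>From stage \<open>m i\<close> on, conditioning leaves \<open>g i\<close>
    unchanged, so the distance to \<open>g i\<close> is that of a conditional expectation of
    \<open>f - g i\<close> from 0, dominated by the one of \<open>D i\<close>.\<close>
  have split: "AE x in M. \<forall>i. \<forall>n\<ge>m i. \<bar>real_cond_exp M (F n) f x - g i x\<bar> \<le> nn_cond_exp M (F n) (D i) x"
  proof (intro AE_all_countable[THEN iffD2] allI)
    fix i n
    show "AE x in M. m i \<le> n \<longrightarrow> ennreal \<bar>real_cond_exp M (F n) f x - g i x\<bar> \<le> nn_cond_exp M (F n) (D i) x"
    proof (cases "m i \<le> n")
      case True
      interpret S: finite_measure_subalgebra M "F n" by (rule fsub)
      have "g i \<in> borel_measurable (F n)"
        using gF[of i] mono[OF True] by (auto simp: measurable_def sp)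
      then have "AE x in M. real_cond_exp M (F n) (g i) x = g i x" using g by (intro S.real_cond_exp_F_meas)
      moreover have "AE x in M. real_cond_exp M (F n) (\<lambda>x. f x - g i x) x = real_cond_exp M (F n) f x - real_cond_exp M (F n) (g i) x"
        using f g by (intro S.real_cond_exp_diff)
      moreover have "AE x in M. \<bar>real_cond_exp M (F n) (\<lambda>x. f x - g i x) x\<bar> \<le> nn_cond_exp M (F n) (D i) x"
        unfolding D_def by (intro S.real_cond_exp_abs) measurable
      ultimately show ?thesis by eventually_elim auto
    qed simp
  qed
  show ?thesis using evA evB split
  proof eventually_elim
    case (elim x)
    show ?case
    proof (rule LIMSEQ_I)
      fix r :: real assume "r > 0"
      have "(\<lambda>i. (1/2::real)^i) \<longlonglongrightarrow> 0" by (rule LIMSEQ_realpow_zero) auto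
      then have "eventually (\<lambda>i. (1/2::real)^i < r/2) sequentially"
        using \<open>r > 0\<close> by (intro order_tendstoD(2)) auto
      with elim(1,2) have "eventually (\<lambda>i. x \<in> space M - A i \<and> x \<in> space M - B i \<and> (1/2::real)^i < r/2) sequentially"
        by eventually_elim auto
      \<comment> \<open>One good index is enough: outside \<open>A i\<close> and \<open>B i\<close>
        the conditional expectation and \<open>f x\<close> are both within (1/2)^i < r/2 of
        \<open>g i x\<close>, for all n beyond \<open>m i\<close> at once.\<close>
      then obtain i where i: "x \<in> space M - A i" "x \<in> space M - B i" "(1/2::real)^i < r/2"
        by (auto simp: eventually_sequentially)
      have fg: "\<bar>f x - g i x\<bar> \<le> (1/2)^i" using i(2) by (auto simp: B_def D_def not_less)
      have "\<bar>real_cond_exp M (F n) f x - f x\<bar> < r" if "n \<ge> m i" for n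
      proof -
        have "ennreal \<bar>real_cond_exp M (F n) f x - g i x\<bar> \<le> ennreal ((1/2)^i)"
          by (rule order_trans[of _ "nn_cond_exp M (F n) (D i) x"])
             (use elim(3) that i(1) in \<open>auto simp: A_def not_less\<close>)
        then have "\<bar>real_cond_exp M (F n) f x - g i x\<bar> \<le> (1/2)^i" by simp
        then show ?thesis using fg i(3) by linarith
      qed
      then show "\<exists>no. \<forall>n\<ge>no. norm (real_cond_exp M (F n) f x - f x) < r" by auto
    qed
  qed
qed

section \<open>Infinite product measures\<close>

text \<open>Second countability makes the product sigma-field coincide with the Borel field of the
  product topology.\<close>

lemma borel_measurable_PiM_continuous:
  fixes f :: "(nat \<Rightarrow> 'x::second_countable_topology) \<Rightarrow> 'b::topological_space"
  assumes "continuous_on UNIV f" "\<And>i. sets (M i) = sets borel"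
  shows "f \<in> borel_measurable (Pi\<^sub>M UNIV M)"
proof -
  have "sets (Pi\<^sub>M UNIV M) = sets (borel :: (nat \<Rightarrow> 'x) measure)"
    by (rule trans[OF sets_PiM_cong[OF refl assms(2)] sets_PiM_equal_borel])
  then show ?thesis
    using borel_measurable_continuous_onI[OF assms(1)] by (simp cong: measurable_cong_sets)
qed

lemma tendsto_fun_iff:
  fixes f :: "'c \<Rightarrow> 'a \<Rightarrow> 'b::topological_space"
  shows "(f \<longlongrightarrow> l) F \<longleftrightarrow> (\<forall>i. ((\<lambda>c. f c i) \<longlongrightarrow> l i) F)"
  using limitin_componentwise[of "\<lambda>_. euclidean" UNIV f l F]
  by (simp add: euclidean_product_topology flip: limitin_canonical_iff)

context sequence_space
begin

text \<open>Only the coordinates in \<open>J\<close> enter, and their joint law is a finite product,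
  where the integral factorises.\<close>

lemma integral_PiM_prod:
  fixes f :: "nat \<Rightarrow> 'a \<Rightarrow> real"
  assumes J: "finite J" and f: "\<And>i. i \<in> J \<Longrightarrow> integrable M (f i)"
  shows "(\<integral>\<omega>. (\<Prod>i\<in>J. f i (\<omega> i)) \<partial>S) = (\<Prod>i\<in>J. \<integral>x. f i x \<partial>M)"
proof -
  have r: "(\<lambda>\<omega>. restrict \<omega> J) \<in> S \<rightarrow>\<^sub>M Pi\<^sub>M J (\<lambda>_. M)" by (rule measurable_restrict_subset) simp
  have d: "distr S (Pi\<^sub>M J (\<lambda>_. M)) (\<lambda>\<omega>. restrict \<omega> J) = Pi\<^sub>M J (\<lambda>_. M)"
    using J by (intro distr_PiM_restrict_finite) auto
  have i: "integrable (Pi\<^sub>M J (\<lambda>_. M)) (\<lambda>\<omega>. \<Prod>i\<in>J. f i (\<omega> i))"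
    using product_integrable_prod[OF J f] by simp
  have c: "(\<lambda>\<omega>. \<Prod>i\<in>J. f i (restrict \<omega> J i)) = (\<lambda>\<omega>. \<Prod>i\<in>J. f i (\<omega> i))"
    by (intro ext prod.cong) auto
  have "(\<integral>\<omega>. (\<Prod>i\<in>J. f i (\<omega> i)) \<partial>distr S (Pi\<^sub>M J (\<lambda>_. M)) (\<lambda>\<omega>. restrict \<omega> J)) = (\<integral>\<omega>. (\<Prod>i\<in>J. f i (\<omega> i)) \<partial>S)"
    using i by (subst integral_distr[OF r]) (auto simp only: c borel_measurable_integrable)
  then show "(\<integral>\<omega>. (\<Prod>i\<in>J. f i (\<omega> i)) \<partial>S) = (\<Prod>i\<in>J. \<integral>x. f i x \<partial>M)"
    unfolding d using product_integral_prod[OF J f] by simp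
qed

lemma integral_PiM_mult:
  fixes f g :: "'a \<Rightarrow> real"
  assumes "i \<noteq> j" "integrable M f" "integrable M g"
  shows "(\<integral>\<omega>. f (\<omega> i) * g (\<omega> j) \<partial>S) = (\<integral>x. f x \<partial>M) * (\<integral>x. g x \<partial>M)"
  using integral_PiM_prod[of "{i, j}" "\<lambda>k. if k = i then f else g"] assms by auto

text \<open>Independence kills the off-diagonal terms of the expanded square, and the n diagonal
  terms are at most 1; division by the square of n gives 1/n. The bound is the same for every
  \<open>M\<close>, so it survives integration over the parameter.\<close>

lemma L2_law_of_large_numbers:
  fixes g :: "'a \<Rightarrow> real"
  assumes g[measurable]: "g \<in> borel_measurable M" and g01: "\<And>x. g x \<in> {0..1}" and n: "n > 0"
  shows "(\<integral>\<^sup>+\<omega>. ennreal (((\<Sum>i<n. g (\<omega> i)) / n - (\<integral>x. g x \<partial>M))\<^sup>2) \<partial>S) \<le> ennreal (1 / n)"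
proof -
  define c where "c = (\<integral>x. g x \<partial>M)"
  have gi: "integrable M g" using g01 by (intro M.integrable_const_bound[where B = 1]) auto
  have c01: "0 \<le> c" "c \<le> 1" unfolding c_def
    using g01 M.integral_le_const[OF gi, of 1] by (auto intro!: integral_nonneg)
  define h where "h x = g x - c" for x
  have h1: "\<bar>h x\<bar> \<le> 1" for x using g01[of x] c01 by (auto simp: h_def abs_le_iff)
  have hi: "integrable M h" unfolding h_def using gi by simp
  have h0: "(\<integral>x. h x \<partial>M) = 0" unfolding h_def using gi by (simp add: c_def M.prob_space)
  have [measurable]: "h \<in> borel_measurable M" unfolding h_def by measurable
  have hij: "integrable S (\<lambda>\<omega>. h (\<omega> i) * h (\<omega> j))" for i j
    using h1 by (intro P.integrable_const_bound[where B = 1]) (auto simp: abs_mult h1 intro!: mult_le_one)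
  have hh: "h x * h y \<le> 1" for x y
  proof -
    have "\<bar>h x\<bar> * \<bar>h y\<bar> \<le> 1" by (rule mult_le_one) (use h1 in auto)
    then show ?thesis using abs_ge_self[of "h x * h y"] unfolding abs_mult by linarith
  qed
  have eij: "(\<integral>\<omega>. h (\<omega> i) * h (\<omega> j) \<partial>S) \<le> (if i = j then 1 else 0)" for i j
  proof (cases "i = j")
    case True
    have "(\<integral>\<omega>. h (\<omega> i) * h (\<omega> j) \<partial>S) \<le> 1"
      using hh by (intro P.integral_le_const hij AE_I2)
    then show ?thesis using True by simp
  next
    case False then show ?thesis using integral_PiM_mult[OF False hi hi] h0 by simp
  qed
  have sum_h: "(\<Sum>i<n. g (\<omega> i)) / n - c = (\<Sum>i<n. h (\<omega> i)) / n" for \<omega>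
    using n by (simp add: h_def sum_subtractf field_simps)
  have sq: "((\<Sum>i<n. g (\<omega> i)) / n - c)\<^sup>2 = (\<Sum>i<n. \<Sum>j<n. h (\<omega> i) * h (\<omega> j)) / (real n)\<^sup>2" for \<omega>
    unfolding sum_h power_divide by (simp add: power2_eq_square sum_product)
  have sq_int: "integrable S (\<lambda>\<omega>. ((\<Sum>i<n. g (\<omega> i)) / n - c)\<^sup>2)"
    unfolding sq by (simp add: hij)
  have "(\<integral>\<^sup>+\<omega>. ennreal (((\<Sum>i<n. g (\<omega> i)) / n - c)\<^sup>2) \<partial>S) = ennreal (\<integral>\<omega>. ((\<Sum>i<n. g (\<omega> i)) / n - c)\<^sup>2 \<partial>S)"
    by (intro nn_integral_eq_integral) (simp_all add: sq_int)
  also have "(\<integral>\<omega>. ((\<Sum>i<n. g (\<omega> i)) / n - c)\<^sup>2 \<partial>S) = (\<Sum>i<n. \<Sum>j<n. (\<integral>\<omega>. h (\<omega> i) * h (\<omega> j) \<partial>S)) / (real n)\<^sup>2"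
    unfolding sq by (simp add: hij)
  also have "\<dots> \<le> (\<Sum>i<n. \<Sum>j<n. if i = j then 1 else 0) / (real n)\<^sup>2"
    by (intro divide_right_mono sum_mono eij) auto
  also have "\<dots> = 1 / n" using n by (simp add: power2_eq_square)
  finally show ?thesis unfolding c_def by (simp add: ennreal_leI)
qed

text \<open>Prepending an independent draw from \<open>M\<close> does not change the law of an
  i.i.d. sequence. Fubini then isolates the first coordinate, which drives the induction on the
  number of coordinates below.\<close>

lemma integral_PiM_case_nat:
  fixes f :: "(nat \<Rightarrow> 'a) \<Rightarrow> real"
  assumes f[measurable]: "f \<in> borel_measurable S" and B: "\<And>\<omega>. \<bar>f \<omega>\<bar> \<le> B"
  shows "(\<integral>\<omega>. f \<omega> \<partial>S) = (\<integral>x. \<integral>\<omega>. f (case_nat x \<omega>) \<partial>S \<partial>M)"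
proof -
  have MS: "pair_sigma_finite M S"
    by (simp add: pair_sigma_finite_def prob_space_imp_sigma_finite M.prob_space_axioms P.prob_space_axioms)
  have pp: "prob_space (M \<Otimes>\<^sub>M S)" by (intro prob_space_pair M.prob_space_axioms P.prob_space_axioms)
  have m[measurable]: "(\<lambda>(x, \<omega>). case_nat x \<omega>) \<in> M \<Otimes>\<^sub>M S \<rightarrow>\<^sub>M S" by measurable
  have "(\<integral>\<omega>. f \<omega> \<partial>S) = (\<integral>\<omega>. f \<omega> \<partial>distr (M \<Otimes>\<^sub>M S) S (\<lambda>(x, \<omega>). case_nat x \<omega>))"
    by (simp only: PiM_iter)
  also have "\<dots> = (\<integral>z. f (case_nat (fst z) (snd z)) \<partial>(M \<Otimes>\<^sub>M S))"
    by (subst integral_distr[OF m f]) (simp add: split_beta')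
  also have "\<dots> = (\<integral>x. \<integral>\<omega>. f (case_nat x \<omega>) \<partial>S \<partial>M)"
  proof -
    have "integrable (M \<Otimes>\<^sub>M S) (\<lambda>z. f (case_nat (fst z) (snd z)))"
      using B measurable_compose[OF m f] by (intro finite_measure.integrable_const_bound[where B = B] prob_space.finite_measure[OF pp]) (auto simp: split_beta')
    then show ?thesis by (subst pair_sigma_finite.integral_fst'[OF MS, symmetric]) auto
  qed
  finally show ?thesis .
qed

end

section \<open>Weak continuity of the infinite product\<close>

lemma sequence_space_prob: "prob_space M \<Longrightarrow> sequence_space M"
  unfolding sequence_space_def product_prob_space_def product_prob_space_axioms_def product_sigma_finite_def
  using prob_space_imp_sigma_finite by blast

text \<open>Fixing the first coordinate preserves this class.  The library metric on \<open>nat \<Rightarrow> 'x\<close> lacks this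
  property: it weights the coordinates through an unspecified enumeration.\<close>

definition coord_lipschitz :: "real \<Rightarrow> nat \<Rightarrow> ((nat \<Rightarrow> 'x::metric_space) \<Rightarrow> real) \<Rightarrow> bool" where
  "coord_lipschitz L N f \<longleftrightarrow> (\<forall>\<omega> \<eta>. \<bar>f \<omega> - f \<eta>\<bar> \<le> L * (\<Sum>i<N. dist (\<omega> i) (\<eta> i)))"

lemma coord_lipschitz_continuous:
  assumes "coord_lipschitz L N f"
  shows "continuous_on UNIV f"
proof (rule continuous_on_sequentiallyI)
  fix u and a :: "nat \<Rightarrow> 'a" assume u: "u \<longlonglongrightarrow> a"
  have ai: "(\<lambda>n. u n i) \<longlonglongrightarrow> a i" for i using u by (simp add: tendsto_fun_iff)
  have "(\<lambda>n. L * (\<Sum>i<N. dist (u n i) (a i))) \<longlonglongrightarrow> L * (\<Sum>i<N. dist (a i) (a i))"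
    by (intro tendsto_intros ai)
  then have z: "(\<lambda>n. L * (\<Sum>i<N. dist (u n i) (a i))) \<longlonglongrightarrow> 0" by simp
  have "(\<lambda>n. f (u n) - f a) \<longlonglongrightarrow> 0"
    by (rule Lim_null_comparison[OF always_eventually z]) (use assms in \<open>simp add: coord_lipschitz_def\<close>)
  then show "(\<lambda>n. f (u n)) \<longlonglongrightarrow> f a" by (rule LIM_zero_cancel)
qed

lemma (in prob_space) integral_diff_bound:
  fixes f g :: "'a \<Rightarrow> real"
  assumes "integrable M f" "integrable M g" "integrable M h" "\<And>x. x \<in> space M \<Longrightarrow> \<bar>f x - g x\<bar> \<le> h x"
  shows "\<bar>(\<integral>x. f x \<partial>M) - (\<integral>x. g x \<partial>M)\<bar> \<le> (\<integral>x. h x \<partial>M)"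
proof -
  have "\<bar>(\<integral>x. f x \<partial>M) - (\<integral>x. g x \<partial>M)\<bar> = \<bar>\<integral>x. f x - g x \<partial>M\<bar>" using assms by simp
  also have "\<dots> \<le> (\<integral>x. \<bar>f x - g x\<bar> \<partial>M)" by (rule integral_abs_bound)
  also have "\<dots> \<le> (\<integral>x. h x \<partial>M)" using assms by (intro integral_mono) auto
  finally show ?thesis .
qed

text \<open>The suprema of \<open>\<bar>h j - g\<bar>\<close> over \<open>j \<ge> K\<close> are Lipschitz, hence admissible test functions,
  and decrease to \<open>0\<close> pointwise.\<close>

lemma weak_convergence_lipschitz:
  fixes \<mu> :: "nat \<Rightarrow> 'x::metric_space measure" and h :: "nat \<Rightarrow> 'x \<Rightarrow> real"
  assumes \<mu>: "\<And>k. \<mu> k \<in> space (prob_algebra borel)" and M: "M \<in> space (prob_algebra borel)"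
    and conv: "\<And>f :: 'x \<Rightarrow> real. continuous_on UNIV f \<Longrightarrow> bounded (range f) \<Longrightarrow>
      (\<lambda>k. \<integral>x. f x \<partial>\<mu> k) \<longlonglongrightarrow> (\<integral>x. f x \<partial>M)"
    and hB: "\<And>k x. \<bar>h k x\<bar> \<le> B" and hL: "\<And>k x y. \<bar>h k x - h k y\<bar> \<le> L * dist x y"
    and lim: "\<And>x. (\<lambda>k. h k x) \<longlonglongrightarrow> g x"
  shows "(\<lambda>k. \<integral>x. h k x \<partial>\<mu> k) \<longlonglongrightarrow> (\<integral>x. g x \<partial>M)"
proof -
  have pM: "prob_space M" and sM: "sets M = sets borel" using M by (auto simp: space_prob_algebra)
  have p\<mu>: "prob_space (\<mu> k)" and s\<mu>: "sets (\<mu> k) = sets borel" for k using \<mu>[of k] by (auto simp: space_prob_algebra)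
  interpret M: prob_space M by fact
  have lip_cont: "continuous_on UNIV f" if "\<And>x y. \<bar>f x - f y\<bar> \<le> C * dist x y" for f :: "'x \<Rightarrow> real" and C
  proof (rule continuous_on_sequentiallyI)
    fix u and a :: 'x assume u: "u \<longlonglongrightarrow> a"
    have "(\<lambda>n. C * dist (u n) a) \<longlonglongrightarrow> C * dist a a" using u by (intro tendsto_intros)
    then have z: "(\<lambda>n. C * dist (u n) a) \<longlonglongrightarrow> 0" by simp
    have "(\<lambda>n. f (u n) - f a) \<longlonglongrightarrow> 0"
      by (rule Lim_null_comparison[OF always_eventually z]) (simp add: that)
    then show "(\<lambda>n. f (u n)) \<longlonglongrightarrow> f a" by (rule LIM_zero_cancel)
  qed
  have gB: "\<bar>g x\<bar> \<le> B" for x by (rule tendsto_upperbound[OF tendsto_rabs[OF lim]]) (auto simp: hB)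
  have gL: "\<bar>g x - g y\<bar> \<le> L * dist x y" for x y
    by (rule tendsto_upperbound[OF tendsto_rabs[OF tendsto_diff[OF lim lim]]]) (auto simp: hL)
  define u where "u K x = (SUP j\<in>{K..}. \<bar>h j x - g x\<bar>)" for K :: nat and x
  have d2: "\<bar>h j x - g x\<bar> \<le> 2 * B" for j x using hB[of j x] gB[of x] by linarith
  have bdd: "bdd_above ((\<lambda>j. \<bar>h j x - g x\<bar>) ` {K..})" for K x by (rule bdd_aboveI[of _ "2 * B"]) (use d2 in auto)
  have up: "\<bar>h j x - g x\<bar> \<le> u K x" if "j \<ge> K" for j K x
    unfolding u_def using that by (intro cSUP_upper bdd) auto
  have u0: "0 \<le> u K x" for K x using up[of K K x] by linarith
  have uB: "u K x \<le> 2 * B" for K x unfolding u_def by (intro cSUP_least) (auto simp: d2)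
  have uL1: "u K x - u K y \<le> (2 * L) * dist x y" for K x y
  proof -
    have "u K x \<le> u K y + 2 * L * dist x y" unfolding u_def[of K x]
    proof (intro cSUP_least)
      fix j assume "j \<in> {K..}"
      then show "\<bar>h j x - g x\<bar> \<le> u K y + 2 * L * dist x y"
        using up[of K j y] hL[of j x y] gL[of x y] by (auto simp: abs_le_iff)
    qed auto
    then show ?thesis by simp
  qed
  have uL: "\<bar>u K x - u K y\<bar> \<le> (2 * L) * dist x y" for K x y
    using uL1[of K x y] uL1[of K y x] by (auto simp: abs_le_iff dist_commute)
  have ulim: "(\<lambda>K. u K x) \<longlonglongrightarrow> 0" for x
  proof (rule LIMSEQ_I)
    fix r :: real assume r: "r > 0"
    obtain K0 where K0: "\<And>j. j \<ge> K0 \<Longrightarrow> \<bar>h j x - g x\<bar> < r/2"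
      using LIMSEQ_D[OF lim, of "r/2" x] r by auto
    have "norm (u K x - 0) < r" if "K \<ge> K0" for K
    proof -
      have "u K x \<le> r/2" unfolding u_def using K0 that by (intro cSUP_least) (auto intro: less_imp_le)
      then show ?thesis using u0[of K x] r by simp
    qed
    then show "\<exists>K0. \<forall>K\<ge>K0. norm (u K x - 0) < r" by blast
  qed
  have uc: "continuous_on UNIV (u K)" for K by (rule lip_cont[OF uL])
  have gc: "continuous_on UNIV g" by (rule lip_cont[OF gL])
  have hc: "continuous_on UNIV (h k)" for k by (rule lip_cont[OF hL])
  have bound: "bounded (range f)" if "\<And>x. \<bar>f x\<bar> \<le> C" for f :: "'x \<Rightarrow> real" and C
    using that by (intro boundedI[of _ C]) auto
  have int: "integrable N f" if "prob_space N" "sets N = sets borel" "continuous_on UNIV f" "\<And>x. \<bar>f x\<bar> \<le> C"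
    for N and f :: "'x \<Rightarrow> real" and C
    using that borel_measurable_continuous_onI[OF that(3)]
    by (intro finite_measure.integrable_const_bound[where B = C]) (auto simp: prob_space.finite_measure cong: measurable_cong_sets)
  have uB': "\<bar>u K x\<bar> \<le> 2 * B" for K x using u0[of K x] uB[of K x] by simp
  have "(\<lambda>K. \<integral>x. u K x \<partial>M) \<longlonglongrightarrow> (\<integral>x. 0 \<partial>M)"
  proof (rule integral_dominated_convergence[where w = "\<lambda>_. 2 * B"])
    show "u K \<in> borel_measurable M" for K
      using borel_measurable_continuous_onI[OF uc] sM by (simp cong: measurable_cong_sets)
  qed (use ulim uB' in auto)
  then have uint: "(\<lambda>K. \<integral>x. u K x \<partial>M) \<longlonglongrightarrow> 0" by simp
  show ?thesis
  proof (rule LIMSEQ_I)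
    fix r :: real assume r: "r > 0"
    \<comment> \<open>\<open>K\<close> is fixed before \<open>k\<close> varies, so weak convergence
      is applied only to the fixed functions \<open>u K\<close> and \<open>g\<close>, while
      \<open>u K\<close> dominates \<open>\<bar>h k x - g x\<bar>\<close> for every
      \<open>k \<ge> K\<close>.\<close>
    obtain K where K: "(\<integral>x. u K x \<partial>M) < r/2"
      using order_tendstoD(2)[OF uint, of "r/2"] r by (auto simp: eventually_sequentially)
    have "(\<lambda>k. (\<integral>x. u K x \<partial>\<mu> k) + \<bar>(\<integral>x. g x \<partial>\<mu> k) - (\<integral>x. g x \<partial>M)\<bar>)
      \<longlonglongrightarrow> (\<integral>x. u K x \<partial>M) + \<bar>(\<integral>x. g x \<partial>M) - (\<integral>x. g x \<partial>M)\<bar>"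
      by (intro tendsto_intros conv uc gc bound[OF uB'] bound[OF gB])
    then have "eventually (\<lambda>k. (\<integral>x. u K x \<partial>\<mu> k) + \<bar>(\<integral>x. g x \<partial>\<mu> k) - (\<integral>x. g x \<partial>M)\<bar> < r) sequentially"
      by (rule order_tendstoD(2)) (use K r in simp)
    then have "eventually (\<lambda>k. norm ((\<integral>x. h k x \<partial>\<mu> k) - (\<integral>x. g x \<partial>M)) < r) sequentially"
      using eventually_ge_at_top[of K]
    proof eventually_elim
      case (elim k)
      have "\<bar>(\<integral>x. h k x \<partial>\<mu> k) - (\<integral>x. g x \<partial>\<mu> k)\<bar> \<le> (\<integral>x. u K x \<partial>\<mu> k)"
        using up[OF elim(2)]
        by (rule prob_space.integral_diff_bound[OF p\<mu> int[OF p\<mu> s\<mu> hc hB] int[OF p\<mu> s\<mu> gc gB] int[OF p\<mu> s\<mu> uc uB']])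
      then show ?case using elim(1) unfolding real_norm_def by linarith
    qed
    then show "\<exists>no. \<forall>n\<ge>no. norm ((\<integral>x. h n x \<partial>\<mu> n) - (\<integral>x. g x \<partial>M)) < r"
      by (simp add: eventually_sequentially)
  qed
qed

text \<open>Induction on the number of coordinates. With the first coordinate frozen at
  \<open>x\<close>, the integral over the others converges by the induction hypothesis; its value
  depends on \<open>k\<close> too, so the outer limit has a varying integrand under a varying
  measure. Lipschitz continuity in \<open>x\<close>, uniform in \<open>k\<close>, is what makes that
  limit available.\<close>

lemma weak_convergence_PiM_coord_lipschitz:
  fixes \<mu> :: "nat \<Rightarrow> 'x::{metric_space, second_countable_topology} measure"
  assumes \<mu>: "\<And>k. \<mu> k \<in> space (prob_algebra borel)" and M: "M \<in> space (prob_algebra borel)"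
    and conv: "\<And>f :: 'x \<Rightarrow> real. continuous_on UNIV f \<Longrightarrow> bounded (range f) \<Longrightarrow>
      (\<lambda>k. \<integral>x. f x \<partial>\<mu> k) \<longlonglongrightarrow> (\<integral>x. f x \<partial>M)"
    and "coord_lipschitz L N f" and "\<And>\<omega>. \<bar>f \<omega>\<bar> \<le> B"
  shows "(\<lambda>k. \<integral>\<omega>. f \<omega> \<partial>Pi\<^sub>M UNIV (\<lambda>_. \<mu> k)) \<longlonglongrightarrow> (\<integral>\<omega>. f \<omega> \<partial>Pi\<^sub>M UNIV (\<lambda>_. M))"
  using assms(4,5)
proof (induction N arbitrary: f)
  case 0
  obtain c where "f = (\<lambda>_. c)"
    using 0(1) by (force simp: coord_lipschitz_def intro: ext)
  then show ?case
    using \<mu> M by (auto simp: space_prob_algebra prob_space_PiM prob_space.prob_space)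
next
  case (Suc N)
  have fL: "\<bar>f (case_nat x \<omega>) - f (case_nat y \<eta>)\<bar> \<le> L * dist x y + L * (\<Sum>i<N. dist (\<omega> i) (\<eta> i))" for x y \<omega> \<eta>
    using Suc.prems(1)[unfolded coord_lipschitz_def, rule_format, of "case_nat x \<omega>" "case_nat y \<eta>"]
    by (simp add: sum.lessThan_Suc_shift distrib_left del: sum.lessThan_Suc)
  have lip: "coord_lipschitz L N (\<lambda>\<omega>. f (case_nat x \<omega>))" for x
    using fL[of x _ x] by (simp add: coord_lipschitz_def)
  have fc: "continuous_on UNIV f" by (rule coord_lipschitz_continuous[OF Suc.prems(1)])
  define h where "h N x = (\<integral>\<omega>. f (case_nat x \<omega>) \<partial>Pi\<^sub>M UNIV (\<lambda>_. N))" for N x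
  have int: "integrable (Pi\<^sub>M UNIV (\<lambda>_. N)) (\<lambda>\<omega>. f (case_nat x \<omega>))" if "N \<in> space (prob_algebra borel)" for N x
    using that Suc.prems(2)
    by (intro finite_measure.integrable_const_bound[where B = B] prob_space.finite_measure prob_space_PiM
        borel_measurable_PiM_continuous coord_lipschitz_continuous[OF lip]) (auto simp: space_prob_algebra)
  have hB: "\<bar>h N x\<bar> \<le> B" if N: "N \<in> space (prob_algebra borel)" for N x
  proof -
    interpret prob_space "Pi\<^sub>M UNIV (\<lambda>_::nat. N)" using N by (intro prob_space_PiM) (auto simp: space_prob_algebra)
    have "\<bar>h N x\<bar> \<le> (\<integral>\<omega>. \<bar>f (case_nat x \<omega>)\<bar> \<partial>Pi\<^sub>M UNIV (\<lambda>_. N))" unfolding h_def by (rule integral_abs_bound)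
    also have "\<dots> \<le> B" using Suc.prems(2) by (intro integral_le_const integrable_abs int N) auto
    finally show ?thesis .
  qed
  have hL: "\<bar>h N x - h N y\<bar> \<le> L * dist x y" if N: "N \<in> space (prob_algebra borel)" for N x y
  proof -
    interpret prob_space "Pi\<^sub>M UNIV (\<lambda>_::nat. N)" using N by (intro prob_space_PiM) (auto simp: space_prob_algebra)
    have "\<bar>h N x - h N y\<bar> \<le> (\<integral>\<omega>. L * dist x y \<partial>Pi\<^sub>M UNIV (\<lambda>_::nat. N))"
      unfolding h_def using fL[of x \<omega> y \<omega> for \<omega>] by (intro integral_diff_bound int N) auto
    then show ?thesis by (simp add: prob_space)
  qed
  have iter: "(\<integral>\<omega>. f \<omega> \<partial>Pi\<^sub>M UNIV (\<lambda>_. N)) = (\<integral>x. h N x \<partial>N)" if N: "N \<in> space (prob_algebra borel)" for N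
    unfolding h_def using N Suc.prems(2)
    by (intro sequence_space.integral_PiM_case_nat sequence_space_prob borel_measurable_PiM_continuous[OF fc])
      (auto simp: space_prob_algebra)
  show ?case unfolding iter[OF \<mu>] iter[OF M]
  proof (rule weak_convergence_lipschitz[OF \<mu> M conv])
    show "(\<lambda>k. h (\<mu> k) x) \<longlonglongrightarrow> h M x" for x
      unfolding h_def by (rule Suc.IH[OF lip]) (rule Suc.prems(2))
    show "\<bar>h (\<mu> k) x\<bar> \<le> B" "\<bar>h (\<mu> k) x - h (\<mu> k) y\<bar> \<le> L * dist x y" for k x y
      by (rule hB[OF \<mu>], rule hL[OF \<mu>])
  qed
qed

text \<open>Infimal convolution of \<open>f\<close> with the penalty
  \<open>real N * (\<Sum>i<N. dist (\<omega> i) (\<eta> i))\<close>. The infimum inherits the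
  Lipschitz property of the penalty, and \<open>N\<close> acts both as its constant and as the
  number of coordinates it sees, so that in the limit every coordinate is forced.\<close>

lemma continuous_approx_coord_lipschitz:
  fixes f :: "(nat \<Rightarrow> 'x::metric_space) \<Rightarrow> real"
  assumes f: "continuous_on UNIV f" and B: "\<And>\<omega>. \<bar>f \<omega>\<bar> \<le> B"
  obtains g where "\<And>N. coord_lipschitz (real N) N (g N)" "\<And>N \<omega>. \<bar>g N \<omega>\<bar> \<le> B" "\<And>N \<omega>. g N \<omega> \<le> f \<omega>"
    "\<And>\<omega>. (\<lambda>N. g N \<omega>) \<longlonglongrightarrow> f \<omega>"
proof
  define d where "d N \<omega> \<eta> = real N * (\<Sum>i<N. dist (\<omega> i) (\<eta> i))" for N and \<omega> \<eta> :: "nat \<Rightarrow> 'x"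
  define g where "g N \<omega> = (INF \<eta>. f \<eta> + d N \<omega> \<eta>)" for N \<omega>
  have d0: "0 \<le> d N \<omega> \<eta>" for N \<omega> \<eta> unfolding d_def by (intro mult_nonneg_nonneg sum_nonneg) auto
  have dt: "d N \<omega> \<eta> \<le> d N \<omega> \<zeta> + d N \<zeta> \<eta>" for N \<omega> \<eta> \<zeta>
    unfolding d_def distrib_left[symmetric] sum.distrib[symmetric]
    by (intro mult_left_mono sum_mono dist_triangle) auto
  have low: "- B \<le> f \<eta> + d N \<omega> \<eta>" for N \<omega> \<eta> using B[of \<eta>] d0[of N \<omega> \<eta>] by linarith
  have bdd: "bdd_below (range (\<lambda>\<eta>. f \<eta> + d N \<omega> \<eta>))" for N \<omega> by (rule bdd_belowI[of _ "- B"]) (use low in auto)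
  have le: "g N \<omega> \<le> f \<eta> + d N \<omega> \<eta>" for N \<omega> \<eta> unfolding g_def by (rule cINF_lower[OF bdd]) simp
  show gf: "g N \<omega> \<le> f \<omega>" for N \<omega> using le[of N \<omega> \<omega>] by (simp add: d_def)
  show "\<bar>g N \<omega>\<bar> \<le> B" for N \<omega>
  proof -
    have "- B \<le> g N \<omega>" unfolding g_def by (intro cINF_greatest low) auto
    then show ?thesis using gf[of N \<omega>] B[of \<omega>] by linarith
  qed
  have gl: "g N \<omega> \<le> g N \<zeta> + d N \<omega> \<zeta>" for N \<omega> \<zeta>
  proof -
    have "g N \<omega> - d N \<omega> \<zeta> \<le> g N \<zeta>" unfolding g_def[of N \<zeta>]
    proof (intro cINF_greatest)
      fix \<eta> show "g N \<omega> - d N \<omega> \<zeta> \<le> f \<eta> + d N \<zeta> \<eta>" using le[of N \<omega> \<eta>] dt[of N \<omega> \<eta> \<zeta>] by linarith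
    qed auto
    then show ?thesis by simp
  qed
  have dsym: "d N \<omega> \<zeta> = d N \<zeta> \<omega>" for N \<omega> \<zeta> by (simp add: d_def dist_commute)
  show "coord_lipschitz (real N) N (g N)" for N
    unfolding coord_lipschitz_def d_def[symmetric]
    using gl dsym by (auto simp: abs_le_iff algebra_simps) (metis add.commute)+
  show "(\<lambda>N. g N \<omega>) \<longlonglongrightarrow> f \<omega>" for \<omega>
  proof -
    \<comment> \<open>Choose near-minimisers; the slack \<open>1 / real (Suc N)\<close> is positive
      for all \<open>N\<close> and vanishes. Their penalty stays below \<open>2 * B + 1\<close>
      since \<open>f\<close> and \<open>g N\<close> are bounded by \<open>B\<close>, hence each
      coordinate \<open>i < N\<close> lies within \<open>(2 * B + 1) / N\<close> of
      \<open>\<omega> i\<close>, and continuity of \<open>f\<close> closes the gap from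
      below.\<close>
    have "\<exists>\<eta>. f \<eta> + d N \<omega> \<eta> < g N \<omega> + 1 / real (Suc N)" for N
      using cInf_lessD[of "range (\<lambda>\<eta>. f \<eta> + d N \<omega> \<eta>)" "g N \<omega> + 1 / real (Suc N)"] by (auto simp: g_def)
    then obtain \<eta> where \<eta>: "\<And>N. f (\<eta> N) + d N \<omega> (\<eta> N) < g N \<omega> + 1 / real (Suc N)" by metis
    have dB: "d N \<omega> (\<eta> N) \<le> 2 * B + 1" for N
    proof -
      have "1 / real (Suc N) \<le> 1" by simp
      then show ?thesis using \<eta>[of N] gf[of N \<omega>] B[of \<omega>] B[of "\<eta> N"] by linarith
    qed
    have "\<eta> \<longlonglongrightarrow> \<omega>"
      unfolding tendsto_fun_iff
    proof
      fix i
      have "(\<lambda>N. dist (\<eta> N i) (\<omega> i)) \<longlonglongrightarrow> 0"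
      proof (rule tendsto_sandwich[OF _ _ tendsto_const lim_const_over_n[of "2 * B + 1"]])
        show "eventually (\<lambda>N. dist (\<eta> N i) (\<omega> i) \<le> (2 * B + 1) / real N) sequentially"
          using eventually_gt_at_top[of i]
        proof eventually_elim
          case (elim N)
          have "real N * dist (\<omega> i) (\<eta> N i) \<le> d N \<omega> (\<eta> N)"
            unfolding d_def using elim by (intro mult_left_mono member_le_sum) auto
          then show ?case using dB[of N] elim by (simp add: field_simps dist_commute)
        qed
      qed simp
      then show "(\<lambda>N. \<eta> N i) \<longlonglongrightarrow> \<omega> i" by (subst tendsto_dist_iff)
    qed
    then have fe: "(\<lambda>N. f (\<eta> N)) \<longlonglongrightarrow> f \<omega>"
      using continuous_on_tendsto_compose[OF f] by auto
    have "(\<lambda>N. f (\<eta> N) - 1 / real (Suc N)) \<longlonglongrightarrow> f \<omega> - 0"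
      by (intro tendsto_diff fe LIMSEQ_Suc lim_const_over_n)
    then have lo: "(\<lambda>N. f (\<eta> N) - 1 / real (Suc N)) \<longlonglongrightarrow> f \<omega>" by simp
    have ev: "f (\<eta> N) - 1 / real (Suc N) \<le> g N \<omega>" for N using \<eta>[of N] d0[of N \<omega> "\<eta> N"] by linarith
    show ?thesis
      by (rule tendsto_sandwich[OF always_eventually always_eventually lo tendsto_const]) (use ev gf in auto)
  qed
qed

text \<open>Approximation from below by functions of finitely many coordinates bounds the lower
  limit; the upper limit follows by applying the same bound to \<open>- f\<close>. No uniform
  approximation of \<open>f\<close> is required.\<close>

lemma weak_convergence_PiM:
  fixes \<mu> :: "nat \<Rightarrow> 'x::{metric_space, second_countable_topology} measure"
    and f :: "(nat \<Rightarrow> 'x) \<Rightarrow> real"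
  assumes \<mu>: "\<And>k. \<mu> k \<in> space (prob_algebra borel)" and M: "M \<in> space (prob_algebra borel)"
    and conv: "\<And>f :: 'x \<Rightarrow> real. continuous_on UNIV f \<Longrightarrow> bounded (range f) \<Longrightarrow>
      (\<lambda>k. \<integral>x. f x \<partial>\<mu> k) \<longlonglongrightarrow> (\<integral>x. f x \<partial>M)"
    and f: "continuous_on UNIV f" and B: "\<And>\<omega>. \<bar>f \<omega>\<bar> \<le> B"
  shows "(\<lambda>k. \<integral>\<omega>. f \<omega> \<partial>Pi\<^sub>M UNIV (\<lambda>_. \<mu> k)) \<longlonglongrightarrow> (\<integral>\<omega>. f \<omega> \<partial>Pi\<^sub>M UNIV (\<lambda>_. M))"
proof -
  have int: "integrable (Pi\<^sub>M UNIV (\<lambda>_. N)) f"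
    if "N \<in> space (prob_algebra borel)" "continuous_on UNIV f" "\<And>\<omega>. \<bar>f \<omega>\<bar> \<le> B"
    for N and f :: "(nat \<Rightarrow> 'x) \<Rightarrow> real"
    using that
    by (intro finite_measure.integrable_const_bound[where B = B] prob_space.finite_measure prob_space_PiM
        borel_measurable_PiM_continuous) (auto simp: space_prob_algebra)
  have lower: "eventually (\<lambda>k. a < (\<integral>\<omega>. f \<omega> \<partial>Pi\<^sub>M UNIV (\<lambda>_. \<mu> k))) sequentially"
    if f: "continuous_on UNIV f" and B: "\<And>\<omega>. \<bar>f \<omega>\<bar> \<le> B" and a: "a < (\<integral>\<omega>. f \<omega> \<partial>Pi\<^sub>M UNIV (\<lambda>_. M))"
    for f :: "(nat \<Rightarrow> 'x) \<Rightarrow> real" and a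
  proof -
    obtain g where gL: "\<And>N. coord_lipschitz (real N) N (g N)" and gB: "\<And>N \<omega>. \<bar>g N \<omega>\<bar> \<le> B"
      and gf: "\<And>N \<omega>. g N \<omega> \<le> f \<omega>" and gl: "\<And>\<omega>. (\<lambda>N. g N \<omega>) \<longlonglongrightarrow> f \<omega>"
      using continuous_approx_coord_lipschitz[OF f B] by blast
    note gc = coord_lipschitz_continuous[OF gL]
    have "(\<lambda>N. \<integral>\<omega>. g N \<omega> \<partial>Pi\<^sub>M UNIV (\<lambda>_. M)) \<longlonglongrightarrow> (\<integral>\<omega>. f \<omega> \<partial>Pi\<^sub>M UNIV (\<lambda>_. M))"
      using gl gB int[OF M, of "\<lambda>_. B"] B[THEN order_trans[OF abs_ge_zero]]
      by (intro integral_dominated_convergence[where w = "\<lambda>_. B"] borel_measurable_integrable int[OF M] f B gc) auto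
    from order_tendstoD(1)[OF this a] obtain N where N: "a < (\<integral>\<omega>. g N \<omega> \<partial>Pi\<^sub>M UNIV (\<lambda>_. M))"
      by (auto simp: eventually_sequentially)
    have "(\<lambda>k. \<integral>\<omega>. g N \<omega> \<partial>Pi\<^sub>M UNIV (\<lambda>_. \<mu> k)) \<longlonglongrightarrow> (\<integral>\<omega>. g N \<omega> \<partial>Pi\<^sub>M UNIV (\<lambda>_. M))"
      by (rule weak_convergence_PiM_coord_lipschitz[OF \<mu> M _ gL gB]) (rule conv)
    from order_tendstoD(1)[OF this N] show ?thesis
    proof eventually_elim
      case (elim k)
      have "(\<integral>\<omega>. g N \<omega> \<partial>Pi\<^sub>M UNIV (\<lambda>_. \<mu> k)) \<le> (\<integral>\<omega>. f \<omega> \<partial>Pi\<^sub>M UNIV (\<lambda>_. \<mu> k))"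
        by (intro integral_mono int[OF \<mu>] gc gB f B gf)
      then show ?case using elim by simp
    qed
  qed
  show ?thesis
  proof (rule order_tendstoI)
    fix a assume "a > (\<integral>\<omega>. f \<omega> \<partial>Pi\<^sub>M UNIV (\<lambda>_. M))"
    then show "eventually (\<lambda>k. (\<integral>\<omega>. f \<omega> \<partial>Pi\<^sub>M UNIV (\<lambda>_. \<mu> k)) < a) sequentially"
      using lower[of "\<lambda>\<omega>. - f \<omega>" "- a"] f B by (simp add: continuous_on_minus)
  qed (rule lower[OF f B])
qed

section \<open>Doob's consistency theorem\<close>

text \<open>The finite intersections of a countable base form a countable pi-system generating the
  Borel sets, and such a system determines a probability measure. The empty intersection contributes
  \<open>UNIV\<close>, which serves as the exhausting set in the uniqueness theorem.\<close>

lemma countable_separating_sets: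
  obtains B :: "nat \<Rightarrow> 'x::second_countable_topology set" where "\<And>j. B j \<in> sets borel"
    "\<And>M N. M \<in> space (prob_algebra borel) \<Longrightarrow> N \<in> space (prob_algebra borel) \<Longrightarrow>
      (\<And>j. measure M (B j) = measure N (B j)) \<Longrightarrow> M = N"
proof -
  obtain \<B> :: "'x set set" where cB: "countable \<B>" and B: "topological_basis \<B>"
    using ex_countable_basis by auto
  define E where "E = Inter ` {F. finite F \<and> F \<subseteq> \<B>}"
  have cE: "countable E" unfolding E_def using countable_Collect_finite_subset[OF cB] by (intro countable_image)
  have ne: "E \<noteq> {}" by (auto simp: E_def)
  have opn: "open X" if "X \<in> E" for X
    using that topological_basis_open[OF B] by (auto simp: E_def intro!: open_Inter)
  have UE: "UNIV \<in> E" unfolding E_def by (intro image_eqI[of _ _ "{}"]) auto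
  have BE: "\<B> \<subseteq> E"
  proof
    fix X assume "X \<in> \<B>" then show "X \<in> E" unfolding E_def by (intro image_eqI[of _ _ "{X}"]) auto
  qed
  have stable: "Int_stable E"
  proof (rule Int_stableI)
    fix X Y assume "X \<in> E" "Y \<in> E"
    then obtain F G where "finite F" "F \<subseteq> \<B>" "X = \<Inter>F" "finite G" "G \<subseteq> \<B>" "Y = \<Inter>G" by (auto simp: E_def)
    then show "X \<inter> Y \<in> E" unfolding E_def by (intro image_eqI[of _ _ "F \<union> G"]) auto
  qed
  have sE: "sets (borel :: 'x measure) = sigma_sets UNIV E"
  proof
    have "sets (borel :: 'x measure) = sigma_sets UNIV \<B>"
      unfolding borel_eq_countable_basis[OF cB B] by (rule sets_measure_of) simp
    also have "\<dots> \<subseteq> sigma_sets UNIV E" by (rule sigma_sets_mono'[OF BE])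
    finally show "sets (borel :: 'x measure) \<subseteq> sigma_sets UNIV E" .
    show "sigma_sets UNIV E \<subseteq> sets (borel :: 'x measure)"
      using sets.sigma_sets_subset[of E "borel :: 'x measure"] borel_open[OF opn] by (simp add: subset_iff)
  qed
  show thesis
  proof
    show "from_nat_into E j \<in> sets borel" for j
      using opn[OF from_nat_into[OF ne]] by simp
    fix M N :: "'x measure"
    assume MN: "M \<in> space (prob_algebra borel)" "N \<in> space (prob_algebra borel)"
      and eq: "\<And>j. measure M (from_nat_into E j) = measure N (from_nat_into E j)"
    have fin: "finite_measure M" "finite_measure N" using MN by (auto simp: space_prob_algebra prob_space.finite_measure)
    show "M = N"
    proof (rule measure_eqI_generator_eq[OF stable, where A = "\<lambda>_. UNIV"])
      fix X assume "X \<in> E"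
      then obtain j where "X = from_nat_into E j" using from_nat_into_surj[OF cE] by metis
      then show "emeasure M X = emeasure N X" using eq fin by (simp add: finite_measure.emeasure_eq_measure)
    qed (use MN UE fin sE in \<open>auto simp: space_prob_algebra finite_measure.emeasure_eq_measure\<close>)
  qed
qed

lemma continuous_approx_closed:
  fixes M :: "'a::metric_space measure"
  assumes M: "prob_space M" and sM: "sets M = sets borel" and C: "closed C" and e: "e > 0"
  obtains \<phi> :: "'a \<Rightarrow> real" where "continuous_on UNIV \<phi>" "\<And>y. \<phi> y \<in> {0..1}"
    "(\<integral>y. \<bar>indicator C y - \<phi> y\<bar> \<partial>M) < e"
proof (cases "C = {}")
  \<comment> \<open>The distance \<open>infdist\<close> to the empty set is 0 by convention, so the
    formula used below would give the constant 1 here instead of 0.\<close>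
  case True then show ?thesis using e that[of "\<lambda>_. 0"] by simp
next
  case False
  interpret prob_space M by fact
  define \<phi> where "\<phi> k y = max 0 (1 - real k * infdist y C)" for k y
  have \<phi>c: "continuous_on UNIV (\<phi> k)" for k unfolding \<phi>_def by (intro continuous_intros)
  have \<phi>01: "\<phi> k y \<in> {0..1}" for k y by (auto simp: \<phi>_def infdist_nonneg)
  have lim: "(\<lambda>k. \<bar>indicator C y - \<phi> k y\<bar>) \<longlonglongrightarrow> 0" for y
  proof (cases "y \<in> C")
    case True then show ?thesis by (simp add: \<phi>_def)
  next
    case y: False
    have pos: "infdist y C > 0"
      using C False y in_closed_iff_infdist_zero[of C y] infdist_nonneg[of y C] by (simp add: less_le)
    obtain k0 :: nat where k0: "real k0 * infdist y C > 1" using pos ex_less_of_nat_mult by blast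
    have "eventually (\<lambda>k. \<bar>indicator C y - \<phi> k y\<bar> = 0) sequentially"
      using eventually_ge_at_top[of k0]
    proof eventually_elim
      case (elim k)
      have "real k0 * infdist y C \<le> real k * infdist y C" using elim pos by simp
      then show ?case using k0 y by (simp add: \<phi>_def)
    qed
    then show ?thesis by (rule tendsto_eventually)
  qed
  have "(\<lambda>k. \<integral>y. \<bar>indicator C y - \<phi> k y\<bar> \<partial>M) \<longlonglongrightarrow> (\<integral>y. 0 \<partial>M)"
  proof (rule integral_dominated_convergence[where w = "\<lambda>_. 1"])
    show "(\<lambda>y. \<bar>indicator C y - \<phi> k y\<bar>) \<in> borel_measurable M" for k
      using borel_measurable_continuous_onI[OF \<phi>c] C
      by (intro borel_measurable_abs borel_measurable_diff borel_measurable_indicator)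
         (simp_all add: sM cong: measurable_cong_sets)
    have "\<bar>indicator C y - \<phi> k y\<bar> \<le> 1" for k y
      using \<phi>01[of k y] by (auto simp: indicator_def)
    then show "AE y in M. norm \<bar>indicator C y - \<phi> k y\<bar> \<le> 1" for k by simp
  qed (use lim in auto)
  then have "(\<lambda>k. \<integral>y. \<bar>indicator C y - \<phi> k y\<bar> \<partial>M) \<longlonglongrightarrow> 0" by simp
  from order_tendstoD(2)[OF this e] obtain k where "(\<integral>y. \<bar>indicator C y - \<phi> k y\<bar> \<partial>M) < e"
    by (auto simp: eventually_sequentially)
  then show ?thesis using that[of "\<phi> k"] \<phi>c \<phi>01 by auto
qed

text \<open>Inner regularity on the graph of \<open>T\<close>: projecting a compact subset of the part of the graph
  above \<open>A\<close> gives a compact set whose preimage is, by injectivity, contained in \<open>A\<close>.  This replaces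
  the Lusin--Souslin theorem.\<close>

lemma injective_borel_approx:
  fixes T :: "'t::polish_space \<Rightarrow> 'y::polish_space"
  assumes q: "prob_space q" and sq: "sets q = sets borel" and T: "T \<in> borel_measurable borel" and inj: "inj T"
    and A: "A \<in> sets borel" and e: "e > 0"
  obtains \<phi> :: "'y \<Rightarrow> real" where "continuous_on UNIV \<phi>" "\<And>y. \<phi> y \<in> {0..1}"
    "(\<integral>\<theta>. \<bar>indicator A \<theta> - \<phi> (T \<theta>)\<bar> \<partial>q) < e"
proof -
  interpret q: prob_space q by fact
  note [measurable] = T A
  note [measurable_cong] = sq
  define \<nu> where "\<nu> = distr q borel (\<lambda>\<theta>. (\<theta>, T \<theta>))"
  have gT[measurable]: "(\<lambda>\<theta>. (\<theta>, T \<theta>)) \<in> q \<rightarrow>\<^sub>M borel" unfolding borel_prod[symmetric] by measurable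
  \<comment> \<open>Membership in the graph is expressed by a vanishing distance, a Borel function
    of the pair, so that \<open>G\<close> is Borel in the product. Its mass under the law of
    \<open>(\<theta>, T \<theta>)\<close> is the mass of \<open>A\<close> under
    \<open>q\<close>.\<close>
  define G where "G = {z. fst z \<in> A \<and> dist (snd z) (T (fst z)) = 0}"
  have "{z \<in> space (borel \<Otimes>\<^sub>M borel). fst z \<in> A \<and> dist (snd z) (T (fst z)) = 0} \<in> sets (borel \<Otimes>\<^sub>M borel)"
    by measurable
  then have G: "G \<in> sets borel" unfolding borel_prod by (simp add: G_def)
  have GA: "(\<lambda>\<theta>. (\<theta>, T \<theta>)) -` G \<inter> space q = A"
    using sets_eq_imp_space_eq[OF sq] by (auto simp: G_def)
  have \<nu>G: "emeasure \<nu> G = emeasure q A" unfolding \<nu>_def by (simp add: emeasure_distr[OF gT] G GA)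
  interpret \<nu>: prob_space \<nu> unfolding \<nu>_def by (rule q.prob_space_distr[OF gT])
  have inner: "emeasure \<nu> G = (SUP K\<in>{K. K \<subseteq> G \<and> compact K}. emeasure \<nu> K)"
    by (rule inner_regular[OF _ _ G]) (simp_all add: \<nu>_def[symmetric] \<nu>.emeasure_space_1, simp add: \<nu>_def)
  obtain K where K: "K \<subseteq> G" "compact K" and Kl: "emeasure \<nu> G < emeasure \<nu> K + ennreal (e/2)"
    using SUP_approx_ennreal[OF _ _ inner, of "e/2"] e compact_empty empty_subsetI by fastforce
  define C where "C = snd ` K"
  have C: "closed C" unfolding C_def by (intro compact_imp_closed compact_continuous_image continuous_intros K)
  have [measurable]: "C \<in> sets borel" using C by simp
  define D where "D = T -` C"
  have DA: "D \<subseteq> A"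
  proof
    fix \<theta> assume "\<theta> \<in> D"
    then obtain \<theta>' where "(\<theta>', T \<theta>) \<in> K" by (auto simp: D_def C_def)
    then have "\<theta>' \<in> A" "T \<theta> = T \<theta>'" using K(1) by (auto simp: G_def)
    then show "\<theta> \<in> A" using inj by (auto dest: injD)
  qed
  have spq: "space q = UNIV" using sets_eq_imp_space_eq[OF sq] by simp
  have Dm[measurable]: "D \<in> sets borel" unfolding D_def using measurable_sets_borel[OF T, of C] C by simp
  have Kb: "K \<in> sets borel" using K(2) by (intro borel_closed compact_imp_closed)
  have "emeasure \<nu> K \<le> emeasure q D"
  proof -
    have "(\<lambda>\<theta>. (\<theta>, T \<theta>)) -` K \<inter> space q \<subseteq> D" by (force simp: D_def C_def)
    then show ?thesis unfolding \<nu>_def emeasure_distr[OF gT Kb] by (rule emeasure_mono) (simp add: sq Dm)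
  qed
  with Kl have "emeasure q A < emeasure q D + ennreal (e/2)"
    unfolding \<nu>G by (metis add.commute add_left_mono order_less_le_trans)
  then have mAD: "measure q A < measure q D + e/2"
    using e by (simp add: q.emeasure_eq_measure ennreal_plus[symmetric] ennreal_less_iff del: ennreal_plus)
  interpret d: prob_space "distr q borel T" by (rule q.prob_space_distr) measurable
  obtain \<phi> :: "'y \<Rightarrow> real" where \<phi>: "continuous_on UNIV \<phi>" "\<And>y. \<phi> y \<in> {0..1}"
    "(\<integral>y. \<bar>indicator C y - \<phi> y\<bar> \<partial>distr q borel T) < e/2"
    using continuous_approx_closed[OF d.prob_space_axioms _ C, of "e/2"] e by auto
  have [measurable]: "\<phi> \<in> borel_measurable borel" by (rule borel_measurable_continuous_onI[OF \<phi>(1)])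
  have i1: "(\<integral>\<theta>. \<bar>indicator D \<theta> - \<phi> (T \<theta>)\<bar> \<partial>q) < e/2"
    using \<phi>(3) by (subst (asm) integral_distr) (auto simp: D_def indicator_def)
  have i2: "(\<integral>\<theta>. \<bar>indicator A \<theta> - indicator D \<theta> :: real\<bar> \<partial>q) < e/2"
  proof -
    have "(\<integral>\<theta>. \<bar>indicator A \<theta> - indicator D \<theta> :: real\<bar> \<partial>q) = (\<integral>\<theta>. indicator (A - D) \<theta> \<partial>q)"
      using DA by (intro Bochner_Integration.integral_cong) (auto simp: indicator_def)
    also have "\<dots> = measure q A - measure q D" using DA by (simp add: q.finite_measure_Diff sq spq)
    finally show ?thesis using mAD by simp
  qed
  have ab: "\<bar>indicator X \<theta> - \<phi> (T \<theta>)\<bar> \<le> 1" for X \<theta>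
    using \<phi>(2)[of "T \<theta>"] by (auto simp: indicator_def)
  have b1: "integrable q (\<lambda>\<theta>. \<bar>indicator D \<theta> - \<phi> (T \<theta>)\<bar>)"
    by (rule q.integrable_const_bound[where B = 1]) (use ab in auto)
  have b2: "integrable q (\<lambda>\<theta>. \<bar>indicator A \<theta> - indicator D \<theta> :: real\<bar>)"
    by (rule q.integrable_const_bound[where B = 1]) (auto simp: indicator_def)
  have b3: "integrable q (\<lambda>\<theta>. \<bar>indicator A \<theta> - \<phi> (T \<theta>)\<bar>)"
    by (rule q.integrable_const_bound[where B = 1]) (use ab in auto)
  have "(\<integral>\<theta>. \<bar>indicator A \<theta> - \<phi> (T \<theta>)\<bar> \<partial>q) \<le>
      (\<integral>\<theta>. \<bar>indicator D \<theta> - \<phi> (T \<theta>)\<bar> + \<bar>indicator A \<theta> - indicator D \<theta>\<bar> \<partial>q)"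
    by (intro integral_mono b3 Bochner_Integration.integrable_add b1 b2) linarith
  also have "\<dots> < e" using b1 b2 i1 i2 by simp
  finally show ?thesis using \<phi>(1,2) that by blast
qed

text \<open>The measures may have mass below 1, as the posterior kernels do. The hypothesis covers
  this: mass close to 1 on a single neighbourhood already forces the total mass to 1.\<close>

lemma integral_tendsto_point:
  fixes \<mu> :: "nat \<Rightarrow> 't::topological_space measure" and g :: "'t \<Rightarrow> real"
  assumes \<mu>: "\<And>n. \<mu> n \<in> space (subprob_algebra borel)"
    and conv: "\<And>U. open U \<Longrightarrow> \<theta> \<in> U \<Longrightarrow> (\<lambda>n. measure (\<mu> n) U) \<longlonglongrightarrow> 1"
    and g: "continuous_on UNIV g" "bounded (range g)"
  shows "(\<lambda>n. \<integral>x. g x \<partial>\<mu> n) \<longlonglongrightarrow> g \<theta>"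
proof -
  obtain B where B: "\<And>x. \<bar>g x\<bar> \<le> B" using g(2) by (auto simp: bounded_iff)
  have B0: "0 \<le> B" using B[of \<theta>] by linarith
  have s[measurable_cong]: "sets (\<mu> n) = sets borel" and sp: "subprob_space (\<mu> n)" for n
    using \<mu>[of n] by (auto simp: space_subprob_algebra)
  have [measurable]: "g \<in> borel_measurable borel" by (rule borel_measurable_continuous_onI[OF g(1)])
  show ?thesis
  proof (rule LIMSEQ_I)
    fix r :: real assume r: "r > 0"
    define U where "U = {x. \<bar>g x - g \<theta>\<bar> < r / 2}"
    have U: "open U" unfolding U_def
      by (intro open_Collect_less continuous_intros continuous_on_subset[OF g(1)]) auto
    have [measurable]: "U \<in> sets borel" using U by simp
    \<comment> \<open>Of the factor \<open>3 * B\<close>, the part \<open>2 * B\<close> bounds the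
      oscillation of \<open>g\<close> on the complement of \<open>U\<close>, and one more
      \<open>B\<close> pays for the mass missing from a sub-probability measure.\<close>
    have "(\<lambda>n. r/2 + 3 * B * (1 - measure (\<mu> n) U)) \<longlonglongrightarrow> r/2 + 3 * B * (1 - 1)"
      using r by (intro tendsto_intros conv[OF U]) (simp add: U_def)
    then have small: "eventually (\<lambda>n. r/2 + 3 * B * (1 - measure (\<mu> n) U) < r) sequentially"
      by (rule order_tendstoD(2)) (use r in simp)
    have nb: "norm ((\<integral>x. g x \<partial>\<mu> n) - g \<theta>) \<le> r/2 + 3 * B * (1 - measure (\<mu> n) U)" for n
    proof -
      interpret subprob_space "\<mu> n" by (rule sp)
      have sU: "space (\<mu> n) = UNIV" using sets_eq_imp_space_eq[OF s[of n]] by simp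
      have gi: "integrable (\<mu> n) g" using B by (intro integrable_const_bound[where B = B]) auto
      have ii: "integrable (\<mu> n) (\<lambda>x. c * indicator X x)" if [measurable]: "X \<in> sets borel" for X and c :: real
        by (rule integrable_const_bound[where B = "\<bar>c\<bar>"]) (auto simp: indicator_def)
      have i1: "integrable (\<mu> n) (\<lambda>x. r/2 * indicator U x)" by (rule ii) measurable
      have i2: "integrable (\<mu> n) (\<lambda>x. 2 * B * indicator (- U) x)" by (rule ii) measurable
      have mU: "measure (\<mu> n) (- U) = measure (\<mu> n) UNIV - measure (\<mu> n) U"
        using finite_measure_compl[of U] by (simp add: sU s Compl_eq_Diff_UNIV)
      have m1: "measure (\<mu> n) UNIV \<le> 1" "measure (\<mu> n) U \<le> 1" "measure (\<mu> n) U \<le> measure (\<mu> n) UNIV"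
        by (auto intro!: subprob_measure_le_1 finite_measure_mono simp: s)
      have "\<bar>(\<integral>x. g x \<partial>\<mu> n) - g \<theta> * measure (\<mu> n) UNIV\<bar> = \<bar>\<integral>x. g x - g \<theta> \<partial>\<mu> n\<bar>"
        using gi by (simp add: sU mult.commute)
      also have "\<dots> \<le> (\<integral>x. \<bar>g x - g \<theta>\<bar> \<partial>\<mu> n)" by (rule integral_abs_bound)
      also have "\<dots> \<le> (\<integral>x. r/2 * indicator U x + 2 * B * indicator (- U) x \<partial>\<mu> n)"
      proof (rule integral_mono)
        fix x
        have "\<bar>g x - g \<theta>\<bar> \<le> 2 * B" using B[of x] B[of \<theta>] by linarith
        then show "\<bar>g x - g \<theta>\<bar> \<le> r/2 * indicator U x + 2 * B * indicator (- U) x"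
          by (auto simp: indicator_def U_def)
      next
        show "integrable (\<mu> n) (\<lambda>x. r/2 * indicator U x + 2 * B * indicator (- U) x)"
          by (rule Bochner_Integration.integrable_add[OF i1 i2])
      qed (use gi in auto)
      also have "\<dots> = r/2 * measure (\<mu> n) U + 2 * B * measure (\<mu> n) (- U)"
        by (subst Bochner_Integration.integral_add[OF i1 i2]) (simp add: sU)
      also have "\<dots> \<le> r/2 + 2 * B * (1 - measure (\<mu> n) U)"
        unfolding mU using m1 r B0 by (intro add_mono mult_left_mono) (auto simp: mult_left_le)
      finally have 1: "\<bar>(\<integral>x. g x \<partial>\<mu> n) - g \<theta> * measure (\<mu> n) UNIV\<bar> \<le> r/2 + 2 * B * (1 - measure (\<mu> n) U)" .
      have "g \<theta> * measure (\<mu> n) UNIV - g \<theta> = - (g \<theta> * (1 - measure (\<mu> n) UNIV))" by (simp add: algebra_simps)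
      then have "\<bar>g \<theta> * measure (\<mu> n) UNIV - g \<theta>\<bar> = \<bar>g \<theta>\<bar> * (1 - measure (\<mu> n) UNIV)"
        using m1(1) by (simp only: abs_minus_cancel abs_mult)
      also have "\<dots> \<le> B * (1 - measure (\<mu> n) U)" using B[of \<theta>] m1 by (intro mult_mono) auto
      finally have 2: "\<bar>g \<theta> * measure (\<mu> n) UNIV - g \<theta>\<bar> \<le> B * (1 - measure (\<mu> n) U)" .
      have "3 * B * (1 - measure (\<mu> n) U) = 2 * B * (1 - measure (\<mu> n) U) + B * (1 - measure (\<mu> n) U)"
        by (simp add: algebra_simps)
      then show ?thesis using 1 2 unfolding real_norm_def by linarith
    qed
    from small have ev: "eventually (\<lambda>n. norm ((\<integral>x. g x \<partial>\<mu> n) - g \<theta>) < r) sequentially"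
      by (rule eventually_mono) (rule le_less_trans[OF nb])
    then show "\<exists>no. \<forall>n\<ge>no. norm ((\<integral>x. g x \<partial>\<mu> n) - g \<theta>) < r" unfolding eventually_sequentially .
  qed
qed

section \<open>The filtration of the observations and the joint law\<close>

lemma measurable_first_obs_joint: "(\<lambda>z. first_obs n (snd z)) \<in> borel \<Otimes>\<^sub>M Pi\<^sub>M UNIV (\<lambda>_. borel) \<rightarrow>\<^sub>M sample_space n"
  by (rule measurable_compose[OF measurable_snd measurable_restrict_subset]) simp

lemma measurable_first_obs_algebra: "(\<lambda>z. first_obs n (snd z)) \<in> obs_algebra n \<rightarrow>\<^sub>M sample_space n"
  unfolding obs_algebra_def split_beta' by (rule measurable_vimage_algebra1) (auto simp: space_PiM)

lemma sets_obs_algebra: "sets (obs_algebra n) = {(\<lambda>z. first_obs n (snd z)) -` B |B. B \<in> sets (sample_space n)}"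
  unfolding obs_algebra_def split_beta' by (auto simp: sets_vimage_algebra2 space_PiM)

lemma sets_obs_algebra_mono:
  assumes "m \<le> n"
  shows "sets (obs_algebra m :: ('t \<times> (nat \<Rightarrow> 'x::topological_space)) measure) \<subseteq> sets (obs_algebra n)"
proof
  fix X :: "('t \<times> (nat \<Rightarrow> 'x)) set" assume "X \<in> sets (obs_algebra m)"
  then obtain B where B: "B \<in> sets (sample_space m)" and X: "X = (\<lambda>z. first_obs m (snd z)) -` B"
    by (auto simp: sets_obs_algebra)
  have mn: "{..<n} \<inter> {..<m} = {..<m}" using assms by auto
  have r: "(\<lambda>x. restrict x {..<m}) \<in> sample_space n \<rightarrow>\<^sub>M sample_space m"
    using assms by (intro measurable_restrict_subset) auto
  have "X = (\<lambda>z. first_obs n (snd z)) -` ((\<lambda>x. restrict x {..<m}) -` B \<inter> space (sample_space n))"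
    unfolding X by (auto simp: space_PiM restrict_restrict mn)
  then show "X \<in> sets (obs_algebra n)" using measurable_sets[OF r B] unfolding sets_obs_algebra by blast
qed

context
  fixes P :: "'t::polish_space \<Rightarrow> 'x::polish_space measure"
  assumes P: "P \<in> borel \<rightarrow>\<^sub>M weak_borel"
begin

lemma prob_space_iid_law: "prob_space (iid_law P \<theta>)"
  and sets_iid_law: "sets (iid_law P \<theta>) = sets (Pi\<^sub>M UNIV (\<lambda>_. borel))"
  using measurable_space[OF iid_law_measurable[OF P], of \<theta>] by (auto simp: space_prob_algebra)

lemma measurable_measure_model: "B \<in> sets borel \<Longrightarrow> (\<lambda>\<theta>. measure (P \<theta>) B) \<in> borel_measurable borel"
  by (rule measurable_compose[OF P_prob_algebra[OF P] measurable_measure_prob_algebra])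

context
  fixes q :: "'t measure"
  assumes q: "q \<in> space (prob_algebra borel)"
begin

lemma prob_space_joint_law: "prob_space (joint_law P q)"
  and sets_joint_law: "sets (joint_law P q) = sets (borel \<Otimes>\<^sub>M Pi\<^sub>M UNIV (\<lambda>_. borel))"
  using joint_law_prob_algebra[OF P q] by (auto simp: space_prob_algebra)

lemma space_joint_law: "space (joint_law P q) = UNIV"
  using sets_eq_imp_space_eq[OF sets_joint_law] by (simp add: space_pair_measure space_PiM)

text \<open>The exceptional set lies in a measurable null set, and by the iterated integral almost
  every section of that set is null.\<close>

lemma AE_joint_lawD:
  assumes "AE z in joint_law P q. \<phi> z"
  shows "AE \<theta> in q. AE \<omega> in iid_law P \<theta>. \<phi> (\<theta>, \<omega>)"
proof -
  obtain N where N: "{z \<in> space (joint_law P q). \<not> \<phi> z} \<subseteq> N" "N \<in> sets (joint_law P q)" "emeasure (joint_law P q) N = 0"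
    using assms by (auto elim!: AE_E)
  have qs[measurable_cong]: "sets q = sets borel" using q by (auto simp: space_prob_algebra)
  have Nm[measurable]: "N \<in> sets (borel \<Otimes>\<^sub>M Pi\<^sub>M UNIV (\<lambda>_. borel))" using N(2) by (simp add: sets_joint_law)
  have "(\<integral>\<^sup>+\<theta>. (\<integral>\<^sup>+\<omega>. indicator N (\<theta>, \<omega>) \<partial>iid_law P \<theta>) \<partial>q) = (\<integral>\<^sup>+z. indicator N z \<partial>joint_law P q)"
    by (rule nn_integral_joint_law[OF P q, symmetric]) measurable
  also have "\<dots> = 0" using N by simp
  finally have "AE \<theta> in q. (\<integral>\<^sup>+\<omega>. indicator N (\<theta>, \<omega>) \<partial>iid_law P \<theta>) = 0"
  proof (subst (asm) nn_integral_0_iff_AE)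
    note [measurable] = measurable_prob_algebraD[OF iid_law_measurable[OF P]]
    have "(\<lambda>(\<theta>, \<omega>). indicator N (\<theta>, \<omega>) :: ennreal) \<in> borel_measurable (borel \<Otimes>\<^sub>M Pi\<^sub>M UNIV (\<lambda>_. borel))" by simp
    then show "(\<lambda>\<theta>. \<integral>\<^sup>+\<omega>. indicator N (\<theta>, \<omega>) \<partial>iid_law P \<theta>) \<in> borel_measurable q"
      unfolding measurable_cong_sets[OF qs refl]
      by (rule nn_integral_measurable_subprob_algebra2) measurable
  qed
  then show ?thesis
  proof eventually_elim
    case (elim \<theta>)
    have "(\<lambda>\<omega>. indicator N (\<theta>, \<omega>) :: ennreal) \<in> borel_measurable (iid_law P \<theta>)"
      unfolding measurable_cong_sets[OF sets_iid_law refl] by measurable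
    from elim[unfolded nn_integral_0_iff_AE[OF this]] show ?case
    proof eventually_elim
      case (elim \<omega>)
      then show ?case using N(1) by (auto simp: space_joint_law indicator_eq_0_iff)
    qed
  qed
qed

text \<open>The passage from sections to the joint law goes through the iterated integral of the
  exceptional set, so joint measurability enters as the hypothesis \<open>m\<close>; every use has
  to verify it.\<close>

lemma AE_joint_lawI:
  assumes m: "{z. \<phi> z} \<in> sets (borel \<Otimes>\<^sub>M Pi\<^sub>M UNIV (\<lambda>_. borel))"
    and ae: "\<And>\<theta>. AE \<omega> in iid_law P \<theta>. \<phi> (\<theta>, \<omega>)"
  shows "AE z in joint_law P q. \<phi> z"
proof (rule AE_I[of _ _ "- {z. \<phi> z}"])
  have m'[measurable]: "- {z. \<phi> z} \<in> sets (borel \<Otimes>\<^sub>M Pi\<^sub>M UNIV (\<lambda>_. borel))"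
    using sets.compl_sets[OF m] by (simp add: Compl_eq_Diff_UNIV space_pair_measure space_PiM)
  show "- {z. \<phi> z} \<in> sets (joint_law P q)" by (simp only: sets_joint_law m')
  have "emeasure (joint_law P q) (- {z. \<phi> z}) = (\<integral>\<^sup>+z. indicator (- {z. \<phi> z}) z \<partial>joint_law P q)"
    using m' by (simp add: sets_joint_law)
  also have "\<dots> = (\<integral>\<^sup>+\<theta>. (\<integral>\<^sup>+\<omega>. indicator (- {z. \<phi> z}) (\<theta>, \<omega>) \<partial>iid_law P \<theta>) \<partial>q)"
    by (rule nn_integral_joint_law[OF P q]) measurable
  also have "\<dots> = (\<integral>\<^sup>+\<theta>. 0 \<partial>q)"
  proof (rule nn_integral_cong)
    fix \<theta>
    have "(\<integral>\<^sup>+\<omega>. indicator (- {z. \<phi> z}) (\<theta>, \<omega>) \<partial>iid_law P \<theta>) = (\<integral>\<^sup>+\<omega>. 0 \<partial>iid_law P \<theta>)"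
      using ae[of \<theta>] by (intro nn_integral_cong_AE) auto
    then show "(\<integral>\<^sup>+\<omega>. indicator (- {z. \<phi> z}) (\<theta>, \<omega>) \<partial>iid_law P \<theta>) = 0" by simp
  qed
  finally show "emeasure (joint_law P q) (- {z. \<phi> z}) = 0" by simp
qed auto

lemma subalgebra_obs_algebra: "subalgebra (joint_law P q) (obs_algebra n)"
  unfolding subalgebra_def
proof
  show "space (obs_algebra n) = space (joint_law P q)" by (simp add: obs_algebra_def space_joint_law)
  show "sets (obs_algebra n) \<subseteq> sets (joint_law P q)"
    using measurable_sets[OF measurable_first_obs_joint]
    by (auto simp: sets_obs_algebra sets_joint_law space_pair_measure space_PiM)
qed

text \<open>Along the sample sizes \<open>(Suc k)\<^sup>2\<close> the mean squared errors are
  summable, so the sum of the squared errors is almost surely finite and its terms tend to 0. A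
  subsequence is enough, because the frequencies serve only to recover the parameter. Working with
  integrals under the joint law gives the joint null set directly.\<close>

lemma AE_empirical_frequency:
  assumes B[measurable]: "B \<in> sets borel"
  shows "AE z in joint_law P q. (\<lambda>k. (\<Sum>i<(Suc k)\<^sup>2. indicator B (snd z i)) / real ((Suc k)\<^sup>2)) \<longlonglongrightarrow> measure (P (fst z)) B"
proof -
  note [measurable] = measurable_measure_model[OF B]
  define d where "d k z = ((\<Sum>i<(Suc k)\<^sup>2. indicator B (snd z i)) / real ((Suc k)\<^sup>2) - measure (P (fst z)) B)\<^sup>2" for k and z :: "'t \<times> (nat \<Rightarrow> 'x)"
  have dm[measurable]: "d k \<in> borel_measurable (borel \<Otimes>\<^sub>M Pi\<^sub>M UNIV (\<lambda>_. borel))" for k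
    unfolding d_def by measurable
  note [measurable_cong] = sets_joint_law
  have dint: "(\<integral>\<^sup>+z. ennreal (d k z) \<partial>joint_law P q) \<le> ennreal (1 / real ((Suc k)\<^sup>2))" for k
  proof -
    have "(\<integral>\<^sup>+\<omega>. ennreal (d k (\<theta>, \<omega>)) \<partial>iid_law P \<theta>) \<le> ennreal (1 / real ((Suc k)\<^sup>2))" for \<theta>
    proof -
      interpret S: sequence_space "P \<theta>" by (rule sequence_space_prob[OF P_prob[OF P]])
      have sp: "space (P \<theta>) = UNIV" using sets_eq_imp_space_eq[OF P_sets[OF P, of \<theta>]] by simp
      have E: "(\<integral>x. indicator B x \<partial>P \<theta>) = measure (P \<theta>) B" by (simp add: sp)
      have "(indicator B :: 'x \<Rightarrow> real) \<in> borel_measurable (P \<theta>)"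
        by (rule borel_measurable_indicator) (simp add: P_sets[OF P] B)
      from S.L2_law_of_large_numbers[OF this, of "(Suc k)\<^sup>2"] show ?thesis
        unfolding d_def iid_law_def E fst_conv snd_conv by (simp add: indicator_def)
    qed
    then have "(\<integral>\<^sup>+\<theta>. (\<integral>\<^sup>+\<omega>. ennreal (d k (\<theta>, \<omega>)) \<partial>iid_law P \<theta>) \<partial>q) \<le> (\<integral>\<^sup>+\<theta>. ennreal (1 / real ((Suc k)\<^sup>2)) \<partial>q)"
      by (intro nn_integral_mono)
    also have "\<dots> = ennreal (1 / real ((Suc k)\<^sup>2))"
      using q by (simp add: space_prob_algebra prob_space.emeasure_space_1)
    finally show ?thesis by (subst nn_integral_joint_law[OF P q]) auto
  qed
  have sm: "summable (\<lambda>k. 1 / real ((Suc k)\<^sup>2))"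
    using inverse_power_summable[of 2, where 'a = real] by (subst summable_Suc_iff) (simp add: inverse_eq_divide)
  have "(\<integral>\<^sup>+z. (\<Sum>k. ennreal (d k z)) \<partial>joint_law P q) = (\<Sum>k. \<integral>\<^sup>+z. ennreal (d k z) \<partial>joint_law P q)"
    by (rule nn_integral_suminf) measurable
  also have "\<dots> \<le> (\<Sum>k. ennreal (1 / real ((Suc k)\<^sup>2)))" by (intro suminf_le dint) auto
  also have "\<dots> < \<infinity>" using sm by (simp add: suminf_ennreal2 less_top del: of_nat_Suc)
  finally have "AE z in joint_law P q. (\<Sum>k. ennreal (d k z)) \<noteq> \<infinity>"
    by (intro nn_integral_PInf_AE) auto
  then show ?thesis
  proof eventually_elim
    case (elim z)
    have "summable (\<lambda>k. d k z)" by (rule summable_suminf_not_top) (use elim in \<open>auto simp: d_def\<close>)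
    then have "(\<lambda>k. sqrt (d k z)) \<longlonglongrightarrow> sqrt 0" by (intro tendsto_real_sqrt summable_LIMSEQ_zero)
    then have "(\<lambda>k. \<bar>(\<Sum>i<(Suc k)\<^sup>2. indicator B (snd z i)) / real ((Suc k)\<^sup>2) - measure (P (fst z)) B\<bar>) \<longlonglongrightarrow> 0"
      unfolding d_def by simp
    then show ?case by (rule LIM_zero_cancel[OF tendsto_rabs_zero_cancel])
  qed
qed

end
end

context
  fixes P :: "'t::polish_space \<Rightarrow> 'x::polish_space measure"
  assumes P: "P \<in> borel \<rightarrow>\<^sub>M weak_borel"
begin

context
  fixes q :: "'t measure"
  assumes q: "q \<in> space (prob_algebra borel)"
begin

text \<open>This supplies the mean approximation that the martingale theorem asks for. The indicator
  of \<open>A\<close> is close in mean to a continuous function of the probabilities of countably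
  many separating sets, and continuity allows those probabilities to be replaced by empirical
  frequencies from a finite sample.\<close>

lemma parameter_approx_by_observations:
  assumes inj: "inj P" and A: "A \<in> sets borel" and e: "(e::real) > 0"
  shows "\<exists>m g. g \<in> borel_measurable (obs_algebra m) \<and> integrable (joint_law P q) g \<and>
    (\<integral>z. \<bar>indicator (A \<times> UNIV) z - g z\<bar> \<partial>joint_law P q) < e"
proof -
  note Js[measurable_cong] = sets_joint_law[OF P q]
  interpret J: prob_space "joint_law P q" by (rule prob_space_joint_law[OF P q])
  have qp: "prob_space q" and qs[measurable_cong]: "sets q = sets borel" using q by (auto simp: space_prob_algebra)
  obtain B :: "nat \<Rightarrow> 'x set" where B[measurable]: "\<And>j. B j \<in> sets borel"
    and sep: "\<And>M N. M \<in> space (prob_algebra borel) \<Longrightarrow> N \<in> space (prob_algebra borel) \<Longrightarrow>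
      (\<And>j. measure M (B j) = measure N (B j)) \<Longrightarrow> M = N"
    using countable_separating_sets by metis
  \<comment> \<open>Encoding \<open>P \<theta>\<close> by a real sequence replaces the space of
    measures by the Polish space \<open>nat \<Rightarrow> real\<close> and keeps injectivity. It
    also turns convergence of all frequencies into convergence of points, since the topology is
    coordinatewise.\<close>
  define T where "T \<theta> = (\<lambda>j. measure (P \<theta>) (B j))" for \<theta>
  have Tm[measurable]: "T \<in> borel_measurable borel"
    unfolding T_def by (intro measurable_coordinatewise_then_product measurable_measure_model[OF P] B)
  have Tinj: "inj T"
  proof (rule injI)
    fix \<theta> \<theta>' assume "T \<theta> = T \<theta>'"
    then have "P \<theta> = P \<theta>'"
      using measurable_space[OF P_prob_algebra[OF P]] by (intro sep) (auto simp: T_def fun_eq_iff)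
    then show "\<theta> = \<theta>'" using inj by (auto dest: injD)
  qed
  obtain \<phi> :: "(nat \<Rightarrow> real) \<Rightarrow> real" where \<phi>c: "continuous_on UNIV \<phi>" and \<phi>01: "\<And>y. \<phi> y \<in> {0..1}"
    and \<phi>A: "(\<integral>\<theta>. \<bar>indicator A \<theta> - \<phi> (T \<theta>)\<bar> \<partial>q) < e / 2"
    using injective_borel_approx[OF qp qs Tm Tinj A, of "e / 2"] e by auto
  have \<phi>m[measurable]: "\<phi> \<in> borel_measurable borel" by (rule borel_measurable_continuous_onI[OF \<phi>c])
  define S where "S k \<omega> = (\<lambda>j. (\<Sum>i<(Suc k)\<^sup>2. indicator (B j) (\<omega> i)) / real ((Suc k)\<^sup>2))" for k and \<omega> :: "nat \<Rightarrow> 'x"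
  \<comment> \<open>All frequencies in \<open>S k\<close> use the same first
    \<open>(Suc k)\<^sup>2\<close> observations, although there are infinitely many of them; hence
    \<open>g k\<close> belongs to a finite stage of the filtration.\<close>
  have S_first: "S k \<omega> = S k (first_obs ((Suc k)\<^sup>2) \<omega>)" for k \<omega> unfolding S_def by simp
  have Sm: "S k \<in> borel_measurable (sample_space ((Suc k)\<^sup>2))" for k
    unfolding S_def by (intro measurable_coordinatewise_then_product) measurable
  define g where "g k z = \<phi> (S k (snd z))" for k and z :: "'t \<times> (nat \<Rightarrow> 'x)"
  have gF: "g k \<in> borel_measurable (obs_algebra ((Suc k)\<^sup>2))" for k
    unfolding g_def by (subst S_first) (intro measurable_compose[OF _ \<phi>m] measurable_compose[OF measurable_first_obs_algebra Sm])
  have gJ[measurable]: "g k \<in> borel_measurable (joint_law P q)" for k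
    by (rule measurable_from_subalg[OF subalgebra_obs_algebra[OF P q] gF])
  have \<phi>b: "\<bar>\<phi> y\<bar> \<le> 1" for y using \<phi>01[of y] by auto
  have gi: "integrable (joint_law P q) (g k)" for k
    by (rule J.integrable_const_bound[where B = 1]) (auto simp: g_def \<phi>b)
  have d1: "\<bar>\<phi> y - \<phi> y'\<bar> \<le> 1" for y y' using \<phi>01[of y] \<phi>01[of y'] by auto
  have "AE z in joint_law P q. \<forall>j. (\<lambda>k. S k (snd z) j) \<longlonglongrightarrow> T (fst z) j"
    unfolding AE_all_countable S_def T_def using AE_empirical_frequency[OF P q B] by blast
  then have lim: "AE z in joint_law P q. (\<lambda>k. \<bar>\<phi> (T (fst z)) - g k z\<bar>) \<longlonglongrightarrow> 0"
  proof eventually_elim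
    case (elim z)
    then have "(\<lambda>k. S k (snd z)) \<longlonglongrightarrow> T (fst z)" by (simp add: tendsto_fun_iff)
    then have "(\<lambda>k. g k z) \<longlonglongrightarrow> \<phi> (T (fst z))"
      unfolding g_def using continuous_on_tendsto_compose[OF \<phi>c] by auto
    then have "(\<lambda>k. \<bar>\<phi> (T (fst z)) - g k z\<bar>) \<longlonglongrightarrow> \<bar>\<phi> (T (fst z)) - \<phi> (T (fst z))\<bar>"
      by (intro tendsto_intros)
    then show ?case by simp
  qed
  have dg: "\<bar>\<phi> (T (fst z)) - g k z\<bar> \<le> 1" for k z by (simp add: g_def d1)
  have "(\<lambda>k. \<integral>z. \<bar>\<phi> (T (fst z)) - g k z\<bar> \<partial>joint_law P q) \<longlonglongrightarrow> (\<integral>z. 0 \<partial>joint_law P q)"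
    by (rule integral_dominated_convergence[where w = "\<lambda>_. 1"]) (use lim in \<open>auto simp: dg\<close>)
  then have "(\<lambda>k. \<integral>z. \<bar>\<phi> (T (fst z)) - g k z\<bar> \<partial>joint_law P q) \<longlonglongrightarrow> 0" by simp
  from order_tendstoD(2)[OF this, of "e/2"] e obtain k
    where k: "(\<integral>z. \<bar>\<phi> (T (fst z)) - g k z\<bar> \<partial>joint_law P q) < e/2" by (auto simp: eventually_sequentially)
  \<comment> \<open>The error splits in two: \<open>h\<close> depends on the parameter alone and
    integrates as under \<open>q\<close>, the first marginal of the joint law; the other half
    compares frequencies with probabilities. Each is below \<open>e / 2\<close>.\<close>
  define h where "h \<theta> = \<bar>indicator A \<theta> - \<phi> (T \<theta>)\<bar>" for \<theta>
  have hm[measurable]: "h \<in> borel_measurable borel" unfolding h_def using A by measurable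
  have h1: "\<bar>h \<theta>\<bar> \<le> 1" for \<theta> using \<phi>01[of "T \<theta>"] by (auto simp: h_def indicator_def)
  have hi: "integrable (joint_law P q) (\<lambda>z. h (fst z))" by (rule J.integrable_const_bound[where B = 1]) (auto simp: h1)
  have h0: "0 \<le> h \<theta>" for \<theta> by (simp add: h_def)
  have hJ: "(\<integral>z. h (fst z) \<partial>joint_law P q) = (\<integral>\<theta>. h \<theta> \<partial>q)"
  proof -
    have "(\<integral>\<^sup>+z. ennreal (h (fst z)) \<partial>joint_law P q) = (\<integral>\<^sup>+\<theta>. ennreal (h \<theta>) \<partial>q)"
      using prob_space.emeasure_space_1[OF prob_space_iid_law[OF P]]
      by (subst nn_integral_joint_law[OF P q]) simp_all
    then show ?thesis by (subst (1 2) integral_eq_nn_integral) (auto simp: h0)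
  qed
  have i2: "integrable (joint_law P q) (\<lambda>z. \<bar>\<phi> (T (fst z)) - g k z\<bar>)"
    by (rule J.integrable_const_bound[where B = 1]) (auto simp: dg)
  have AU[measurable]: "A \<times> UNIV \<in> sets (joint_law P q)"
    unfolding Js using A sets.top[of "Pi\<^sub>M UNIV (\<lambda>_::nat. borel :: 'x measure)"] by (intro pair_measureI) (simp_all add: space_PiM)
  have i0: "integrable (joint_law P q) (\<lambda>z. \<bar>indicator (A \<times> UNIV) z - g k z\<bar>)"
    by (intro integrable_abs Bochner_Integration.integrable_diff gi J.integrable_const_bound[where B = 1 and f = "indicator (A \<times> UNIV)"])
       (use AU in \<open>auto simp: indicator_def\<close>)
  have "(\<integral>z. \<bar>indicator (A \<times> UNIV) z - g k z\<bar> \<partial>joint_law P q)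
      \<le> (\<integral>z. h (fst z) + \<bar>\<phi> (T (fst z)) - g k z\<bar> \<partial>joint_law P q)"
    by (intro integral_mono i0 Bochner_Integration.integrable_add hi i2) (auto simp: h_def indicator_def)
  also have "\<dots> = (\<integral>\<theta>. h \<theta> \<partial>q) + (\<integral>z. \<bar>\<phi> (T (fst z)) - g k z\<bar> \<partial>joint_law P q)"
    unfolding hJ[symmetric] by (rule Bochner_Integration.integral_add[OF hi i2])
  also have "\<dots> < e" using k \<phi>A unfolding h_def by linarith
  finally show ?thesis using gF gi by blast
qed

text \<open>Martingale convergence for one set, and the version property of the posterior, hold
  outside a null set depending on that set. A countable base yields one null set for all open
  \<open>U\<close>: some base set around the parameter lies inside \<open>U\<close>, and the kernels
  have mass at most 1.\<close>

lemma doob_consistency: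
  assumes inj: "inj P" and Q: "\<And>n. posterior_version P q n (Q n)"
  shows "AE z in joint_law P q. \<forall>U. open U \<longrightarrow> fst z \<in> U \<longrightarrow>
    (\<lambda>n. measure (Q n (first_obs n (snd z))) U) \<longlonglongrightarrow> 1"
proof -
  interpret J: prob_space "joint_law P q" by (rule prob_space_joint_law[OF P q])
  have ind: "AE z in joint_law P q. (\<lambda>n. measure (Q n (first_obs n (snd z))) A) \<longlonglongrightarrow> indicator A (fst z)"
    if A: "A \<in> sets borel" for A
  proof -
    have AU: "A \<times> UNIV \<in> sets (joint_law P q)"
      unfolding sets_joint_law[OF P q] using A sets.top[of "Pi\<^sub>M UNIV (\<lambda>_::nat. borel :: 'x measure)"]
      by (intro pair_measureI) (simp_all add: space_PiM)
    have "integrable (joint_law P q) (indicator (A \<times> UNIV) :: _ \<Rightarrow> real)"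
      using AU by (intro J.integrable_const_bound[where B = 1]) (auto simp: indicator_def)
    from J.real_cond_exp_tendsto[OF subalgebra_obs_algebra[OF P q] sets_obs_algebra_mono this
        parameter_approx_by_observations[OF inj A]]
    have "AE z in joint_law P q. (\<lambda>n. real_cond_exp (joint_law P q) (obs_algebra n) (indicator (A \<times> UNIV)) z)
        \<longlonglongrightarrow> indicator (A \<times> UNIV) z" by blast
    moreover have "AE z in joint_law P q. \<forall>n. measure (Q n (first_obs n (snd z))) A =
        real_cond_exp (joint_law P q) (obs_algebra n) (indicator (A \<times> UNIV)) z"
      unfolding AE_all_countable using Q A by (auto simp: posterior_version_def)
    ultimately show ?thesis
    proof eventually_elim
      case (elim z)
      then show ?case by (cases z) (simp add: indicator_def)
    qed
  qed
  obtain \<B> :: "'t set set" where \<B>: "countable \<B>" "topological_basis \<B>" using ex_countable_basis by auto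
  have op: "open b" if "b \<in> \<B>" for b using that \<B>(2) by (rule topological_basis_open[rotated])
  have "AE z in joint_law P q. \<forall>b\<in>\<B>. (\<lambda>n. measure (Q n (first_obs n (snd z))) b) \<longlonglongrightarrow> indicator b (fst z)"
    using \<B>(1) op by (subst AE_ball_countable) (auto intro!: ind)
  then show ?thesis
  proof eventually_elim
    case (elim z)
    show ?case
    proof (intro allI impI)
      fix U assume U: "open U" "fst z \<in> U"
      obtain b where b: "b \<in> \<B>" "fst z \<in> b" "b \<subseteq> U" using topological_basisE[OF \<B>(2) U] by auto
      have lo: "(\<lambda>n. measure (Q n (first_obs n (snd z))) b) \<longlonglongrightarrow> 1" using elim b by force
      have K: "Q n (first_obs n (snd z)) \<in> space (subprob_algebra borel)" for n
      proof -
        have "Q n \<in> sample_space n \<rightarrow>\<^sub>M subprob_algebra borel" using Q[of n] unfolding posterior_version_def by simp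
        then show ?thesis by (rule measurable_space) (simp add: space_PiM)
      qed
      show "(\<lambda>n. measure (Q n (first_obs n (snd z))) U) \<longlonglongrightarrow> 1"
      proof (rule tendsto_sandwich[OF always_eventually always_eventually lo tendsto_const], safe)
        fix n
        interpret subprob_space "Q n (first_obs n (snd z))" using K[of n] by (simp add: space_subprob_algebra)
        show "measure (Q n (first_obs n (snd z))) b \<le> measure (Q n (first_obs n (snd z))) U"
          using K[of n] U b by (intro finite_measure_mono) (auto simp: space_subprob_algebra)
        show "measure (Q n (first_obs n (snd z))) U \<le> 1" by (rule subprob_measure_le_1)
      qed
    qed
  qed
qed

end

lemma return_in_prob_algebra: "return borel \<theta> \<in> space (prob_algebra borel)"
  by (simp add: space_prob_algebra prob_space_return)

text \<open>A null set of the point mass cannot contain \<theta>, so what holds for almost every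
  parameter holds at \<theta> itself. This is how statements for all priors become statements for
  all parameters.\<close>

lemma AE_joint_law_return:
  assumes "AE z in joint_law P (return borel \<theta>). \<phi> z"
  shows "AE \<omega> in iid_law P \<theta>. \<phi> (\<theta>, \<omega>)"
proof -
  have "AE \<theta>' in return borel \<theta>. AE \<omega> in iid_law P \<theta>'. \<phi> (\<theta>', \<omega>)"
    by (rule AE_joint_lawD[OF P return_in_prob_algebra assms])
  then obtain N where N: "{\<theta>'. \<not> (AE \<omega> in iid_law P \<theta>'. \<phi> (\<theta>', \<omega>))} \<subseteq> N" "N \<in> sets borel" "emeasure (return borel \<theta>) N = 0"
    by (auto elim!: AE_E)
  then show ?thesis by (auto simp: indicator_eq_0_iff)
qed

text \<open>Under a point mass prior the indicator of \<open>A \<times> UNIV\<close> is almost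
  surely constant, and conditioning leaves constants unchanged.\<close>

lemma posterior_version_return:
  "posterior_version P (return borel \<theta>) n (\<lambda>_. return borel \<theta>)"
proof -
  let ?J = "joint_law P (return borel \<theta>)"
  note r = return_in_prob_algebra[of \<theta>]
  interpret J: prob_space ?J by (rule prob_space_joint_law[OF P r])
  interpret S: finite_measure_subalgebra ?J "obs_algebra n"
    by unfold_locales (rule subalgebra_obs_algebra[OF P r])
  have "AE z in ?J. measure (return borel \<theta>) A = real_cond_exp ?J (obs_algebra n) (indicator (A \<times> UNIV)) z"
    if A: "A \<in> sets borel" for A
  proof -
    have AU: "A \<times> UNIV \<in> sets ?J"
      unfolding sets_joint_law[OF P r] using A sets.top[of "Pi\<^sub>M UNIV (\<lambda>_::nat. borel :: 'x measure)"]
      by (intro pair_measureI) (simp_all add: space_PiM)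
    have ae: "AE z in ?J. indicator (A \<times> UNIV) z = (indicator A \<theta> :: real)"
    proof (rule AE_I)
      let ?N = "{\<theta>'. (\<theta>' \<in> A) \<noteq> (\<theta> \<in> A)} \<times> (UNIV :: (nat \<Rightarrow> 'x) set)"
      show "{z \<in> space ?J. indicator (A \<times> UNIV) z \<noteq> (indicator A \<theta> :: real)} \<subseteq> ?N"
        by (auto simp: indicator_def split: if_splits)
      have N: "{\<theta>'. (\<theta>' \<in> A) \<noteq> (\<theta> \<in> A)} \<in> sets borel" using A by (cases "\<theta> \<in> A") (auto simp: Compl_eq[symmetric])
      have top: "(UNIV :: (nat \<Rightarrow> 'x) set) \<in> sets (Pi\<^sub>M UNIV (\<lambda>_. borel))"
        using sets.top[of "Pi\<^sub>M UNIV (\<lambda>_::nat. borel :: 'x measure)"] by (simp add: space_PiM)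
      show "?N \<in> sets ?J" unfolding sets_joint_law[OF P r] using N top by (rule pair_measureI)
      have "(\<lambda>\<theta>'. emeasure (iid_law P \<theta>') UNIV * indicator {\<theta>'. (\<theta>' \<in> A) \<noteq> (\<theta> \<in> A)} \<theta>')
         = indicator {\<theta>'. (\<theta>' \<in> A) \<noteq> (\<theta> \<in> A)}"
        using prob_space.emeasure_space_1[OF prob_space_iid_law[OF P]] sets_eq_imp_space_eq[OF sets_iid_law[OF P]]
        by (simp add: space_PiM)
      then show "emeasure ?J ?N = 0"
        using N by (subst emeasure_joint_law[OF P r N top]) simp
    qed
    have "AE z in ?J. real_cond_exp ?J (obs_algebra n) (indicator (A \<times> UNIV)) z = real_cond_exp ?J (obs_algebra n) (\<lambda>_. indicator A \<theta> :: real) z"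
      using AU by (intro S.real_cond_exp_cong ae) auto
    moreover have "AE z in ?J. real_cond_exp ?J (obs_algebra n) (\<lambda>_. indicator A \<theta> :: real) z = indicator A \<theta>"
      by (rule S.real_cond_exp_F_meas) auto
    ultimately show ?thesis by eventually_elim (simp add: measure_return A)
  qed
  then show ?thesis
    unfolding posterior_version_def by (auto simp: subprob_space_return space_subprob_algebra)
qed

end

section \<open>Consistency and merging\<close>

lemma tendsto_zero_squeeze:
  fixes f g :: "nat \<Rightarrow> real"
  assumes "\<And>n. f n \<le> g n" "\<And>n. 0 \<le> f n" "g \<longlonglongrightarrow> 0"
  shows "f \<longlonglongrightarrow> 0"
  by (rule tendsto_sandwich[OF always_eventually always_eventually tendsto_const assms(3)]) (use assms in auto)

lemma merge_weaklyI:
  assumes "\<And>g :: 'a::topological_space \<Rightarrow> real. continuous_on UNIV g \<Longrightarrow> bounded (range g) \<Longrightarrow>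
      \<exists>l. (\<lambda>n. \<integral>x. g x \<partial>p n) \<longlonglongrightarrow> l \<and> (\<lambda>n. \<integral>x. g x \<partial>q n) \<longlonglongrightarrow> l"
  shows "merge_weakly p q"
  unfolding merge_weakly_def
proof (intro allI impI, elim conjE)
  fix g :: "'a \<Rightarrow> real" assume "continuous_on UNIV g" "bounded (range g)"
  with assms obtain l where "(\<lambda>n. \<integral>x. g x \<partial>p n) \<longlonglongrightarrow> l" "(\<lambda>n. \<integral>x. g x \<partial>q n) \<longlonglongrightarrow> l" by blast
  then have "(\<lambda>n. \<bar>(\<integral>x. g x \<partial>p n) - (\<integral>x. g x \<partial>q n)\<bar>) \<longlonglongrightarrow> \<bar>l - l\<bar>" by (intro tendsto_intros)
  then show "(\<lambda>n. \<bar>(\<integral>x. g x \<partial>p n) - (\<integral>x. g x \<partial>q n)\<bar>) \<longlonglongrightarrow> 0" by simp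
qed

lemma continuous_on_integral_weak_topology:
  fixes f :: "'x::topological_space \<Rightarrow> real"
  assumes P: "continuous_map euclidean weak_topology P" and f: "continuous_on UNIV f" "bounded (range f)"
  shows "continuous_on UNIV (\<lambda>\<theta>. \<integral>x. f x \<partial>P \<theta>)"
proof (rule iffD2[OF continuous_on_open_vimage[OF open_UNIV]], intro allI impI)
  fix V :: "real set" assume V: "open V"
  have sp: "P \<theta> \<in> space (prob_algebra borel)" for \<theta> using P by (simp add: continuous_map_def Pi_iff)
  from openin_continuous_map_preimage[OF P openin_weak_topology_integral[OF f V]]
  show "open ((\<lambda>\<theta>. \<integral>x. f x \<partial>P \<theta>) -` V \<inter> UNIV)" using sp by (simp add: vimage_def)
qed

context
  fixes E :: "nat \<Rightarrow> (nat \<Rightarrow> 'x::topological_space) \<Rightarrow> 't::topological_space measure"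
  assumes E: "\<And>n. E n \<in> sample_space n \<rightarrow>\<^sub>M subprob_algebra borel"
begin

lemma kernel_first_obs: "E n (first_obs n \<omega>) \<in> space (subprob_algebra borel)"
  using E[of n] by (rule measurable_space) (simp add: space_PiM)

lemma subprob_kernel_first_obs: "subprob_space (E n (first_obs n \<omega>))"
  and sets_kernel_first_obs: "sets (E n (first_obs n \<omega>)) = sets borel"
  using kernel_first_obs by (auto simp: space_subprob_algebra)

lemma space_kernel_first_obs: "space (E n (first_obs n \<omega>)) = UNIV"
  using sets_eq_imp_space_eq[OF sets_kernel_first_obs] by simp

end

context
  fixes P :: "'t::polish_space \<Rightarrow> 'x::polish_space measure"
    and E :: "nat \<Rightarrow> (nat \<Rightarrow> 'x) \<Rightarrow> 't measure"
  assumes P: "P \<in> borel \<rightarrow>\<^sub>M weak_borel"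
    and E: "\<And>n. E n \<in> sample_space n \<rightarrow>\<^sub>M subprob_algebra borel"
begin

text \<open>For each fixed \<theta> countably many balls around \<theta> suffice, which handles the
  order of quantifiers. Integrating over \<theta> moves the centre of the balls, so the event
  \<open>\<psi>\<close> has to be measurable in the pair before the fibrewise statements can be
  combined.\<close>

lemma consistent_imp_AE_joint_law:
  assumes q: "q \<in> space (prob_algebra borel)"
    and prob: "\<And>\<theta>. AE \<omega> in iid_law P \<theta>. \<forall>\<^sub>F n in sequentially. prob_space (E n (first_obs n \<omega>))"
    and cons: "\<And>\<theta>. weakly_consistent_at P E \<theta>"
  shows "AE z in joint_law P q. \<forall>U. open U \<longrightarrow> fst z \<in> U \<longrightarrow>
    (\<lambda>n. measure (E n (first_obs n (snd z))) U) \<longlonglongrightarrow> 1"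
proof -
  define \<psi> where "\<psi> z \<longleftrightarrow> (\<forall>k. (\<lambda>n. measure (E n (first_obs n (snd z))) (ball (fst z) (1 / real (Suc k)))) \<longlonglongrightarrow> 1)"
    for z :: "'t \<times> (nat \<Rightarrow> 'x)"
  \<comment> \<open>The kernel is evaluated at a set that moves with \<open>z\<close>. The moving
    balls are the sections of a single measurable set, the one where the distance to
    \<open>fst z\<close> is less than \<open>r\<close>.\<close>
  have m[measurable]: "(\<lambda>z. measure (E n (first_obs n (snd z))) (ball (fst z) r))
      \<in> borel_measurable (borel \<Otimes>\<^sub>M Pi\<^sub>M UNIV (\<lambda>_. borel))" for n r
  proof (rule measure_measurable_subprob_algebra2)
    have "{w \<in> space ((borel \<Otimes>\<^sub>M Pi\<^sub>M UNIV (\<lambda>_. borel)) \<Otimes>\<^sub>M borel). dist (fst (fst w)) (snd w) < r}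
      \<in> sets ((borel \<Otimes>\<^sub>M Pi\<^sub>M UNIV (\<lambda>_::nat. borel :: 'x measure)) \<Otimes>\<^sub>M (borel :: 't measure))" by measurable
    also have "{w \<in> space ((borel \<Otimes>\<^sub>M Pi\<^sub>M UNIV (\<lambda>_. borel)) \<Otimes>\<^sub>M borel). dist (fst (fst w)) (snd w) < r} =
      (SIGMA z:space (borel \<Otimes>\<^sub>M Pi\<^sub>M UNIV (\<lambda>_::nat. borel :: 'x measure)). ball (fst z) r)"
      by (auto simp: space_pair_measure)
    finally show "(SIGMA z:space (borel \<Otimes>\<^sub>M Pi\<^sub>M UNIV (\<lambda>_::nat. borel :: 'x measure)). ball (fst z) r)
      \<in> sets ((borel \<Otimes>\<^sub>M Pi\<^sub>M UNIV (\<lambda>_::nat. borel :: 'x measure)) \<Otimes>\<^sub>M (borel :: 't measure))" .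
  qed (rule measurable_compose[OF measurable_first_obs_joint E])
  have "AE z in joint_law P q. \<psi> z"
  proof (rule AE_joint_lawI[OF P q])
    have "{z \<in> space (borel \<Otimes>\<^sub>M Pi\<^sub>M UNIV (\<lambda>_::nat. borel :: 'x measure)). \<psi> z}
        \<in> sets (borel \<Otimes>\<^sub>M Pi\<^sub>M UNIV (\<lambda>_::nat. borel :: 'x measure))"
      unfolding \<psi>_def by measurable
    then show "{z. \<psi> z} \<in> sets (borel \<Otimes>\<^sub>M Pi\<^sub>M UNIV (\<lambda>_::nat. borel :: 'x measure))"
      by (simp add: space_pair_measure space_PiM)
    fix \<theta>
    have "AE \<omega> in iid_law P \<theta>. \<forall>k. (\<lambda>n. measure (E n (first_obs n \<omega>)) (- ball \<theta> (1 / real (Suc k)))) \<longlonglongrightarrow> 0"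
      unfolding AE_all_countable using cons[of \<theta>] by (auto simp: weakly_consistent_at_def interior_open)
    then show "AE \<omega> in iid_law P \<theta>. \<psi> (\<theta>, \<omega>)" using prob[of \<theta>]
    proof eventually_elim
      case (elim \<omega>)
      show ?case unfolding \<psi>_def fst_conv snd_conv
      proof
        fix k
        let ?b = "ball \<theta> (1 / real (Suc k))"
        have "(\<lambda>n. 1 - measure (E n (first_obs n \<omega>)) (- ?b)) \<longlonglongrightarrow> 1 - 0"
          using elim(1) by (intro tendsto_intros) auto
        \<comment> \<open>Consistency bounds the complement of the ball; mass near 1 on the ball
          follows only where the kernel is a genuine probability measure, that is for all large
          n.\<close>
        moreover have "eventually (\<lambda>n. 1 - measure (E n (first_obs n \<omega>)) (- ?b) = measure (E n (first_obs n \<omega>)) ?b) sequentially"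
          using elim(2)
        proof eventually_elim
          case (elim n)
          then interpret prob_space "E n (first_obs n \<omega>)" .
          show ?case
            using prob_compl[of ?b] by (simp add: space_kernel_first_obs[OF E] sets_kernel_first_obs[OF E] Compl_eq_Diff_UNIV)
        qed
        ultimately show "(\<lambda>n. measure (E n (first_obs n \<omega>)) ?b) \<longlonglongrightarrow> 1"
          by (simp add: tendsto_cong)
      qed
    qed
  qed
  then show ?thesis
  proof eventually_elim
    case (elim z)
    show ?case
    proof (intro allI impI)
      fix U assume U: "open U" "fst z \<in> U"
      then obtain e where e: "e > 0" "ball (fst z) e \<subseteq> U" by (auto simp: open_contains_ball)
      obtain k where "1 / real (Suc k) < e" using nat_approx_posE[OF e(1)] by auto
      then have bU: "ball (fst z) (1 / real (Suc k)) \<subseteq> U" using e(2) by force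
      have lo: "(\<lambda>n. measure (E n (first_obs n (snd z))) (ball (fst z) (1 / real (Suc k)))) \<longlonglongrightarrow> 1"
        using elim unfolding \<psi>_def by blast
      show "(\<lambda>n. measure (E n (first_obs n (snd z))) U) \<longlonglongrightarrow> 1"
      proof (rule tendsto_sandwich[OF always_eventually always_eventually lo tendsto_const], safe)
        fix n
        interpret subprob_space "E n (first_obs n (snd z))" by (rule subprob_kernel_first_obs[OF E])
        show "measure (E n (first_obs n (snd z))) (ball (fst z) (1 / real (Suc k))) \<le> measure (E n (first_obs n (snd z))) U"
          using U bU by (intro finite_measure_mono) (auto simp: sets_kernel_first_obs[OF E])
        show "measure (E n (first_obs n (snd z))) U \<le> 1" by (rule subprob_measure_le_1)
      qed
    qed
  qed
qed

text \<open>Both the dominating function and the null set may vary with \<open>W\<close>, since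
  consistency quantifies over neighbourhoods outside the almost sure statement.\<close>

lemma consistentI_integral:
  assumes "\<And>W. W \<in> sets borel \<Longrightarrow> \<theta> \<in> interior W \<Longrightarrow> \<exists>g :: 't \<Rightarrow> real.
     g \<in> borel_measurable borel \<and> bounded (range g) \<and> (\<forall>x. indicator (- W) x \<le> g x) \<and>
     (AE \<omega> in iid_law P \<theta>. (\<lambda>n. \<integral>x. g x \<partial>E n (first_obs n \<omega>)) \<longlonglongrightarrow> 0)"
  shows "weakly_consistent_at P E \<theta>"
  unfolding weakly_consistent_at_def
proof (intro ballI impI)
  fix W :: "'t set" assume W: "W \<in> sets borel" "\<theta> \<in> interior W"
  obtain g :: "'t \<Rightarrow> real" where g: "g \<in> borel_measurable borel" "bounded (range g)"
    and gW: "\<And>x. indicator (- W) x \<le> g x"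
    and ae: "AE \<omega> in iid_law P \<theta>. (\<lambda>n. \<integral>x. g x \<partial>E n (first_obs n \<omega>)) \<longlonglongrightarrow> 0" using assms[OF W] by blast
  obtain B where B: "\<And>x. \<bar>g x\<bar> \<le> B" using g(2) by (auto simp: bounded_iff)
  show "AE \<omega> in iid_law P \<theta>. (\<lambda>n. measure (E n (first_obs n \<omega>)) (- W)) \<longlonglongrightarrow> 0"
    using ae
  proof eventually_elim
    case (elim \<omega>)
    have "measure (E n (first_obs n \<omega>)) (- W) \<le> (\<integral>x. g x \<partial>E n (first_obs n \<omega>))" for n
    proof -
      interpret subprob_space "E n (first_obs n \<omega>)" by (rule subprob_kernel_first_obs[OF E])
      have W': "- W \<in> sets (E n (first_obs n \<omega>))" using W(1) by (simp add: sets_kernel_first_obs[OF E])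
      have "measure (E n (first_obs n \<omega>)) (- W) = (\<integral>x. indicator (- W) x \<partial>E n (first_obs n \<omega>))"
        by (simp add: space_kernel_first_obs[OF E])
      also have "\<dots> \<le> (\<integral>x. g x \<partial>E n (first_obs n \<omega>))"
      proof (rule integral_mono[OF _ _ gW])
        show "integrable (E n (first_obs n \<omega>)) (indicator (- W) :: 't \<Rightarrow> real)"
          using W' by (intro integrable_const_bound[where B = 1]) (auto simp: indicator_def)
        show "integrable (E n (first_obs n \<omega>)) g"
          using g(1) B by (intro integrable_const_bound[where B = B]) (auto simp: measurable_cong_sets[OF sets_kernel_first_obs[OF E] refl])
      qed
      finally show ?thesis .
    qed
    then show ?case
      by (rule tendsto_zero_squeeze[OF _ measure_nonneg elim])
  qed
qed

lemma merge_imp_consistent: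
  assumes "AE z in joint_law P (return borel \<theta>).
    merge_weakly (\<lambda>n. E n (first_obs n (snd z))) (\<lambda>n. return borel \<theta>)"
  shows "weakly_consistent_at P E \<theta>"
proof (rule consistentI_integral)
  fix W :: "'t set" assume "\<theta> \<in> interior W"
  then obtain r where r: "r > 0" "ball \<theta> r \<subseteq> W" by (auto simp: mem_interior)
  \<comment> \<open>A continuous function that vanishes at \<theta> and equals 1 off the ball of
    radius \<open>r\<close>, so it dominates the indicator of the complement of \<open>W\<close> and
    has integral 0 under the point mass.\<close>
  define g where "g x = min 1 (dist \<theta> x / r)" for x
  have gc: "continuous_on UNIV g" unfolding g_def by (intro continuous_intros) (use r in auto)
  have gm: "g \<in> borel_measurable borel" by (rule borel_measurable_continuous_onI[OF gc])
  have gb: "bounded (range g)" by (rule boundedI[of _ 1]) (use r in \<open>auto simp: g_def\<close>)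
  have gW: "indicator (- W) x \<le> g x" for x
  proof (cases "x \<in> W")
    case True then show ?thesis using r(1) by (simp add: g_def)
  next
    case False
    then have "r \<le> dist \<theta> x" using r(2) by force
    then show ?thesis using r(1) False by (simp add: g_def)
  qed
  have "AE \<omega> in iid_law P \<theta>. (\<lambda>n. \<integral>x. g x \<partial>E n (first_obs n \<omega>)) \<longlonglongrightarrow> 0"
    using AE_joint_law_return[OF P assms]
  proof eventually_elim
    case (elim \<omega>)
    have "(\<integral>x. g x \<partial>return borel \<theta>) = 0" by (subst integral_return) (simp_all add: gm, simp add: g_def)
    with elim gc gb have "(\<lambda>n. \<bar>\<integral>x. g x \<partial>E n (first_obs n \<omega>)\<bar>) \<longlonglongrightarrow> 0"
      unfolding merge_weakly_def by fastforce
    then show ?case by (rule tendsto_rabs_zero_cancel)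
  qed
  then show "\<exists>g :: 't \<Rightarrow> real. g \<in> borel_measurable borel \<and> bounded (range g) \<and> (\<forall>x. indicator (- W) x \<le> g x) \<and>
     (AE \<omega> in iid_law P \<theta>. (\<lambda>n. \<integral>x. g x \<partial>E n (first_obs n \<omega>)) \<longlonglongrightarrow> 0)"
    using gm gb gW by blast
qed

end

section \<open>Predictive laws and their weak limits\<close>

context
  fixes P :: "'t::polish_space \<Rightarrow> 'x::polish_space measure"
  assumes P: "P \<in> borel \<rightarrow>\<^sub>M weak_borel"
begin

lemma integral_predictive:
  fixes f :: "(nat \<Rightarrow> 'x) \<Rightarrow> real"
  assumes M: "M \<in> space (subprob_algebra borel)" and f: "continuous_on UNIV f" "bounded (range f)"
  shows "(\<integral>\<omega>. f \<omega> \<partial>predictive P M) = (\<integral>\<theta>. \<integral>\<omega>. f \<omega> \<partial>iid_law P \<theta> \<partial>M)"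
proof -
  obtain B where B: "\<And>x. \<bar>f x\<bar> \<le> B" using f(2) by (auto simp: bounded_iff)
  have sM: "sets M = sets borel" and sp: "subprob_space M" using M by (auto simp: space_subprob_algebra)
  show ?thesis
    unfolding predictive_def
  proof (rule integral_bind[where K = "Pi\<^sub>M UNIV (\<lambda>_. borel)" and B = B and B' = 1])
    show "f \<in> borel_measurable (Pi\<^sub>M UNIV (\<lambda>_. borel))" by (rule borel_measurable_PiM_continuous[OF f(1)]) simp
    show "iid_law P \<in> M \<rightarrow>\<^sub>M subprob_algebra (Pi\<^sub>M UNIV (\<lambda>_. borel))"
      unfolding measurable_cong_sets[OF sM refl] by (rule measurable_prob_algebraD[OF iid_law_measurable[OF P]])
    show "finite_measure M" using sp by (simp add: subprob_space_def)
    show "AE \<theta> in M. emeasure (iid_law P \<theta>) (space (iid_law P \<theta>)) \<le> ennreal 1"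
      by (simp add: prob_space.emeasure_space_1[OF prob_space_iid_law[OF P]])
  qed (rule B)
qed

lemma bounded_integral_iid_law:
  fixes f :: "(nat \<Rightarrow> 'x) \<Rightarrow> real"
  assumes f: "continuous_on UNIV f" "bounded (range f)"
  shows "bounded (range (\<lambda>\<theta>. \<integral>\<omega>. f \<omega> \<partial>iid_law P \<theta>))"
proof -
  obtain B where B: "\<And>x. \<bar>f x\<bar> \<le> B" using f(2) by (auto simp: bounded_iff)
  have "\<bar>\<integral>\<omega>. f \<omega> \<partial>iid_law P \<theta>\<bar> \<le> B" for \<theta>
  proof -
    interpret prob_space "iid_law P \<theta>" by (rule prob_space_iid_law[OF P])
    have fm: "f \<in> borel_measurable (iid_law P \<theta>)"
      unfolding measurable_cong_sets[OF sets_iid_law[OF P] refl]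
      by (rule borel_measurable_PiM_continuous[OF f(1)]) simp
    have "\<bar>\<integral>\<omega>. f \<omega> \<partial>iid_law P \<theta>\<bar> \<le> (\<integral>\<omega>. \<bar>f \<omega>\<bar> \<partial>iid_law P \<theta>)" by (rule integral_abs_bound)
    also have "\<dots> \<le> B" using B fm by (intro integral_le_const integrable_abs integrable_const_bound[where B = B]) auto
    finally show ?thesis .
  qed
  then show ?thesis by (intro boundedI[of _ B]) auto
qed

text \<open>In a metric parameter space sequences suffice, and along a sequence weak convergence of
  the marginals lifts to the infinite products.\<close>

lemma continuous_on_integral_iid_law:
  fixes f :: "(nat \<Rightarrow> 'x) \<Rightarrow> real"
  assumes cP: "continuous_map euclidean weak_topology P" and f: "continuous_on UNIV f" "bounded (range f)"
  shows "continuous_on UNIV (\<lambda>\<theta>. \<integral>\<omega>. f \<omega> \<partial>iid_law P \<theta>)"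
proof (rule continuous_on_sequentiallyI)
  fix u :: "nat \<Rightarrow> 't" and a assume u: "u \<longlonglongrightarrow> a"
  obtain B where B: "\<And>x. \<bar>f x\<bar> \<le> B" using f(2) by (auto simp: bounded_iff)
  have sp: "P \<theta> \<in> space (prob_algebra borel)" for \<theta> using measurable_space[OF P_prob_algebra[OF P]] by simp
  show "(\<lambda>n. \<integral>\<omega>. f \<omega> \<partial>iid_law P (u n)) \<longlonglongrightarrow> (\<integral>\<omega>. f \<omega> \<partial>iid_law P a)"
    unfolding iid_law_def
  proof (rule weak_convergence_PiM[OF sp sp _ f(1) B])
    fix g :: "'x \<Rightarrow> real" assume "continuous_on UNIV g" "bounded (range g)"
    from continuous_on_tendsto_compose[OF continuous_on_integral_weak_topology[OF cP this] u]
    show "(\<lambda>k. \<integral>x. g x \<partial>P (u k)) \<longlonglongrightarrow> (\<integral>x. g x \<partial>P a)" by simp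
  qed
qed

text \<open>Integrating \<open>f\<close> under the predictive law amounts to integrating a bounded
  continuous function of the parameter under the posterior, so concentration at \<theta> carries
  over.\<close>

lemma predictive_tendsto:
  fixes f :: "(nat \<Rightarrow> 'x) \<Rightarrow> real" and \<mu> :: "nat \<Rightarrow> 't measure"
  assumes cP: "continuous_map euclidean weak_topology P" and f: "continuous_on UNIV f" "bounded (range f)"
    and \<mu>: "\<And>n. \<mu> n \<in> space (subprob_algebra borel)"
    and conv: "\<And>U. open U \<Longrightarrow> \<theta> \<in> U \<Longrightarrow> (\<lambda>n. measure (\<mu> n) U) \<longlonglongrightarrow> 1"
  shows "(\<lambda>n. \<integral>\<omega>. f \<omega> \<partial>predictive P (\<mu> n)) \<longlonglongrightarrow> (\<integral>\<omega>. f \<omega> \<partial>iid_law P \<theta>)"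
  unfolding integral_predictive[OF \<mu> f]
  by (rule integral_tendsto_point[OF \<mu> conv continuous_on_integral_iid_law[OF cP f] bounded_integral_iid_law[OF f]])

text \<open>The first two coordinates are independent with equal means, so the product yields a
  nonnegative function of the parameter that vanishes exactly where the mean of \<open>f\<close> is
  \<open>c\<close>. This remains true when \<open>c\<close> is the mean under a different
  parameter.\<close>

lemma integral_iid_law_square:
  fixes f :: "'x \<Rightarrow> real"
  assumes f: "continuous_on UNIV f" "bounded (range f)"
  shows "(\<integral>\<omega>. (f (\<omega> 0) - c) * (f (\<omega> 1) - c) \<partial>iid_law P \<theta>) = ((\<integral>x. f x \<partial>P \<theta>) - c)\<^sup>2"
proof -
  interpret prob_space "P \<theta>" by (rule P_prob[OF P])
  obtain B where B: "\<And>x. \<bar>f x\<bar> \<le> B" using f(2) by (auto simp: bounded_iff)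
  have fm: "f \<in> borel_measurable (P \<theta>)"
    unfolding measurable_cong_sets[OF P_sets[OF P] refl] by (rule borel_measurable_continuous_onI[OF f(1)])
  have fi: "integrable (P \<theta>) f" using B fm by (intro integrable_const_bound[where B = B]) auto
  have "(\<integral>\<omega>. (f (\<omega> 0) - c) * (f (\<omega> 1) - c) \<partial>iid_law P \<theta>) = (\<integral>x. f x - c \<partial>P \<theta>) * (\<integral>x. f x - c \<partial>P \<theta>)"
    unfolding iid_law_def
    by (rule sequence_space.integral_PiM_mult[OF sequence_space_prob[OF P_prob[OF P]]]) (use fi in auto)
  also have "(\<integral>x. f x - c \<partial>P \<theta>) = (\<integral>x. f x \<partial>P \<theta>) - c" using fi by (simp add: prob_space)
  finally show ?thesis by (simp add: power2_eq_square)
qed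

context
  fixes E :: "nat \<Rightarrow> (nat \<Rightarrow> 'x) \<Rightarrow> 't measure"
  assumes E: "\<And>n. E n \<in> sample_space n \<rightarrow>\<^sub>M subprob_algebra borel"
begin

text \<open>Test functions \<open>(f (\<omega> 0) - c) * (f (\<omega> 1) - c)\<close>, with \<open>c\<close> the mean of \<open>f\<close> under \<open>P \<theta>\<close>, turn
  weak convergence of the predictive laws into convergence of the posterior second moments of
  \<open>(\<integral>f \<partial>P \<theta>') - c\<close>; Chebyshev's inequality then handles the subbasic weak neighbourhoods
  of \<open>P \<theta>\<close>.\<close>

lemma predictive_imp_weak_neighborhood:
  assumes cP: "continuous_map euclidean weak_topology P"
    and conv: "\<And>f :: (nat \<Rightarrow> 'x) \<Rightarrow> real. continuous_on UNIV f \<Longrightarrow> bounded (range f) \<Longrightarrow>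
      AE \<omega> in iid_law P \<theta>. (\<lambda>n. \<integral>\<eta>. f \<eta> \<partial>predictive P (E n (first_obs n \<omega>))) \<longlonglongrightarrow> (\<integral>\<eta>. f \<eta> \<partial>iid_law P \<theta>)"
    and U: "openin weak_topology U" and \<theta>U: "P \<theta> \<in> U"
  shows "AE \<omega> in iid_law P \<theta>. (\<lambda>n. measure (E n (first_obs n \<omega>)) {\<theta>'. P \<theta>' \<notin> U}) \<longlonglongrightarrow> 0"
proof -
  have op: "open {\<theta>. P \<theta> \<in> U}" if "openin weak_topology U" for U
    using openin_continuous_map_preimage[OF cP that] by simp
  have meas: "{\<theta>. P \<theta> \<notin> U} \<in> sets borel" if "openin weak_topology U" for U
    using borel_closed[OF closed_Compl[OF op[OF that]]] by (simp add: Compl_eq)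
  note fin = subprob_space.axioms(1)[OF subprob_kernel_first_obs[OF E]]
  note sE = sets_kernel_first_obs[OF E]
  show ?thesis
    using openin_topology_generated_by[OF U[unfolded weak_topology_def]] \<theta>U
  \<comment> \<open>Induction on the way \<open>U\<close> is generated keeps the number of null sets
    finite: an intersection combines two of them, and a possibly uncountable union uses only one
    member containing \<open>P \<theta>\<close>.\<close>
  proof (induction rule: generate_topology_on.induct)
    case Empty then show ?case by simp
  next
    case (Int a b)
    then have o: "openin weak_topology a" "openin weak_topology b"
      by (simp_all add: weak_topology_def openin_topology_generated_by_iff)
    have "AE \<omega> in iid_law P \<theta>. (\<lambda>n. measure (E n (first_obs n \<omega>)) {\<theta>'. P \<theta>' \<notin> a}) \<longlonglongrightarrow> 0"
      "AE \<omega> in iid_law P \<theta>. (\<lambda>n. measure (E n (first_obs n \<omega>)) {\<theta>'. P \<theta>' \<notin> b}) \<longlonglongrightarrow> 0"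
      by (rule Int.IH, use Int.prems in blast)+
    then show ?case
    proof eventually_elim
      case (elim \<omega>)
      from tendsto_add[OF elim] have s: "(\<lambda>n. measure (E n (first_obs n \<omega>)) {\<theta>'. P \<theta>' \<notin> a} +
         measure (E n (first_obs n \<omega>)) {\<theta>'. P \<theta>' \<notin> b}) \<longlonglongrightarrow> 0" by simp
      have "measure (E n (first_obs n \<omega>)) {\<theta>'. P \<theta>' \<notin> a \<inter> b} \<le> measure (E n (first_obs n \<omega>)) {\<theta>'. P \<theta>' \<notin> a} +
         measure (E n (first_obs n \<omega>)) {\<theta>'. P \<theta>' \<notin> b}" for n
      proof -
        have "{\<theta>'. P \<theta>' \<notin> a \<inter> b} = {\<theta>'. P \<theta>' \<notin> a} \<union> {\<theta>'. P \<theta>' \<notin> b}" by auto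
        then show ?thesis using measure_Un_le[of "{\<theta>'. P \<theta>' \<notin> a}" "E n (first_obs n \<omega>)" "{\<theta>'. P \<theta>' \<notin> b}"]
            meas[OF o(1)] meas[OF o(2)] by (simp add: sE)
      qed
      then show ?case by (rule tendsto_zero_squeeze[OF _ measure_nonneg s])
    qed
  next
    case (UN K)
    then obtain k where k: "k \<in> K" "P \<theta> \<in> k" by auto
    have ok: "openin weak_topology k" using UN(1)[OF k(1)] by (simp add: weak_topology_def openin_topology_generated_by_iff)
    have "AE \<omega> in iid_law P \<theta>. (\<lambda>n. measure (E n (first_obs n \<omega>)) {\<theta>'. P \<theta>' \<notin> k}) \<longlonglongrightarrow> 0" by (rule UN.IH[OF k])
    then show ?case
    proof eventually_elim
      case (elim \<omega>)
      have "measure (E n (first_obs n \<omega>)) {\<theta>'. P \<theta>' \<notin> \<Union>K} \<le> measure (E n (first_obs n \<omega>)) {\<theta>'. P \<theta>' \<notin> k}" for n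
        using k(1) by (intro finite_measure.finite_measure_mono[OF fin]) (auto simp: sE intro: meas[OF ok])
      then show ?case by (rule tendsto_zero_squeeze[OF _ measure_nonneg elim])
    qed
  next
    case (Basis s)
    then obtain f :: "'x \<Rightarrow> real" and V where s: "s = {M \<in> space (prob_algebra borel). (\<integral>x. f x \<partial>M) \<in> V}"
      and f: "continuous_on UNIV f" "bounded (range f)" and V: "open V" by auto
    have sp: "P \<theta> \<in> space (prob_algebra borel)" for \<theta> using measurable_space[OF P_prob_algebra[OF P]] by simp
    define c where "c = (\<integral>x. f x \<partial>P \<theta>)"
    have "c \<in> V" using Basis s by (simp add: c_def)
    then obtain e where e: "e > 0" "ball c e \<subseteq> V" using V by (auto simp: open_contains_ball)
    define F where "F \<eta> = (f (\<eta> 0) - c) * (f (\<eta> 1) - c)" for \<eta> :: "nat \<Rightarrow> 'x"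
    have fcomp: "continuous_on UNIV (\<lambda>\<eta>. f (\<eta> i))" for i :: nat
      by (rule continuous_on_compose2[OF f(1) continuous_on_product_coordinates]) auto
    have Fc: "continuous_on UNIV F" unfolding F_def by (intro continuous_intros fcomp)
    obtain B where B: "\<And>x. \<bar>f x\<bar> \<le> B" using f(2) by (auto simp: bounded_iff)
    have fB: "\<bar>f x - c\<bar> \<le> B + \<bar>c\<bar>" for x using B[of x] by linarith
    have Fb: "bounded (range F)"
      by (rule boundedI[of _ "(B + \<bar>c\<bar>) * (B + \<bar>c\<bar>)"])
         (use fB B[THEN order_trans[OF abs_ge_zero]] in \<open>auto simp: F_def abs_mult intro!: mult_mono add_nonneg_nonneg\<close>)
    have IF: "(\<integral>\<eta>. F \<eta> \<partial>iid_law P \<theta>') = ((\<integral>x. f x \<partial>P \<theta>') - c)\<^sup>2" for \<theta>'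
      unfolding F_def by (rule integral_iid_law_square[OF f])
    have gc: "continuous_on UNIV (\<lambda>\<theta>'. ((\<integral>x. f x \<partial>P \<theta>') - c)\<^sup>2)"
      by (intro continuous_intros continuous_on_integral_weak_topology[OF cP f])
    have gb: "bounded (range (\<lambda>\<theta>'. ((\<integral>x. f x \<partial>P \<theta>') - c)\<^sup>2))"
      using bounded_integral_iid_law[OF Fc Fb] by (simp add: IF)
    then obtain C where C: "\<And>\<theta>'. ((\<integral>x. f x \<partial>P \<theta>') - c)\<^sup>2 \<le> C" by (auto simp: bounded_iff)
    have os: "openin weak_topology s" unfolding s by (rule openin_weak_topology_integral[OF f V])
    have "AE \<omega> in iid_law P \<theta>. (\<lambda>n. \<integral>\<eta>. F \<eta> \<partial>predictive P (E n (first_obs n \<omega>))) \<longlonglongrightarrow> 0"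
      using conv[OF Fc Fb] by (simp add: IF c_def)
    then show ?case
    proof eventually_elim
      case (elim \<omega>)
      from tendsto_divide[OF this tendsto_const[of "e\<^sup>2"]]
      have z: "(\<lambda>n. (\<integral>\<eta>. F \<eta> \<partial>predictive P (E n (first_obs n \<omega>))) / e\<^sup>2) \<longlonglongrightarrow> 0" using e by simp
      have "measure (E n (first_obs n \<omega>)) {\<theta>'. P \<theta>' \<notin> s} \<le> (\<integral>\<eta>. F \<eta> \<partial>predictive P (E n (first_obs n \<omega>))) / e\<^sup>2" for n
      proof -
        interpret subprob_space "E n (first_obs n \<omega>)" by (rule subprob_kernel_first_obs[OF E])
        have gm: "(\<lambda>\<theta>'. ((\<integral>x. f x \<partial>P \<theta>') - c)\<^sup>2) \<in> borel_measurable (E n (first_obs n \<omega>))"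
          unfolding measurable_cong_sets[OF sE refl] by (rule borel_measurable_continuous_onI[OF gc])
        have "measure (E n (first_obs n \<omega>)) {\<theta>'. P \<theta>' \<notin> s} = (\<integral>x. indicator {\<theta>'. P \<theta>' \<notin> s} x \<partial>E n (first_obs n \<omega>))"
          by (simp add: space_kernel_first_obs[OF E])
        also have "\<dots> \<le> (\<integral>\<theta>'. ((\<integral>x. f x \<partial>P \<theta>') - c)\<^sup>2 / e\<^sup>2 \<partial>E n (first_obs n \<omega>))"
        proof (rule integral_mono)
          show "integrable (E n (first_obs n \<omega>)) (indicator {\<theta>'. P \<theta>' \<notin> s} :: 't \<Rightarrow> real)"
            by (rule integrable_const_bound[where B = 1, OF _ borel_measurable_indicator])
              (simp_all only: sE meas[OF os], simp add: indicator_def)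
          show "integrable (E n (first_obs n \<omega>)) (\<lambda>\<theta>'. ((\<integral>x. f x \<partial>P \<theta>') - c)\<^sup>2 / e\<^sup>2)"
            using gm C by (intro Bochner_Integration.integrable_divide integrable_const_bound[where B = C]) auto
          show "indicator {\<theta>'. P \<theta>' \<notin> s} \<theta>' \<le> ((\<integral>x. f x \<partial>P \<theta>') - c)\<^sup>2 / e\<^sup>2" for \<theta>'
          proof (cases "P \<theta>' \<in> s")
            case False
            then have "(\<integral>x. f x \<partial>P \<theta>') \<notin> ball c e" using sp[of \<theta>'] e(2) by (auto simp: s)
            then have "e \<le> \<bar>(\<integral>x. f x \<partial>P \<theta>') - c\<bar>" by (simp add: dist_real_def abs_minus_commute)
            then have "e\<^sup>2 \<le> ((\<integral>x. f x \<partial>P \<theta>') - c)\<^sup>2" using e(1) by (metis abs_le_square_iff abs_of_pos)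
            then show ?thesis using e(1) False by simp
          qed simp
        qed
        also have "\<dots> = (\<integral>\<eta>. F \<eta> \<partial>predictive P (E n (first_obs n \<omega>))) / e\<^sup>2"
          by (simp add: integral_predictive[OF kernel_first_obs[OF E] Fc Fb] IF)
        finally show ?thesis .
      qed
      then show ?case by (rule tendsto_zero_squeeze[OF _ measure_nonneg z])
    qed
  qed
qed

text \<open>Continuity of the inverse makes the image of \<open>interior W\<close> the trace on
  \<open>range P\<close> of a weakly open \<open>U\<close>. Hence the parameters outside
  \<open>interior W\<close> are exactly those with \<open>P \<theta>'\<close> outside
  \<open>U\<close>, and neighbourhoods of \<theta> reduce to weak neighbourhoods of
  \<open>P \<theta>\<close>.\<close>

lemma predictive_imp_consistent:
  assumes cP: "continuous_map euclidean weak_topology P"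
    and ci: "continuous_map (subtopology weak_topology (range P)) euclidean (inv P)" and inj: "inj P"
    and conv: "\<And>f :: (nat \<Rightarrow> 'x) \<Rightarrow> real. continuous_on UNIV f \<Longrightarrow> bounded (range f) \<Longrightarrow>
      AE \<omega> in iid_law P \<theta>. (\<lambda>n. \<integral>\<eta>. f \<eta> \<partial>predictive P (E n (first_obs n \<omega>))) \<longlonglongrightarrow> (\<integral>\<eta>. f \<eta> \<partial>iid_law P \<theta>)"
  shows "weakly_consistent_at P E \<theta>"
  unfolding weakly_consistent_at_def
proof (intro ballI impI)
  fix W :: "'t set" assume W: "W \<in> sets borel" "\<theta> \<in> interior W"
  have "openin (subtopology weak_topology (range P)) {M \<in> topspace (subtopology weak_topology (range P)). inv P M \<in> interior W}"
    by (rule openin_continuous_map_preimage[OF ci]) simp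
  then obtain U where U: "openin weak_topology U"
    and eq: "{M \<in> topspace (subtopology weak_topology (range P)). inv P M \<in> interior W} = U \<inter> range P"
    by (auto simp: openin_subtopology)
  have sp: "P \<theta> \<in> space (prob_algebra borel)" for \<theta> using measurable_space[OF P_prob_algebra[OF P]] by simp
  have PU: "P \<theta>' \<in> U \<longleftrightarrow> \<theta>' \<in> interior W" for \<theta>'
  proof -
    have "P \<theta>' \<in> U \<longleftrightarrow> P \<theta>' \<in> U \<inter> range P" by simp
    also have "\<dots> \<longleftrightarrow> \<theta>' \<in> interior W" unfolding eq[symmetric] using sp[of \<theta>'] inj by simp
    finally show ?thesis .
  qed
  have "AE \<omega> in iid_law P \<theta>. (\<lambda>n. measure (E n (first_obs n \<omega>)) {\<theta>'. P \<theta>' \<notin> U}) \<longlonglongrightarrow> 0"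
    by (rule predictive_imp_weak_neighborhood[OF cP conv U]) (use W PU in auto)
  then show "AE \<omega> in iid_law P \<theta>. (\<lambda>n. measure (E n (first_obs n \<omega>)) (- W)) \<longlonglongrightarrow> 0"
  proof eventually_elim
    case (elim \<omega>)
    have "measure (E n (first_obs n \<omega>)) (- W) \<le> measure (E n (first_obs n \<omega>)) {\<theta>'. P \<theta>' \<notin> U}" for n
    proof -
      interpret subprob_space "E n (first_obs n \<omega>)" by (rule subprob_kernel_first_obs[OF E])
      have "{\<theta>'. P \<theta>' \<notin> U} = - interior W" using PU by auto
      then show ?thesis using interior_subset[of W]
        by (intro finite_measure_mono) (auto simp: sets_kernel_first_obs[OF E])
    qed
    then show ?case by (rule tendsto_zero_squeeze[OF _ measure_nonneg elim])
  qed
qed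

end

end

theorem proposition2p1:
  fixes P :: "'t::polish_space \<Rightarrow> 'x::polish_space measure"
    and \<Lambda> :: "'l::topological_space set"
    and Prior :: "'l \<Rightarrow> 't measure"
    and Post :: "nat \<Rightarrow> 'l \<Rightarrow> (nat \<Rightarrow> 'x) \<Rightarrow> 't measure"
    and lhat :: "nat \<Rightarrow> (nat \<Rightarrow> 'x) \<Rightarrow> 'l"
  assumes P_prob: "\<And>\<theta>. P \<theta> \<in> space (prob_algebra borel)"
    and P_inj: "inj P"
    and P_borel: "P \<in> borel \<rightarrow>\<^sub>M weak_borel"
    and prior: "\<And>l. l \<in> \<Lambda> \<Longrightarrow> Prior l \<in> space (prob_algebra borel)"
    and post: "\<And>n l L. prior_at \<Lambda> Prior l L \<Longrightarrow> posterior_version P L n (Post n l)"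
    and lhat_measurable: "\<And>n. lhat n \<in> sample_space n \<rightarrow>\<^sub>M borel"
    and lhat_closure: "\<And>n x. x \<in> space (sample_space n) \<Longrightarrow> lhat n x \<in> closure \<Lambda>"
    and EB_measurable: "\<And>n. eb_posterior Post lhat n \<in> sample_space n \<rightarrow>\<^sub>M subprob_algebra borel"
    and EB_well_defined: "\<And>\<theta>. AE \<omega> in iid_law P \<theta>. \<forall>\<^sub>F n in sequentially.
          (\<exists>L. prior_at \<Lambda> Prior (lhat n (first_obs n \<omega>)) L) \<and> prob_space (eb_posterior Post lhat n (first_obs n \<omega>))"
  shows
    "((\<forall>\<theta>. weakly_consistent_at P (eb_posterior Post lhat) \<theta>) \<longleftrightarrow>
        (\<forall>q Q. q \<in> space (prob_algebra borel) \<and> (\<forall>n. posterior_version P q n (Q n)) \<longrightarrow>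
           (AE z in joint_law P q.
              merge_weakly (\<lambda>n. eb_posterior Post lhat n (first_obs n (snd z))) (\<lambda>n. Q n (first_obs n (snd z))))))
     \<and>
     (continuous_map euclidean weak_topology P \<and>
      continuous_map (subtopology weak_topology (range P)) euclidean (inv P) \<longrightarrow>
        ((\<forall>\<theta>. weakly_consistent_at P (eb_posterior Post lhat) \<theta>) \<longleftrightarrow>
           (\<forall>q Q. q \<in> space (prob_algebra borel) \<and> (\<forall>n. posterior_version P q n (Q n)) \<longrightarrow>
              (AE z in joint_law P q.
                 merge_weakly (\<lambda>n. predictive P (eb_posterior Post lhat n (first_obs n (snd z))))
                              (\<lambda>n. predictive P (Q n (first_obs n (snd z)))))))
        \<and>
        ((\<forall>\<theta>. weakly_consistent_at P (eb_posterior Post lhat) \<theta>) \<longleftrightarrow>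
           (\<forall>q Q. q \<in> space (prob_algebra borel) \<and> (\<forall>n. posterior_version P q n (Q n)) \<longrightarrow>
              (\<forall>f :: (nat \<Rightarrow> 'x) \<Rightarrow> real. continuous_on UNIV f \<and> bounded (range f) \<longrightarrow>
                 (AE z in joint_law P q.
                    (\<lambda>n. \<bar>(\<integral>\<omega>. f \<omega> \<partial>predictive P (eb_posterior Post lhat n (first_obs n (snd z))))
                         - (\<integral>\<omega>. f \<omega> \<partial>predictive P (Q n (first_obs n (snd z))))\<bar>) \<longlonglongrightarrow> 0)))))"
proof -
  define E where "E = eb_posterior Post lhat"
  define consistent where "consistent \<longleftrightarrow> (\<forall>\<theta>. weakly_consistent_at P E \<theta>)"
  define posteriors where "posteriors q Q \<longleftrightarrow> q \<in> space (prob_algebra borel) \<and> (\<forall>n. posterior_version P q n (Q n))" for q Q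
  note PE = P_borel EB_measurable[folded E_def]
  have E_prob: "AE \<omega> in iid_law P \<theta>. \<forall>\<^sub>F n in sequentially. prob_space (E n (first_obs n \<omega>))" for \<theta>
    using EB_well_defined[of \<theta>] unfolding E_def by eventually_elim (auto elim: eventually_mono)
  have Km: "K n (first_obs n \<omega>) \<in> space (subprob_algebra borel)" if "posteriors q K" for q K n \<omega>
  proof -
    have "K n \<in> sample_space n \<rightarrow>\<^sub>M subprob_algebra borel" using that unfolding posteriors_def posterior_version_def by blast
    then show ?thesis by (rule measurable_space) (simp add: space_PiM)
  qed
  note Em = kernel_first_obs[OF PE(2)]
  have both: "AE z in joint_law P q. (\<forall>U. open U \<longrightarrow> fst z \<in> U \<longrightarrow> (\<lambda>n. measure (E n (first_obs n (snd z))) U) \<longlonglongrightarrow> 1)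
      \<and> (\<forall>U. open U \<longrightarrow> fst z \<in> U \<longrightarrow> (\<lambda>n. measure (Q n (first_obs n (snd z))) U) \<longlonglongrightarrow> 1)"
    if "consistent" "posteriors q Q" for q Q
    using that unfolding consistent_def posteriors_def
    by (intro AE_conjI consistent_imp_AE_joint_law[OF PE] doob_consistency[OF P_borel] E_prob P_inj) auto
  have merge: "AE z in joint_law P q. merge_weakly (\<lambda>n. E n (first_obs n (snd z))) (\<lambda>n. Q n (first_obs n (snd z)))"
    if c: "consistent" and Q: "posteriors q Q" for q Q
    using both[OF that]
  proof eventually_elim
    case (elim z)
    show ?case
    proof (rule merge_weaklyI)
      fix g :: "'t \<Rightarrow> real" assume g: "continuous_on UNIV g" "bounded (range g)"
      show "\<exists>l. (\<lambda>n. \<integral>x. g x \<partial>E n (first_obs n (snd z))) \<longlonglongrightarrow> l \<and> (\<lambda>n. \<integral>x. g x \<partial>Q n (first_obs n (snd z))) \<longlonglongrightarrow> l"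
        using elim by (intro exI[of _ "g (fst z)"] conjI integral_tendsto_point g Em Km[OF Q]) auto
    qed
  qed
  have dirac: "posteriors (return borel \<theta>) (\<lambda>_ _. return borel \<theta>)" for \<theta>
    unfolding posteriors_def using posterior_version_return[OF P_borel] return_in_prob_algebra[OF P_borel] by auto
  have a: "consistent \<longleftrightarrow> (\<forall>q Q. posteriors q Q \<longrightarrow>
      (AE z in joint_law P q. merge_weakly (\<lambda>n. E n (first_obs n (snd z))) (\<lambda>n. Q n (first_obs n (snd z)))))"
    (is "_ \<longleftrightarrow> ?A")
  proof
    assume ?A
    then show "consistent" unfolding consistent_def
      using dirac by (intro allI merge_imp_consistent[OF PE]) blast
  qed (use merge in blast)
  define merges where "merges q Q \<longleftrightarrow> (AE z in joint_law P q. merge_weakly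
      (\<lambda>n. predictive P (E n (first_obs n (snd z)))) (\<lambda>n. predictive P (Q n (first_obs n (snd z)))))" for q Q
  define merges_each where "merges_each q Q \<longleftrightarrow> (\<forall>f :: (nat \<Rightarrow> 'x) \<Rightarrow> real. continuous_on UNIV f \<and> bounded (range f) \<longrightarrow>
      (AE z in joint_law P q. (\<lambda>n. \<bar>(\<integral>\<omega>. f \<omega> \<partial>predictive P (E n (first_obs n (snd z))))
        - (\<integral>\<omega>. f \<omega> \<partial>predictive P (Q n (first_obs n (snd z))))\<bar>) \<longlonglongrightarrow> 0))" for q Q
  \<comment> \<open>The two readings of predictive merging differ in whether one null set serves all
    test functions. A cycle settles both: consistency gives the strong reading, which gives the weak
    one, which gives consistency.\<close>
  have b: "(consistent \<longleftrightarrow> (\<forall>q Q. posteriors q Q \<longrightarrow> merges q Q)) \<and> (consistent \<longleftrightarrow> (\<forall>q Q. posteriors q Q \<longrightarrow> merges_each q Q))"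
    if cP: "continuous_map euclidean weak_topology P"
      and ci: "continuous_map (subtopology weak_topology (range P)) euclidean (inv P)"
  proof -
    have 1: "merges q Q" if "consistent" and Q: "posteriors q Q" for q Q
      unfolding merges_def using both[OF that]
    proof eventually_elim
      case (elim z)
      show ?case
      proof (rule merge_weaklyI)
        fix g :: "(nat \<Rightarrow> 'x) \<Rightarrow> real" assume g: "continuous_on UNIV g" "bounded (range g)"
        show "\<exists>l. (\<lambda>n. \<integral>x. g x \<partial>predictive P (E n (first_obs n (snd z)))) \<longlonglongrightarrow> l \<and>
            (\<lambda>n. \<integral>x. g x \<partial>predictive P (Q n (first_obs n (snd z)))) \<longlonglongrightarrow> l"
          using elim by (intro exI[of _ "\<integral>\<omega>. g \<omega> \<partial>iid_law P (fst z)"] conjI predictive_tendsto[OF P_borel cP g] Em Km[OF Q]) auto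
      qed
    qed
    have 2: "merges_each q Q" if "merges q Q" for q Q
      unfolding merges_each_def
    proof (intro allI impI)
      fix f :: "(nat \<Rightarrow> 'x) \<Rightarrow> real" assume f: "continuous_on UNIV f \<and> bounded (range f)"
      show "AE z in joint_law P q. (\<lambda>n. \<bar>(\<integral>\<omega>. f \<omega> \<partial>predictive P (E n (first_obs n (snd z))))
        - (\<integral>\<omega>. f \<omega> \<partial>predictive P (Q n (first_obs n (snd z))))\<bar>) \<longlonglongrightarrow> 0"
        using that unfolding merges_def by eventually_elim (use f in \<open>auto simp: merge_weakly_def\<close>)
    qed
    have 3: "consistent" if *: "\<forall>q Q. posteriors q Q \<longrightarrow> merges_each q Q"
      unfolding consistent_def
    proof (intro allI predictive_imp_consistent[OF PE cP ci P_inj])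
      fix \<theta> and f :: "(nat \<Rightarrow> 'x) \<Rightarrow> real" assume f: "continuous_on UNIV f" "bounded (range f)"
      \<comment> \<open>With a point mass as posterior the predictive law is the fixed law
        \<open>iid_law P \<theta>\<close>, so merging becomes ordinary convergence to it.\<close>
      have I: "(\<integral>\<eta>. f \<eta> \<partial>predictive P (return borel \<theta>)) = (\<integral>\<eta>. f \<eta> \<partial>iid_law P \<theta>)"
      proof -
        have "iid_law P \<in> borel \<rightarrow>\<^sub>M subprob_algebra (Pi\<^sub>M UNIV (\<lambda>_. borel))"
          by (rule measurable_prob_algebraD[OF iid_law_measurable[OF P_borel]])
        then show ?thesis unfolding predictive_def by (subst bind_return) auto
      qed
      have "AE z in joint_law P (return borel \<theta>). (\<lambda>n. \<bar>(\<integral>\<omega>. f \<omega> \<partial>predictive P (E n (first_obs n (snd z))))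
        - (\<integral>\<eta>. f \<eta> \<partial>iid_law P \<theta>)\<bar>) \<longlonglongrightarrow> 0"
        using *[rule_format, OF dirac[of \<theta>], unfolded merges_each_def, rule_format, OF conjI[OF f]] unfolding I .
      from AE_joint_law_return[OF P_borel this]
      show "AE \<omega> in iid_law P \<theta>. (\<lambda>n. \<integral>\<eta>. f \<eta> \<partial>predictive P (E n (first_obs n \<omega>))) \<longlonglongrightarrow> (\<integral>\<eta>. f \<eta> \<partial>iid_law P \<theta>)"
      proof eventually_elim
        case (elim \<omega>)
        then show ?case unfolding snd_conv by (rule LIM_zero_cancel[OF tendsto_rabs_zero_cancel])
      qed
    qed
    show ?thesis using 1 2 3 by blast
  qed
  show ?thesis
    using a b unfolding consistent_def posteriors_def merges_def merges_each_def E_def by blast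
qed

end
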